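(* Fix an integer $d\geq 2$ and a partition $\mu=(\mu_1,\dots,\mu_l)$ of $d$. Then there are integers $C(\mu;k)\in\mathbb{Z}$, $1\leq k\leq \binom{d}{2}$, such that for every genus $g\in\mathbb{Z}_{\geq0}$, \[ H_{g;\mu}=\frac{2}{d!\cdot\mu_1\cdots\mu_l}\sum_{k=1}^{\binom{d}{2}}\Big(C(\mu;k)\cdot k^{d+2g-2+l}\Big). \] Moreover, $C(\mu;k)=0$ for all $k$ with $\binom{d-1}{2}<k<\binom{d}{2}$, $C(\mu;\binom{d}{2})=1$, and, when $d\geq 3$, $C(\mu;\binom{d-1}{2})=-d\cdot\#\{i : \mu_i=1\}$. Consequently, for fixed $\mu$, as $g\to\infty$, \[ H_{g;\mu}=\frac{2}{d!\cdot\mu_1\cdots\mu_l}\binom{d}{2}^{d+2g-2+l}-\frac{2\cdot\#\{i:\mu_i=1\}}{(d-1)!\cdot\mu_1\cdots\mu_l}\binom{d-1}{2}^{d+2g-2+l}+O\Bigg(\bigg(\binom{d-1}{2}-1\bigg)^{d+2g-2+l}\Bigg). \]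
   Context: A partition $\mu=(\mu_1,\dots,\mu_l)$ of $d$ is a weakly decreasing sequence of positive integers with sum $d$; $l=l(\mu)$ is its length. Let $m_j(\mu)=\#\{i:\mu_i=j\}$ and $|\mathrm{Aut}(\mu)|=\prod_{j\geq1} m_j(\mu)!$. For a partition $\mu$ of $d$, $C_\mu\subset S_d$ denotes the conjugacy class of permutations with cycle lengths $\mu_1,\dots,\mu_l$; $C_{(2,1^{d-2})}$ is the class of transpositions. For $g\geq 0$ set $b=2g-2+d+l(\mu)$. The connected simple Hurwitz number is \[ H_{g;\mu}=\frac{|\mathrm{Aut}(\mu)|}{d!}\cdot\#\{(\sigma_1,\dots,\sigma_{b+1}) : \sigma_1\in C_\mu,\ \sigma_i\in C_{(2,1^{d-2})}\ (2\leq i\leq b+1),\ \sigma_1\sigma_2\cdots\sigma_{b+1}=\mathrm{id},\ \langle\sigma_1,\dots,\sigma_{b+1}\rangle \text{ acts transitively on }\{1,\dots,d\}\}. \] (Equivalently, it is the weighted count, with weights $1/|\mathrm{Aut}|$, of connected genus-$g$ branched covers of $\mathbb{P}^1$ of degree $d$ with ramification type $\mu$ over $\infty$ and $b$ further simple branch points, automorphisms required to preserve the preimages of $\infty$.) *)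

theory Defs
  imports
    "HOL-Algebra.Sym_Groups"
    "HOL-Combinatorics.Orbits"
    "HOL-Library.Multiset"
    "HOL-Library.Landau_Symbols"
begin

definition is_partition :: "nat \<Rightarrow> nat list \<Rightarrow> bool" where
  "is_partition d \<mu> \<longleftrightarrow> sorted_wrt (\<ge>) \<mu> \<and> (\<forall>p\<in>set \<mu>. 0 < p) \<and> sum_list \<mu> = d"

text \<open>The product is over the parts that occur; all other multiplicities are 0 and contribute
  the factor \<open>0! = 1\<close>.\<close>

definition aut_size :: "nat list \<Rightarrow> nat" where
  "aut_size \<mu> = (\<Prod>j\<in>set \<mu>. fact (count_list \<mu> j))"

text \<open>The orbits of a permutation on \<open>{1..d}\<close> are the supports of its cycles,
  with fixed points giving cycles of length 1.\<close>

definition cycle_type :: "nat \<Rightarrow> (nat \<Rightarrow> nat) \<Rightarrow> nat multiset" where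
  "cycle_type d \<sigma> = image_mset card (mset_set (Orbits.orbit \<sigma> ` {1..d}))"

definition conj_class :: "nat \<Rightarrow> nat list \<Rightarrow> (nat \<Rightarrow> nat) set" where
  "conj_class d \<mu> = {\<sigma> \<in> carrier (sym_group d). cycle_type d \<sigma> = mset \<mu>}"

definition generates_transitive :: "nat \<Rightarrow> (nat \<Rightarrow> nat) set \<Rightarrow> bool" where
  "generates_transitive d S \<longleftrightarrow>
     (\<forall>x\<in>{1..d}. \<forall>y\<in>{1..d}. \<exists>\<rho>\<in>generate (sym_group d) S. \<rho> x = y)"

text \<open>The tuple \<open>(\<sigma>\<^sub>1, \<dots>, \<sigma>\<^bsub>b+1\<^esub>)\<close> is a list, so \<open>\<sigma>\<^sub>1\<close> is its head.\<close>

definition hurwitz_tuples :: "nat \<Rightarrow> nat list \<Rightarrow> nat \<Rightarrow> (nat \<Rightarrow> nat) list set" where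
  "hurwitz_tuples d \<mu> b =
     {\<sigma>s. length \<sigma>s = b + 1
        \<and> hd \<sigma>s \<in> conj_class d \<mu>
        \<and> (\<forall>\<tau>\<in>set (tl \<sigma>s). \<tau> \<in> conj_class d (2 # replicate (d - 2) 1))
        \<and> foldr (\<circ>) \<sigma>s id = id
        \<and> generates_transitive d (set \<sigma>s)}"

text \<open>The number of simple branch points is \<open>2g - 2 + d + l(\<mu>)\<close>; the summands are ordered so that
  the subtraction on natural numbers does not truncate when \<open>\<mu>\<close> is a nonempty partition.\<close>

definition hurwitz :: "nat \<Rightarrow> nat list \<Rightarrow> real" where
  "hurwitz g \<mu> =
     (let d = sum_list \<mu>; b = 2 * g + d + length \<mu> - 2
      in real (aut_size \<mu>) / fact d * real (card (hurwitz_tuples d \<mu> b)))"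

end

theory Submission
  imports Defs "HOL-Library.Function_Algebras" "HOL-Computational_Algebra.Polynomial"
begin

text \<open>Without the transitivity condition, the count is a matrix entry of a power of the Cayley graph
  operator \<open>A\<close> of all transpositions on \<open>S\<^sub>n\<close>. The operator \<open>A\<close> is a sum of commuting
  Jucys--Murphy elements, which by the Hecke relation \<open>J s = s J' - 1\<close> are diagonalizable with
  integral eigenvalues; an induction along \<open>S\<^bsub>n-1\<^esub> \<subseteq> S\<^sub>n\<close> shows that
  the eigenvalues of \<open>A\<close> other than \<open>n choose 2\<close> are at most \<open>(n choose 2) - n\<close>.
  Hence \<open>n!\<close> times the count is an exponential sum \<open>\<Sum>k. c k * k ^ b\<close>, where \<open>c k\<close> is the trace of an
  automorphism of the lattice of integral points of an eigenspace, hence an integer.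

  Splitting off the orbit of a base point expresses the transitive count as the full count minus
  binomial convolutions over the proper invariant subsets \<open>B\<close> containing the base point. The
  convolution for \<open>B\<close> has frequencies up to \<open>(|B| choose 2) + ((n - |B|) choose 2)\<close>, which is at most
  \<open>(n - 1) choose 2\<close>, with equality only if \<open>|B|\<close> is \<open>1\<close> or \<open>n - 1\<close>; such \<open>B\<close> correspond to the fixed
  points of \<open>\<sigma>\<^sub>1\<close>. Since the count vanishes unless the sign of \<open>\<sigma>\<^sub>1\<close> is \<open>(-1) ^ b\<close>, uniqueness of
  exponential sums pairs the frequencies \<open>k\<close> and \<open>-k\<close>, which gives the factor \<open>2\<close>.\<close>

section \<open>Polynomials in a linear operator\<close>

text \<open>The size n of the spectral gap is what makes the second coefficient accessible: (n-1
  choose 2) = (n choose 2) - (n-1) lies strictly inside the gap, so the full count contributes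
  nothing at that frequency, and the coefficient comes from the subtracted convolutions alone. The
  gap cannot be carried through the induction by eigenvalues only. A Jucys--Murphy eigenvalue added
  to an eigenvalue for the smaller set may exceed the bound, and these cases are excluded by looking
  at the eigenvectors, some of which are invariant under all transpositions. Hence the induction
  concerns a spanning set of vectors. The spectral projections have denominators. Since the operator
  commutes with left translations, n! times a single entry of a projection is a trace, and a trace
  on a lattice is integral. The same n! suits the recursion over subsets B: the quotient of n! by
  |B|! (n-|B|)! is a binomial coefficient, so subtracting the convolutions keeps all coefficients
  integral.\<close>

instantiation "fun" :: (type, real_vector) real_vector
begin

definition scaleR_fun :: "real \<Rightarrow> ('a \<Rightarrow> 'b) \<Rightarrow> 'a \<Rightarrow> 'b" where
  "scaleR_fun c f = (\<lambda>x. c *\<^sub>R f x)"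

instance
  by standard (simp_all add: scaleR_fun_def fun_eq_iff algebra_simps)

end

lemma scaleR_fun_apply [simp]: "(c *\<^sub>R f) x = c *\<^sub>R f x"
  by (simp add: scaleR_fun_def)

lemma linear_apply_at: "linear (\<lambda>f :: 'a \<Rightarrow> real. f x)"
  by (rule linearI) simp_all

text \<open>This is p(T) v, evaluated by Horner's scheme.\<close>

definition poly_op :: "('v \<Rightarrow> 'v) \<Rightarrow> real poly \<Rightarrow> 'v \<Rightarrow> 'v :: real_vector" where
  "poly_op T p v = fold_coeffs (\<lambda>a w. a *\<^sub>R v + T w) p 0"

section \<open>Lagrange interpolation at integer nodes\<close>

definition root_poly :: "int set \<Rightarrow> real poly" where
  "root_poly S = (\<Prod>k\<in>S. [:- of_int k, 1:])"

text \<open>Evaluated at an operator annihilated by \<open>root_poly S\<close>, it is the projection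
  onto the eigenspace of k along the other eigenspaces.\<close>

definition lagrange_poly :: "int set \<Rightarrow> int \<Rightarrow> real poly" where
  "lagrange_poly S k = smult (1 / (\<Prod>j\<in>S - {k}. of_int k - of_int j)) (root_poly (S - {k}))"

lemma root_poly_insert: "finite S \<Longrightarrow> k \<notin> S \<Longrightarrow> root_poly (insert k S) = [:- of_int k, 1:] * root_poly S"
  by (simp add: root_poly_def)

lemma root_poly_remove: "finite S \<Longrightarrow> k \<in> S \<Longrightarrow> root_poly S = [:- of_int k, 1:] * root_poly (S - {k})"
  using root_poly_insert[of "S - {k}" k] by (simp add: insert_absorb)

lemma poly_root_poly: "poly (root_poly S) x = (\<Prod>k\<in>S. x - of_int k)"
  by (simp add: root_poly_def poly_prod)

lemma root_poly_dvd: "finite S \<Longrightarrow> R \<subseteq> S \<Longrightarrow> root_poly R dvd root_poly S"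
  unfolding root_poly_def by (rule prod_dvd_prod_subset)

lemma degree_root_poly: "finite S \<Longrightarrow> degree (root_poly S) = card S"
  unfolding root_poly_def by (subst degree_prod_eq_sum_degree) auto

text \<open>Both sides have degree below \<open>card S\<close> and take the value 1 at every node,
  so they coincide.\<close>

lemma sum_lagrange_poly:
  assumes "finite S" "S \<noteq> {}"
  shows "(\<Sum>k\<in>S. lagrange_poly S k) = 1"
proof (rule poly_eqI_degree[where A = "of_int ` S"])
  fix x :: real assume "x \<in> of_int ` S"
  then obtain m where m: "m \<in> S" "x = of_int m" by auto
  have "poly (lagrange_poly S k) x = (if k = m then 1 else 0)" if "k \<in> S" for k
  proof (cases "k = m")
    case True
    have "(\<Prod>j\<in>S - {k}. real_of_int k - of_int j) \<noteq> 0"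
      using assms by (subst prod_zero_iff) auto
    thus ?thesis using True m by (simp add: lagrange_poly_def poly_root_poly)
  next
    case False
    hence "(\<Prod>j\<in>S - {k}. real_of_int m - of_int j) = 0"
      using assms m by (subst prod_zero_iff) auto
    thus ?thesis using False m by (simp add: lagrange_poly_def poly_root_poly)
  qed
  hence "poly (\<Sum>k\<in>S. lagrange_poly S k) x = (\<Sum>k\<in>S. if k = m then 1 else 0)"
    by (simp add: poly_sum)
  thus "poly (\<Sum>k\<in>S. lagrange_poly S k) x = poly 1 x"
    using assms m by simp
next
  have c: "card (real_of_int ` S) = card S"
    by (rule card_image) (auto simp: inj_on_def)
  have pos: "card S > 0" using assms by (simp add: card_gt_0_iff)
  have "degree (\<Sum>k\<in>S. lagrange_poly S k) \<le> card S - 1"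
    using assms by (intro degree_sum_le) (auto simp: lagrange_poly_def degree_root_poly)
  thus "degree (\<Sum>k\<in>S. lagrange_poly S k) < card (real_of_int ` S)"
    using c pos by linarith
  show "degree (1 :: real poly) < card (real_of_int ` S)" using c pos by simp
qed

section \<open>Functional calculus of one linear operator\<close>

context
  fixes T :: "'v \<Rightarrow> 'v :: real_vector"
  assumes T: "linear T"
begin

lemma poly_op_0 [simp]: "poly_op T 0 v = 0"
  by (simp add: poly_op_def)

lemma poly_op_pCons [simp]: "poly_op T (pCons a p) v = a *\<^sub>R v + T (poly_op T p v)"
  by (cases "p = 0 \<and> a = 0") (auto simp: poly_op_def linear_0[OF T])

lemma poly_op_1 [simp]: "poly_op T 1 v = v"
  by (simp add: one_pCons linear_0[OF T])

lemma poly_op_add: "poly_op T (p + q) v = poly_op T p v + poly_op T q v"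
  by (induction p q rule: poly_induct2) (simp_all add: linear_add[OF T] algebra_simps)

lemma poly_op_smult: "poly_op T (smult c p) v = c *\<^sub>R poly_op T p v"
  by (induction p) (simp_all add: linear_scale[OF T] algebra_simps)

lemma linear_poly_op: "linear (poly_op T p)"
proof (induction p)
  case 0
  show ?case by (rule linearI) simp_all
next
  case (pCons a p)
  show ?case
    by (rule linearI)
       (simp_all add: linear_add[OF pCons.IH] linear_scale[OF pCons.IH] linear_add[OF T]
                      linear_scale[OF T] algebra_simps)
qed

lemma poly_op_mult: "poly_op T (p * q) v = poly_op T p (poly_op T q v)"
  by (induction p) (simp_all add: poly_op_add poly_op_smult)

lemma poly_op_diff: "poly_op T (p - q) v = poly_op T p v - poly_op T q v"
  using poly_op_add[of p "smult (-1) q"] poly_op_smult[of "-1" q] by simp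

lemma poly_op_sum: "poly_op T (\<Sum>k\<in>S. p k) v = (\<Sum>k\<in>S. poly_op T (p k) v)"
  by (induction S rule: infinite_finite_induct) (simp_all add: poly_op_add)

lemma poly_op_eigen: "T v = c *\<^sub>R v \<Longrightarrow> poly_op T p v = poly p c *\<^sub>R v"
  by (induction p) (simp_all add: linear_scale[OF T] algebra_simps)

lemma poly_op_commute:
  assumes "linear U" "\<And>v. U (T v) = T (U v)"
  shows "U (poly_op T p v) = poly_op T p (U v)"
  by (induction p) (simp_all add: linear_0 linear_add linear_scale assms)

lemma poly_op_dvd:
  assumes "p dvd q" "poly_op T p v = 0"
  shows "poly_op T q v = 0"
proof -
  from assms(1) obtain r where "q = r * p" by (metis dvd_def mult.commute)
  thus ?thesis using assms(2) linear_0[OF linear_poly_op] by (simp add: poly_op_mult)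
qed

lemma poly_op_root_poly_eigen:
  assumes "finite S" "k \<in> S" "T v = of_int k *\<^sub>R v"
  shows "poly_op T (root_poly S) v = 0"
proof -
  have "poly (root_poly S) (of_int k) = 0" using assms by (auto simp: poly_root_poly)
  thus ?thesis using poly_op_eigen[OF assms(3)] by simp
qed

context
  fixes S :: "int set" and v :: 'v
  assumes S: "finite S" and root: "poly_op T (root_poly S) v = 0"
begin

lemma lagrange_eigen:
  assumes "k \<in> S"
  shows "T (poly_op T (lagrange_poly S k) v) = of_int k *\<^sub>R poly_op T (lagrange_poly S k) v"
proof -
  have "root_poly S = [:- of_int k, 1:] * root_poly (S - {k})"
    using S assms by (rule root_poly_remove)
  hence "T (poly_op T (root_poly (S - {k})) v) = of_int k *\<^sub>R poly_op T (root_poly (S - {k})) v"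
    using root by (simp add: poly_op_diff poly_op_smult linear_0[OF T])
  thus ?thesis by (simp add: lagrange_poly_def poly_op_smult linear_scale[OF T])
qed

lemma lagrange_decomp: "v = (\<Sum>k\<in>S. poly_op T (lagrange_poly S k) v)"
proof (cases "S = {}")
  case True
  thus ?thesis using root by (simp add: root_poly_def)
next
  case False
  have "(\<Sum>k\<in>S. poly_op T (lagrange_poly S k) v) = poly_op T 1 v"
    unfolding poly_op_sum[symmetric] by (simp only: sum_lagrange_poly[OF S False])
  thus ?thesis by simp
qed

text \<open>The source of all exponential sums below: on each eigencomponent of v, a power of T acts
  as the power of an integer.\<close>

lemma funpow_lagrange:
  "(T ^^ b) v = (\<Sum>k\<in>S. of_int k ^ b *\<^sub>R poly_op T (lagrange_poly S k) v)"
proof (induction b)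
  case 0
  show ?case using lagrange_decomp by simp
next
  case (Suc b)
  have "(T ^^ Suc b) v = (\<Sum>k\<in>S. of_int k ^ b *\<^sub>R T (poly_op T (lagrange_poly S k) v))"
    by (simp add: Suc linear_sum[OF T] linear_scale[OF T])
  thus ?case by (simp add: lagrange_eigen mult.commute)
qed

end

end

text \<open>The relation \<open>J s = s J' - 1\<close> of the degenerate affine Hecke algebra: on a \<open>J\<close>-eigenspace for
  the eigenvalue \<open>a\<close>, it forces the eigenvalues of \<open>J'\<close> to be those of \<open>J\<close> or \<open>a \<plusminus> 1\<close>.\<close>

lemma hecke_root_poly:
  fixes J J' s :: "'v \<Rightarrow> 'v :: real_vector"
  assumes lin: "linear J" "linear J'" "linear s"
    and comm: "\<And>v. J (J' v) = J' (J v)"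
    and Js: "\<And>v. J (s v) = s (J' v) - v" and ss: "\<And>v. s (s v) = v"
    and root: "\<And>v. poly_op J (root_poly {-m..m}) v = 0"
    and semisimple: "\<And>(k::int) v. poly_op J' ([:- of_int k, 1:] * [:- of_int k, 1:]) v = 0 \<Longrightarrow>
       poly_op J' [:- of_int k, 1:] v = 0"
  shows "poly_op J' (root_poly {-(m+1)..m+1}) v = 0"
proof -
  note pJ = poly_op_add[OF lin(1)] poly_op_mult[OF lin(1)] 
  note pJ' = poly_op_add[OF lin(2)] poly_op_mult[OF lin(2)] poly_op_smult[OF lin(2)]
  note l = linear_add[OF lin(1)] linear_add[OF lin(2)] linear_add[OF lin(3)]
     linear_diff[OF lin(1)] linear_diff[OF lin(2)] linear_diff[OF lin(3)]
     linear_scale[OF lin(1)] linear_scale[OF lin(2)] linear_scale[OF lin(3)]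
     linear_0[OF lin(1)] linear_0[OF lin(2)] linear_0[OF lin(3)]
  define R where "R = {-(m+1)..m+1}"
  have eig: "poly_op J' (root_poly R) w = 0"
    if a: "a \<in> {-m..m}" and w: "J w = of_int a *\<^sub>R w" for a w
  proof -
    have JJ': "J (poly_op J' p y) = poly_op J' p (J y)" for p y
      by (rule poly_op_commute[OF lin(2) lin(1) comm])
    \<comment> \<open>A polynomial in J is moved past s one linear factor at a time. Commuting J
      past s leaves a term -u', where u' = J' u - a u; since J u = a u, this term turns the
      remaining -J u into -J' u.\<close>
    have step: "poly_op J (root_poly S * [:- of_int a, 1:]) (s y) =
       s (poly_op J' (root_poly S) (poly_op J' [:- of_int a, 1:] y)) - poly_op J' (root_poly S) y"
      if S: "finite S" and y: "J y = of_int a *\<^sub>R y" for S y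
      using S
    proof (induction S)
      case empty
      show ?case
        using y lin by (simp add: root_poly_def poly_op_smult poly_op_pCons poly_op_0 l Js ss algebra_simps)
    next
      case (insert b S)
      define u where "u = poly_op J' (root_poly S) y"
      define u' where "u' = poly_op J' (root_poly S) (poly_op J' [:- of_int a, 1:] y)"
      have Ju: "J u = of_int a *\<^sub>R u" using y by (simp add: u_def JJ' linear_scale[OF linear_poly_op[OF lin(2)]])
      have u': "u' = J' u - of_int a *\<^sub>R u"
        unfolding u_def u'_def poly_op_mult[OF lin(2), symmetric]
        using lin(2) by (simp add: poly_op_diff poly_op_smult poly_op_pCons poly_op_mult algebra_simps)
      have "poly_op J (root_poly (insert b S) * [:- of_int a, 1:]) (s y)
          = poly_op J [:- of_int b, 1:] (poly_op J (root_poly S * [:- of_int a, 1:]) (s y))"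
        unfolding root_poly_insert[OF insert.hyps] mult.assoc by (rule poly_op_mult[OF lin(1)])
      also have "\<dots> = poly_op J [:- of_int b, 1:] (s u' - u)"
        by (simp only: insert.IH u_def u'_def)
      also have "\<dots> = s (J' u') - u' - J u - of_int b *\<^sub>R (s u' - u)"
        using lin(1) by (simp add: poly_op_0 poly_op_pCons l Js)
      also have "\<dots> = s (J' u' - of_int b *\<^sub>R u') - (J' u - of_int b *\<^sub>R u)"
        by (simp add: u' Ju l algebra_simps)
      also have "J' u' - of_int b *\<^sub>R u' =
         poly_op J' (root_poly (insert b S)) (poly_op J' [:- of_int a, 1:] y)"
        unfolding root_poly_insert[OF insert.hyps] u'_def using lin(2)
        by (simp add: poly_op_0 poly_op_pCons poly_op_mult poly_op_diff poly_op_smult l)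
      also have "J' u - of_int b *\<^sub>R u = poly_op J' (root_poly (insert b S)) y"
        unfolding root_poly_insert[OF insert.hyps] u_def using lin(2)
        by (simp add: poly_op_0 poly_op_pCons poly_op_mult poly_op_diff poly_op_smult l)
      finally show ?case .
    qed
    define q where "q = root_poly ({-m..m} - {a})"
    define t :: "real poly" where "t = [:- of_int a, 1:]"
    have "root_poly {-m..m} = t * q"
      unfolding q_def t_def using a by (intro root_poly_remove) auto
    hence "poly_op J (q * t) y = 0" for y
      using root[of y] by (simp add: mult.commute)
    \<comment> \<open>For this choice of S the left-hand side of \<open>step\<close> is the full
      annihilator of J applied to s y, hence 0.\<close>
    hence qs: "poly_op J' q y = s (poly_op J' (q * t) y)" if "J y = of_int a *\<^sub>R y" for y
      using step[of "{-m..m} - {a}" y] that by (simp only: q_def t_def poly_op_mult[OF lin(2)]) simp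
    \<comment> \<open>The relation \<open>qs\<close> is used at w and at t(J') w, which stays in the
      a-eigenspace because J and J' commute. As s is an involution, it cancels, leaving q (t^2 - 1)
      as an annihilator of w under J'; the roots of t^2 - 1 are a + 1 and a - 1.\<close>
    have "J (poly_op J' t w) = of_int a *\<^sub>R poly_op J' t w"
      using w by (simp add: JJ' linear_scale[OF linear_poly_op[OF lin(2)]])
    hence "poly_op J' (q * t) w = s (poly_op J' (q * t * t) w)"
      using qs[of "poly_op J' t w"] by (simp only: poly_op_mult[OF lin(2)])
    hence "poly_op J' (q * t * t) w = s (poly_op J' (q * t) w)" by (simp add: ss)
    also have "\<dots> = poly_op J' q w" using qs[OF w] by simp
    finally have "poly_op J' (q * t * t + smult (-1) q) w = 0"
      using lin(2) by (simp only: poly_op_add poly_op_smult) simp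
    moreover have "q * t * t + smult (-1) q = [:- of_int (a+1), 1:] * [:- of_int (a-1), 1:] * q"
    proof -
      have "t * t + [:-1:] = [:- of_int (a+1), 1:] * [:- of_int (a-1), 1:]"
        by (simp add: t_def algebra_simps)
      thus ?thesis by (metis (no_types, lifting) distrib_right mult.assoc mult.commute mult_pCons_left add.right_neutral mult_zero_left pCons_0_0)
    qed
    ultimately have z: "poly_op J' ([:- of_int (a+1), 1:] * [:- of_int (a-1), 1:] * q) w = 0" by simp
    define r where "r = root_poly (R - {a+1,a-1})"
    have R1: "root_poly (R - {a+1}) = [:- of_int (a-1), 1:] * r"
      unfolding r_def using root_poly_remove[of "R - {a+1}" "a-1"] a
      by (simp add: R_def Diff_insert2[symmetric])
    have R2: "root_poly R = [:- of_int (a+1), 1:] * root_poly (R - {a+1})"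
      using a by (intro root_poly_remove) (auto simp: R_def)
    \<comment> \<open>If a + 1 or a - 1 is also a root of q, the annihilator has a double root
      there. It is enlarged until both roots are double, and semisimplicity then reduces each square
      to a simple factor.\<close>
    have "q dvd root_poly R" unfolding q_def by (rule root_poly_dvd) (auto simp: R_def)
    hence "[:- of_int (a+1), 1:] * [:- of_int (a-1), 1:] * q dvd
       [:- of_int (a+1), 1:] * [:- of_int (a-1), 1:] * ([:- of_int (a+1), 1:] * ([:- of_int (a-1), 1:] * r))"
      unfolding R1[symmetric] R2[symmetric] by (rule mult_dvd_mono[OF dvd_refl])
    from poly_op_dvd[OF lin(2) this z]
    have "poly_op J' ([:- of_int (a+1), 1:] * [:- of_int (a+1), 1:] *
            ([:- of_int (a-1), 1:] * ([:- of_int (a-1), 1:] * r))) w = 0"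
      by (simp only: mult_ac)
    hence "poly_op J' [:- of_int (a+1), 1:] (poly_op J' ([:- of_int (a-1), 1:] * ([:- of_int (a-1), 1:] * r)) w) = 0"
      unfolding poly_op_mult[OF lin(2), of "[:- of_int (a+1), 1:] * [:- of_int (a+1), 1:]"] by (rule semisimple)
    hence "poly_op J' ([:- of_int (a-1), 1:] * [:- of_int (a-1), 1:] * ([:- of_int (a+1), 1:] * r)) w = 0"
      unfolding poly_op_mult[OF lin(2), symmetric] by (simp only: mult_ac)
    hence "poly_op J' [:- of_int (a-1), 1:] (poly_op J' ([:- of_int (a+1), 1:] * r) w) = 0"
      unfolding poly_op_mult[OF lin(2), of "[:- of_int (a-1), 1:] * [:- of_int (a-1), 1:]"] by (rule semisimple)
    thus ?thesis
      unfolding R2 R1 poly_op_mult[OF lin(2), symmetric] by (simp only: mult_ac)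
  qed
  have "poly_op J' (root_poly R) v = (\<Sum>a\<in>{-m..m}. poly_op J' (root_poly R) (poly_op J (lagrange_poly {-m..m} a) v))"
    by (subst lagrange_decomp[OF lin(1) _ root[of v]]) (simp_all add: linear_sum[OF linear_poly_op[OF lin(2)]])
  also have "\<dots> = 0"
    using lagrange_eigen[OF lin(1) _ root[of v]] by (intro sum.neutral ballI eig) auto
  finally show ?thesis by (simp add: R_def)
qed

section \<open>The spectrum of the transposition sum\<close>

definition transps :: "'a set \<Rightarrow> ('a \<Rightarrow> 'a) set" where
  "transps X = {transpose a b |a b. a \<in> X \<and> b \<in> X \<and> a \<noteq> b}"

text \<open>The argument ranges over all maps, not only over permutations of a fixed set, so the
  operators for different sets X act on one space, and an induction over X needs no restriction of
  functions.\<close>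

definition shift :: "('a \<Rightarrow> 'a) \<Rightarrow> (('a \<Rightarrow> 'a) \<Rightarrow> real) \<Rightarrow> ('a \<Rightarrow> 'a) \<Rightarrow> real" where
  "shift \<tau> f = (\<lambda>\<sigma>. f (\<sigma> \<circ> \<tau>))"

definition shift_sum :: "('a \<Rightarrow> 'a) set \<Rightarrow> (('a \<Rightarrow> 'a) \<Rightarrow> real) \<Rightarrow> ('a \<Rightarrow> 'a) \<Rightarrow> real" where
  "shift_sum P f = (\<lambda>\<sigma>. \<Sum>\<tau>\<in>P. f (\<sigma> \<circ> \<tau>))"

text \<open>\<open>shift_sum (star Y z)\<close> is the Jucys--Murphy element that is added when z
  joins Y.\<close>

definition star :: "'a set \<Rightarrow> 'a \<Rightarrow> ('a \<Rightarrow> 'a) set" where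
  "star Y z = (\<lambda>y. transpose y z) ` Y"

lemma finite_transps: "finite X \<Longrightarrow> finite (transps X)"
  unfolding transps_def by (rule finite_subset[of _ "(\<lambda>(a, b). transpose a b) ` (X \<times> X)"]) auto

lemma transps_permutes: "\<tau> \<in> transps X \<Longrightarrow> \<tau> permutes X"
  by (auto simp: transps_def permutes_swap_id)

lemma transps_involution: "\<tau> \<in> transps X \<Longrightarrow> \<tau> \<circ> \<tau> = id"
  by (auto simp: transps_def)

lemma star_subset_transps: "z \<notin> Y \<Longrightarrow> star Y z \<subseteq> transps (insert z Y)"
  by (auto simp: star_def transps_def)

lemma transps_mono: "X \<subseteq> Y \<Longrightarrow> transps X \<subseteq> transps Y"
  by (auto simp: transps_def)

lemma transps_insert: "transps (insert z Y) = transps Y \<union> star (Y - {z}) z"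
proof -
  have "transpose z b \<in> star (Y - {z}) z" if "b \<in> Y" "b \<noteq> z" for b
    using that transpose_commute[of z b] by (auto simp: star_def)
  thus ?thesis by (auto simp: transps_def star_def)
qed

lemma inj_on_star: "z \<notin> Y \<Longrightarrow> inj_on (\<lambda>y. transpose y z) Y"
  by (rule inj_onI) (metis transpose_apply_second)

lemma transps_star_disjoint: "z \<notin> Y \<Longrightarrow> transps Y \<inter> star Y z = {}"
proof -
  assume z: "z \<notin> Y"
  have "\<tau> z = z" if "\<tau> \<in> transps Y" for \<tau>
    using that z by (auto simp: transps_def transpose_def)
  moreover have "\<tau> z \<noteq> z" if "\<tau> \<in> star Y z" for \<tau>
    using that z by (auto simp: star_def)
  ultimately show ?thesis by blast
qed

lemma shift_sum_star: "z \<notin> Y \<Longrightarrow> shift_sum (star Y z) f \<sigma> = (\<Sum>y\<in>Y. f (\<sigma> \<circ> transpose y z))"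
  unfolding shift_sum_def star_def by (subst sum.reindex) (simp_all add: inj_on_star)

lemma shift_sum_transps_insert:
  assumes "finite Y" "z \<notin> Y"
  shows "shift_sum (transps (insert z Y)) f = shift_sum (transps Y) f + shift_sum (star Y z) f"
  using assms transps_star_disjoint[OF assms(2)]
  by (auto simp: fun_eq_iff shift_sum_def transps_insert finite_transps star_def intro!: sum.union_disjoint)

lemma card_star: "z \<notin> Y \<Longrightarrow> card (star Y z) = card Y"
  unfolding star_def by (simp add: card_image inj_on_star)

lemma choose_two_Suc: "Suc n choose 2 = (n choose 2) + n"
  by (simp add: numeral_2_eq_2)

lemma card_transps: "finite X \<Longrightarrow> card (transps X) = card X choose 2"
proof (induction X rule: finite_induct)
  case empty
  show ?case by (simp add: transps_def)
next
  case (insert z Y)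
  have "card (transps (insert z Y)) = card (transps Y) + card (star Y z)"
    using insert transps_star_disjoint[of z Y]
    by (subst transps_insert) (simp add: card_Un_disjoint finite_transps star_def)
  thus ?case using insert by (simp add: card_star choose_two_Suc)
qed

lemma linear_shift: "linear (shift \<tau>)"
  by (rule linearI) (simp_all add: shift_def fun_eq_iff)

lemma linear_shift_sum: "linear (shift_sum P)"
  by (rule linearI) (simp_all add: shift_sum_def fun_eq_iff sum.distrib sum_distrib_left)

section \<open>Commutation from invariance under conjugation\<close>

lemma conj_transpose:
  assumes "bij p"
  shows "p \<circ> transpose a b \<circ> inv' p = transpose (p a) (p b)"
proof
  fix x
  obtain y where y: "x = p y" using bij_is_surj[OF assms] by (metis surj_def)
  have "inv' p x = y" by (simp add: y assms bij_is_inj)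
  thus "(p \<circ> transpose a b \<circ> inv' p) x = transpose (p a) (p b) x"
    using bij_is_inj[OF assms] by (simp add: y transpose_def inj_eq)
qed

lemma conj_transps: "p permutes X \<Longrightarrow> (\<lambda>\<tau>. p \<circ> \<tau> \<circ> inv' p) ` transps X = transps X"
proof -
  assume p: "p permutes X"
  have *: "(\<lambda>\<tau>. p \<circ> \<tau> \<circ> inv' p) ` transps X \<subseteq> transps X" if "p permutes X" for p
  proof
    fix \<tau> assume "\<tau> \<in> (\<lambda>\<tau>. p \<circ> \<tau> \<circ> inv' p) ` transps X"
    then obtain a b where ab: "a \<in> X" "b \<in> X" "a \<noteq> b" "\<tau> = p \<circ> transpose a b \<circ> inv' p"
      by (auto simp: transps_def)
    have "\<tau> = transpose (p a) (p b)" unfolding ab by (rule conj_transpose[OF permutes_bij[OF that]])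
    moreover have "p a \<in> X" "p b \<in> X" "p a \<noteq> p b"
      using ab permutes_in_image[OF that] permutes_inj[OF that] by (auto simp: inj_eq)
    ultimately show "\<tau> \<in> transps X" unfolding transps_def by blast
  qed
  have "\<tau> \<in> (\<lambda>\<tau>. p \<circ> \<tau> \<circ> inv' p) ` transps X" if "\<tau> \<in> transps X" for \<tau>
  proof
    show "inv' p \<circ> \<tau> \<circ> p \<in> transps X"
      using *[OF permutes_inv[OF p]] that permutes_inv_inv[OF p] by auto
    show "\<tau> = p \<circ> (inv' p \<circ> \<tau> \<circ> p) \<circ> inv' p"
      using permutes_inverses[OF p] by (simp add: fun_eq_iff)
  qed
  thus ?thesis using *[OF p] by blast
qed

lemma conj_star: "p permutes Y \<Longrightarrow> z \<notin> Y \<Longrightarrow> (\<lambda>\<tau>. p \<circ> \<tau> \<circ> inv' p) ` star Y z = star Y z"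
proof -
  assume p: "p permutes Y" and z: "z \<notin> Y"
  have "p \<circ> transpose y z \<circ> inv' p = transpose (p y) z" for y
    using permutes_not_in[OF p z] by (simp only: conj_transpose[OF permutes_bij[OF p]])
  hence "(\<lambda>\<tau>. p \<circ> \<tau> \<circ> inv' p) ` star Y z = (\<lambda>y. transpose y z) ` p ` Y"
    by (simp add: star_def image_image)
  thus ?thesis by (simp add: star_def permutes_image[OF p])
qed

lemma inj_conj: "bij p \<Longrightarrow> inj_on (\<lambda>\<tau>. p \<circ> \<tau> \<circ> inv' p) P"
proof (rule inj_onI)
  fix x y assume p: "bij p" and eq: "p \<circ> x \<circ> inv' p = p \<circ> y \<circ> inv' p"
  have "x u = y u" for u
    using fun_cong[OF eq, of "p u"] p by (simp add: bij_is_inj inj_eq)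
  thus "x = y" by (simp add: fun_eq_iff)
qed

lemma shift_sum_shift:
  assumes "bij p" "(\<lambda>\<tau>. p \<circ> \<tau> \<circ> inv' p) ` P = P"
  shows "shift_sum P (shift p f) = shift p (shift_sum P f)"
proof
  fix \<sigma>
  have "shift p (shift_sum P f) \<sigma> = (\<Sum>\<tau>\<in>P. f (\<sigma> \<circ> (p \<circ> \<tau> \<circ> inv' p) \<circ> p))"
    using inv_o_cancel[OF bij_is_inj[OF assms(1)]] by (simp add: shift_def shift_sum_def comp_assoc)
  also have "\<dots> = (\<Sum>\<tau>\<in>(\<lambda>\<tau>. p \<circ> \<tau> \<circ> inv' p) ` P. f (\<sigma> \<circ> \<tau> \<circ> p))"
    by (simp add: sum.reindex inj_conj[OF assms(1)])
  also have "\<dots> = shift_sum P (shift p f) \<sigma>"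
    by (simp add: assms(2) shift_def shift_sum_def)
  finally show "shift_sum P (shift p f) \<sigma> = shift p (shift_sum P f) \<sigma>" by simp
qed

lemma shift_sum_eq: "finite P \<Longrightarrow> shift_sum P f = (\<Sum>\<tau>\<in>P. shift \<tau> f)"
  by (induction P rule: finite_induct) (auto simp: fun_eq_iff shift_sum_def shift_def)

lemma shift_sum_commute:
  assumes "finite Q" "\<And>q. q \<in> Q \<Longrightarrow> bij q" "\<And>q. q \<in> Q \<Longrightarrow> (\<lambda>\<tau>. q \<circ> \<tau> \<circ> inv' q) ` P = P"
  shows "shift_sum P (shift_sum Q f) = shift_sum Q (shift_sum P f)"
  using assms by (simp add: shift_sum_eq[OF assms(1)] linear_sum[OF linear_shift_sum] shift_sum_shift)

text \<open>Functions on all maps are handled coset by coset: the form is the inner product on the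
  coset of \<open>\<sigma>\<close> under the group of permutations of \<open>X\<close>.\<close>

definition coset_ip :: "'a set \<Rightarrow> ('a \<Rightarrow> 'a) \<Rightarrow> (('a \<Rightarrow> 'a) \<Rightarrow> real) \<Rightarrow> (('a \<Rightarrow> 'a) \<Rightarrow> real) \<Rightarrow> real" where
  "coset_ip X \<sigma> f g = (\<Sum>\<rho> | \<rho> permutes X. f (\<sigma> \<circ> \<rho>) * g (\<sigma> \<circ> \<rho>))"

lemma coset_ip_eq_0:
  assumes "finite X" "coset_ip X \<sigma> f f = 0"
  shows "f \<sigma> = 0"
proof -
  have "\<forall>\<rho>\<in>{\<rho>. \<rho> permutes X}. f (\<sigma> \<circ> \<rho>) * f (\<sigma> \<circ> \<rho>) = 0"
    using assms finite_permutations[OF assms(1)] unfolding coset_ip_def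
    by (subst sum_nonneg_eq_0_iff[symmetric]) auto
  thus ?thesis using permutes_id[of X] by (auto dest!: spec[of _ id])
qed

lemma coset_ip_shift:
  assumes "\<tau> \<in> transps X"
  shows "coset_ip X \<sigma> (shift \<tau> f) g = coset_ip X \<sigma> f (shift \<tau> g)"
  unfolding coset_ip_def shift_def
  by (rule sum.reindex_bij_witness[where i = "\<lambda>\<rho>. \<rho> \<circ> \<tau>" and j = "\<lambda>\<rho>. \<rho> \<circ> \<tau>"])
     (use assms transps_involution[OF assms] in
       \<open>auto simp: comp_assoc intro: permutes_compose transps_permutes\<close>)

lemma coset_ip_add: "coset_ip X \<sigma> (f + g) h = coset_ip X \<sigma> f h + coset_ip X \<sigma> g h"
  by (simp add: coset_ip_def sum.distrib algebra_simps)

lemma coset_ip_diff: "coset_ip X \<sigma> (f - g) h = coset_ip X \<sigma> f h - coset_ip X \<sigma> g h"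
  by (simp add: coset_ip_def sum_subtractf algebra_simps)

lemma coset_ip_scale: "coset_ip X \<sigma> (c *\<^sub>R f) h = c * coset_ip X \<sigma> f h"
  by (simp add: coset_ip_def sum_distrib_left algebra_simps)

lemma coset_ip_commute: "coset_ip X \<sigma> f g = coset_ip X \<sigma> g f"
  by (simp add: coset_ip_def mult.commute)

lemma coset_ip_sum: "finite P \<Longrightarrow> coset_ip X \<sigma> (\<Sum>p\<in>P. f p) h = (\<Sum>p\<in>P. coset_ip X \<sigma> (f p) h)"
proof (induction P rule: finite_induct)
  case empty
  show ?case by (simp add: coset_ip_def)
next
  case (insert x F)
  thus ?case by (simp only: sum.insert[OF insert.hyps] coset_ip_add)
qed

lemma coset_ip_shift_sum:
  assumes "finite P" "P \<subseteq> transps X"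
  shows "coset_ip X \<sigma> (shift_sum P f) g = coset_ip X \<sigma> f (shift_sum P g)"
proof -
  have "coset_ip X \<sigma> (shift_sum P f) g = (\<Sum>\<tau>\<in>P. coset_ip X \<sigma> (shift \<tau> f) g)"
    by (simp add: shift_sum_eq assms coset_ip_sum)
  also have "\<dots> = (\<Sum>\<tau>\<in>P. coset_ip X \<sigma> (shift \<tau> g) f)"
    using assms by (intro sum.cong refl) (metis coset_ip_shift coset_ip_commute subsetD)
  also have "\<dots> = coset_ip X \<sigma> (shift_sum P g) f"
    by (simp add: shift_sum_eq assms coset_ip_sum)
  finally show ?thesis by (simp add: coset_ip_commute)
qed

text \<open>A self-adjoint operator T has no proper generalized eigenvectors: for u = (T - k) v, the
  form of u with itself equals the form of (T - k) u = 0 with v. This is done on every coset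
  separately, which gives u = 0 at every argument.\<close>

lemma shift_sum_semisimple:
  assumes X: "finite X" and P: "finite P" "P \<subseteq> transps X"
    and sq: "poly_op (shift_sum P) ([:- of_int k, 1:] * [:- of_int k, 1:]) v = 0"
  shows "poly_op (shift_sum P) [:- of_int k, 1:] v = 0"
proof -
  define u where "u = poly_op (shift_sum P) [:- of_int k, 1:] v"
  have u: "u = shift_sum P v - of_int k *\<^sub>R v"
    by (simp add: u_def poly_op_pCons[OF linear_shift_sum] poly_op_0[OF linear_shift_sum]
        linear_0[OF linear_shift_sum] linear_add[OF linear_shift_sum])
  have Tu: "shift_sum P u - of_int k *\<^sub>R u = 0"
    using sq unfolding poly_op_mult[OF linear_shift_sum] u_def[symmetric]
    by (simp add: poly_op_pCons[OF linear_shift_sum] poly_op_0[OF linear_shift_sum]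
        linear_0[OF linear_shift_sum] linear_add[OF linear_shift_sum])
  have "coset_ip X \<sigma> u u = 0" for \<sigma>
  proof -
    have "coset_ip X \<sigma> u u = coset_ip X \<sigma> (shift_sum P v) u - of_int k * coset_ip X \<sigma> v u"
      by (subst (1) u) (simp add: coset_ip_diff coset_ip_scale)
    also have "\<dots> = coset_ip X \<sigma> (shift_sum P u - of_int k *\<^sub>R u) v"
      using P coset_ip_commute[of X \<sigma> v "shift_sum P u"] coset_ip_commute[of X \<sigma> v u]
      by (simp add: coset_ip_shift_sum coset_ip_diff coset_ip_scale)
    also have "\<dots> = 0" unfolding Tu by (simp add: coset_ip_def)
    finally show ?thesis .
  qed
  hence "u = 0" using coset_ip_eq_0[OF X] by (auto simp: fun_eq_iff)
  thus ?thesis by (simp add: u_def)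
qed

text \<open>The equality case of the triangle inequality: the squared norms of
  \<open>v - shift \<tau> v\<close>, summed over P, equal twice the form of
  \<open>card P *\<^sub>R v - shift_sum P v\<close> with v. The eigenvalue equation makes this 0, so
  every summand vanishes.\<close>

lemma shift_sum_top_eigen:
  assumes X: "finite X" and P: "finite P" "P \<subseteq> transps X"
    and v: "shift_sum P v = of_nat (card P) *\<^sub>R v" and \<tau>: "\<tau> \<in> P"
  shows "shift \<tau> v = v"
proof
  fix \<sigma>
  have sq: "coset_ip X \<sigma> (v - shift \<tau> v) (v - shift \<tau> v) = 2 * (coset_ip X \<sigma> v v - coset_ip X \<sigma> (shift \<tau> v) v)"
    if "\<tau> \<in> P" for \<tau>
  proof -
    have \<tau>: "\<tau> \<in> transps X" using that P by auto
    have "shift \<tau> (shift \<tau> v) = v"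
      using transps_involution[OF \<tau>] by (simp add: shift_def comp_assoc)
    hence "coset_ip X \<sigma> (shift \<tau> v) (shift \<tau> v) = coset_ip X \<sigma> v v"
      by (simp add: coset_ip_shift[OF \<tau>])
    thus ?thesis
      using coset_ip_commute[of X \<sigma> v "v - shift \<tau> v"] coset_ip_commute[of X \<sigma> "shift \<tau> v" "v - shift \<tau> v"]
        coset_ip_commute[of X \<sigma> v "shift \<tau> v"]
      by (simp add: coset_ip_diff)
  qed
  have "(\<Sum>\<tau>\<in>P. coset_ip X \<sigma> (v - shift \<tau> v) (v - shift \<tau> v))
      = 2 * (of_nat (card P) * coset_ip X \<sigma> v v - coset_ip X \<sigma> (shift_sum P v) v)"
    by (simp add: sq shift_sum_eq P coset_ip_sum sum_subtractf sum_distrib_left[symmetric])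
  also have "\<dots> = 0" by (simp add: v coset_ip_scale)
  finally have "\<forall>\<tau>\<in>P. coset_ip X \<sigma> (v - shift \<tau> v) (v - shift \<tau> v) = 0"
    by (subst (asm) sum_nonneg_eq_0_iff[OF P(1)]) (auto simp: coset_ip_def intro: sum_nonneg)
  hence "(v - shift \<tau> v) \<sigma> = 0" using coset_ip_eq_0[OF X] \<tau> by blast
  thus "shift \<tau> v \<sigma> = v \<sigma>" by simp
qed

text \<open>Adding a point x to Y widens the interval of eigenvalues by one on each side. In the
  Hecke relation, J belongs to x over Y, J' to z over Y with x added, and s is the shift by the
  transposition of x and z. The empty star gives the zero operator.\<close>

lemma jucys_murphy_root_poly:
  assumes "finite Y" "z \<notin> Y"
  shows "poly_op (shift_sum (star Y z)) (root_poly {- int (card Y)..int (card Y)}) v = 0"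
  using assms
proof (induction Y arbitrary: z v rule: finite_induct)
  case empty
  have "shift_sum {} v = of_int 0 *\<^sub>R v" by (simp add: shift_sum_def fun_eq_iff)
  hence "poly_op (shift_sum {}) (root_poly {0}) v = 0"
    by (intro poly_op_root_poly_eigen[OF linear_shift_sum]) auto
  thus ?case by (simp add: star_def)
next
  case (insert x Y)
  have xz: "x \<noteq> z" "z \<notin> Y" using insert by auto
  define J where "J = shift_sum (star Y x)"
  define J' where "J' = shift_sum (star (insert x Y) z)"
  define s where "s = shift (transpose x z)"
  have "poly_op J' (root_poly {-(int (card Y) + 1)..int (card Y) + 1}) v = 0"
  proof (rule hecke_root_poly[of J J' s])
    show "linear J" "linear J'" "linear s"
      by (simp_all add: J_def J'_def s_def linear_shift_sum linear_shift)
    show "J (J' v) = J' (J v)" for v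
      unfolding J_def J'_def
    proof (rule shift_sum_commute[symmetric])
      show "finite (star Y x)" using insert by (simp add: star_def)
      fix q assume "q \<in> star Y x"
      hence q: "q permutes insert x Y"
        using star_subset_transps[OF insert.hyps(2)] transps_permutes by blast
      show "bij q" using q by (rule permutes_bij)
      show "(\<lambda>\<tau>. q \<circ> \<tau> \<circ> inv' q) ` star (insert x Y) z = star (insert x Y) z"
        using q insert by (intro conj_star)
    qed
    show "J (s v) = s (J' v) - v" for v
    proof
      fix \<sigma>
      \<comment> \<open>This matches the terms for y in Y. The remaining term of J', with y = x,
        composes two equal transpositions and accounts for the -v.\<close>
      have t: "transpose y x \<circ> transpose x z = transpose x z \<circ> transpose y z" if "y \<in> Y" for y
      proof -
        have "y \<noteq> x" "y \<noteq> z" using that insert by auto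
        thus ?thesis using xz by (auto simp: fun_eq_iff transpose_def)
      qed
      show "J (s v) \<sigma> = (s (J' v) - v) \<sigma>"
        using insert xz by (auto simp: J_def J'_def s_def shift_def shift_sum_star comp_assoc t)
    qed
    show "s (s v) = v" for v by (simp add: s_def shift_def comp_assoc)
    show "poly_op J (root_poly {- int (card Y)..int (card Y)}) v = 0" for v
      unfolding J_def using insert by auto
    show "poly_op J' [:- real_of_int k, 1:] v = 0"
      if "poly_op J' ([:- real_of_int k, 1:] * [:- real_of_int k, 1:]) v = 0" for k v
      using that unfolding J'_def
      by (rule shift_sum_semisimple[rotated 3, of _ _ _ "insert z (insert x Y)"])
         (use insert star_subset_transps[of z "insert x Y"] in \<open>auto simp: star_def\<close>)
  qed
  moreover have "int (card (insert x Y)) = int (card Y) + 1" using insert by simp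
  ultimately show ?case by (simp only: J'_def)
qed

text \<open>A finite set containing the eigenvalues, not the exact set of them. The gap n is sharp
  for n \<ge> 2: the standard representation has eigenvalue (n-1 choose 2) - 1 = (n choose 2) -
  n.\<close>

definition spectrum :: "nat \<Rightarrow> int set" where
  "spectrum n = insert (int (n choose 2)) {- int (n choose 2)..int (n choose 2) - int n}"

text \<open>The operator for \<open>insert z Y\<close> is the one for Y plus the commuting element J
  of z, so each spanning vector for Y is split into its J-components. With m the size of Y, a
  component with eigenvalues k \<le> (m choose 2) - m and j < m respects the new gap. For j = m the
  component is invariant under everything. On vectors invariant over Y, J satisfies a quadratic
  equation, which leaves only j = m and j = -1.\<close>

lemma transps_eigenvectors_span:
  fixes X :: "'a set"
  assumes "finite X"
  shows "v \<in> span ({v. \<forall>\<tau>\<in>transps X. shift \<tau> v = v} \<union>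
      {v. \<exists>k\<in>{- int (card X choose 2)..int (card X choose 2) - int (card X)}.
            shift_sum (transps X) v = of_int k *\<^sub>R v})"
  using assms
proof (induction X arbitrary: v rule: finite_induct)
  case empty
  show ?case by (intro span_base) (simp add: transps_def)
next
  case (insert z Y)
  define E :: "'a set \<Rightarrow> (('a \<Rightarrow> 'a) \<Rightarrow> real) set" where "E = (\<lambda>X. {v. \<forall>\<tau>\<in>transps X. shift \<tau> v = v} \<union>
      {v. \<exists>k\<in>{- int (card X choose 2)..int (card X choose 2) - int (card X)}.
            shift_sum (transps X) v = of_int k *\<^sub>R v})"
  define m where "m = int (card Y)"
  define J where "J = shift_sum (star Y z)"
  define u where "u v j = poly_op J (lagrange_poly {-m..m} j) v" for v j
  have fin: "finite (star Y z)" using insert by (simp add: star_def)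
  have linJ: "linear J" by (simp add: J_def linear_shift_sum)
  have root: "poly_op J (root_poly {-m..m}) v = 0" for v
    unfolding J_def m_def using insert by (intro jucys_murphy_root_poly)
  have card: "int (card (insert z Y) choose 2) = int (card Y choose 2) + m" "int (card (insert z Y)) = m + 1"
    using insert by (simp_all add: choose_two_Suc m_def)
  have eig: "J (u v j) = of_int j *\<^sub>R u v j" if "j \<in> {-m..m}" for v j
    unfolding u_def using lagrange_eigen[OF linJ _ root] that by blast
  \<comment> \<open>Here m is the number of transpositions in the star, so the component is fixed by
    each of them; they generate the rest, by (a b) = (a z)(b z)(a z).\<close>
  have top: "u v m \<in> span (E (insert z Y))" for v
  proof -
    have "J (u v m) = of_nat (card (star Y z)) *\<^sub>R u v m"
      using eig[of m v] insert by (simp add: card_star m_def)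
    hence st: "\<forall>\<tau>\<in>star Y z. shift \<tau> (u v m) = u v m"
      using insert shift_sum_top_eigen[of "insert z Y" "star Y z"] fin star_subset_transps[of z Y]
      unfolding J_def by blast
    have "shift \<tau> (u v m) = u v m" if "\<tau> \<in> transps Y" for \<tau>
    proof -
      from that obtain a b where ab: "\<tau> = transpose a b" "a \<in> Y" "b \<in> Y" "a \<noteq> b"
        by (auto simp: transps_def)
      have "\<tau> = transpose a z \<circ> transpose b z \<circ> transpose a z"
        using ab insert by (auto simp: fun_eq_iff transpose_def)
      hence "shift \<tau> (u v m) = shift (transpose a z) (shift (transpose b z) (shift (transpose a z) (u v m)))"
        by (simp add: shift_def comp_assoc)
      thus ?thesis using st ab by (simp add: star_def)
    qed
    thus ?thesis
      using st insert by (intro span_base) (auto simp: E_def transps_insert)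
  qed
  have EY: "u v j \<in> span (E (insert z Y))" if v: "v \<in> E Y" and j: "j \<in> {-m..m}" for v j
  proof (cases "\<forall>\<tau>\<in>transps Y. shift \<tau> v = v")
    case True
    have inv: "\<forall>\<tau>\<in>transps Y. shift \<tau> (u v j) = u v j"
    proof
      fix \<tau> assume \<tau>: "\<tau> \<in> transps Y"
      hence "\<tau> permutes Y" by (rule transps_permutes)
      hence "shift \<tau> (J v) = J (shift \<tau> v)" for v
        unfolding J_def using insert by (simp add: shift_sum_shift permutes_bij conj_star)
      thus "shift \<tau> (u v j) = u v j"
        unfolding u_def using True \<tau> by (simp add: poly_op_commute[OF linJ linear_shift])
    qed
    show ?thesis
    proof (cases "j = m")
      case True
      thus ?thesis using top by simp
    next
      case False
      define w where "w = u v j"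
      have Jw: "J w = of_int j *\<^sub>R w" using eig j by (simp add: w_def)
      have winv: "w (\<sigma> \<circ> transpose a b) = w \<sigma>" if "a \<in> Y" "b \<in> Y" "a \<noteq> b" for a b \<sigma>
        using inv that unfolding w_def[symmetric] by (auto simp: transps_def shift_def fun_eq_iff)
      \<comment> \<open>In the double sum, equal indices give m copies of w. For y different from u,
        (y z)(u z) = (u z)(y u), and w does not see the last factor, so each u is counted m - 1
        times. The resulting equation has roots m and -1.\<close>
      have "J (J w) \<sigma> = m * w \<sigma> + (m - 1) * J w \<sigma>" for \<sigma>
      proof -
        have "J (J w) \<sigma> = (\<Sum>y\<in>Y. \<Sum>u\<in>Y. w (\<sigma> \<circ> transpose y z \<circ> transpose u z))"
          using insert by (simp add: J_def shift_sum_star)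
        also have "\<dots> = (\<Sum>y\<in>Y. w \<sigma> + (\<Sum>u\<in>Y-{y}. w (\<sigma> \<circ> transpose u z)))"
        proof (intro sum.cong refl)
          fix y assume y: "y \<in> Y"
          have "w (\<sigma> \<circ> transpose y z \<circ> transpose u z) = w (\<sigma> \<circ> transpose u z)" if "u \<in> Y - {y}" for u
          proof -
            have "transpose y z \<circ> transpose u z = transpose u z \<circ> transpose y u"
              using that y insert by (auto simp: fun_eq_iff transpose_def)
            hence "w (\<sigma> \<circ> transpose y z \<circ> transpose u z) = w (\<sigma> \<circ> transpose u z \<circ> transpose y u)"
              by (simp add: comp_assoc)
            thus ?thesis using winv y that by auto
          qed
          thus "(\<Sum>u\<in>Y. w (\<sigma> \<circ> transpose y z \<circ> transpose u z)) = w \<sigma> + (\<Sum>u\<in>Y-{y}. w (\<sigma> \<circ> transpose u z))"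
            using y insert by (simp add: sum.remove[of Y y] comp_assoc)
        qed
        also have "\<dots> = (\<Sum>y\<in>Y. w \<sigma> + (J w \<sigma> - w (\<sigma> \<circ> transpose y z)))"
          using insert by (intro sum.cong refl) (simp add: J_def shift_sum_star sum_diff1)
        also have "\<dots> = m * w \<sigma> + (m * J w \<sigma> - J w \<sigma>)"
          using insert by (simp add: sum.distrib sum_subtractf J_def shift_sum_star m_def)
        finally show ?thesis by (simp add: algebra_simps)
      qed
      hence "of_int j * (of_int j * w \<sigma>) = m * w \<sigma> + (m - 1) * (j * w \<sigma>)" for \<sigma>
        by (simp add: Jw linear_scale[OF linJ] mult.assoc)
      hence "(of_int j - of_int m) * (of_int j + 1) * w \<sigma> = 0" for \<sigma>
        by (simp add: algebra_simps)
      hence or: "j = -1 \<or> w = 0" using False by (auto simp: fun_eq_iff) 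
      show ?thesis
      proof (cases "j = -1")
        case True
        have "shift_sum (transps Y) w = of_nat (card Y choose 2) *\<^sub>R w"
          using inv insert.hyps unfolding w_def[symmetric]
          by (simp add: fun_eq_iff shift_def shift_sum_def card_transps)
        hence "shift_sum (transps (insert z Y)) w = of_int (int (card Y choose 2) - 1) *\<^sub>R w"
          using insert Jw True by (simp add: shift_sum_transps_insert J_def[symmetric] algebra_simps)
        \<comment> \<open>The upper bound is attained: (m+1 choose 2) - (m+1) = (m choose 2) -
          1.\<close>
        moreover have "int (card Y choose 2) - 1 \<in> {- int (card (insert z Y) choose 2)..int (card (insert z Y) choose 2) - int (card (insert z Y))}"
          using j True unfolding card by auto
        ultimately have "w \<in> E (insert z Y)" unfolding E_def by blast
        thus ?thesis unfolding w_def[symmetric] by (rule span_base)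
      next
        case False
        thus ?thesis using or by (simp add: w_def[symmetric] span_zero)
      qed
    qed
  next
    case False
    then obtain k where k: "k \<in> {- int (card Y choose 2)..int (card Y choose 2) - m}"
      and vk: "shift_sum (transps Y) v = of_int k *\<^sub>R v"
      using v by (auto simp: E_def m_def)
    have "J (shift_sum (transps Y) v) = shift_sum (transps Y) (J v)" for v
      unfolding J_def
    proof (rule shift_sum_commute)
      show "finite (transps Y)" using insert by (simp add: finite_transps)
      fix q assume "q \<in> transps Y"
      hence q: "q permutes Y" by (rule transps_permutes)
      show "bij q" using q by (rule permutes_bij)
      show "(\<lambda>\<tau>. q \<circ> \<tau> \<circ> inv' q) ` star Y z = star Y z" using q insert.hyps(2) by (rule conj_star)
    qed
    hence uk: "shift_sum (transps Y) (u v j) = of_int k *\<^sub>R u v j"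
      unfolding u_def using vk
      by (simp add: poly_op_commute[OF linJ linear_shift_sum] linear_scale[OF linear_poly_op[OF linJ]])
    hence ukj: "shift_sum (transps (insert z Y)) (u v j) = of_int (k + j) *\<^sub>R u v j"
      using insert eig[OF j] by (simp add: shift_sum_transps_insert J_def[symmetric] algebra_simps)
    show ?thesis
    \<comment> \<open>As k \<le> (m choose 2) - m and j \<le> m, the bound can fail only for j = m,
      which \<open>top\<close> covers.\<close>
    proof (cases "k + j \<le> int (card Y choose 2) - 1")
      case True
      hence "k + j \<in> {- int (card (insert z Y) choose 2)..int (card (insert z Y) choose 2) - int (card (insert z Y))}"
        using k j unfolding card by auto
      hence "u v j \<in> E (insert z Y)" unfolding E_def using ukj by blast
      thus ?thesis by (rule span_base)
    next
      case False
      hence "j = m" using k j by auto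
      thus ?thesis using top by simp
    qed
  qed
  have "E Y \<subseteq> span (E (insert z Y))"
  proof
    fix v assume v: "v \<in> E Y"
    have "v = (\<Sum>j\<in>{-m..m}. u v j)" unfolding u_def by (rule lagrange_decomp[OF linJ _ root]) simp
    thus "v \<in> span (E (insert z Y))" using EY[OF v] span_sum[of "{-m..m}" "u v"] by metis
  qed
  hence "span (E Y) \<subseteq> span (E (insert z Y))" by (intro span_minimal subspace_span)
  moreover have "v \<in> span (E Y)" unfolding E_def by (rule insert.IH)
  ultimately show ?case unfolding E_def by blast
qed

lemma transps_root_poly:
  assumes X: "finite X"
  shows "poly_op (shift_sum (transps X)) (root_poly (spectrum (card X))) v = 0"
proof (rule linear_eq_0_on_span[OF linear_poly_op[OF linear_shift_sum] _ transps_eigenvectors_span[OF X, of v]])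
  have fin: "finite (spectrum (card X))" by (simp add: spectrum_def)
  fix u assume u: "u \<in> {v. \<forall>\<tau>\<in>transps X. shift \<tau> v = v} \<union>
      {v. \<exists>k\<in>{- int (card X choose 2)..int (card X choose 2) - int (card X)}.
            shift_sum (transps X) v = of_int k *\<^sub>R v}"
  have "shift_sum (transps X) u = of_int (int (card X choose 2)) *\<^sub>R u" if "\<forall>\<tau>\<in>transps X. shift \<tau> u = u"
    using that by (simp add: fun_eq_iff shift_def shift_sum_def card_transps X)
  hence "\<exists>k\<in>spectrum (card X). shift_sum (transps X) u = of_int k *\<^sub>R u"
    using u by (auto simp: spectrum_def)
  thus "poly_op (shift_sum (transps X)) (root_poly (spectrum (card X))) u = 0"
    using poly_op_root_poly_eigen[OF linear_shift_sum fin] by blast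
qed

section \<open>Counting factorizations into transpositions\<close>

text \<open>A subgroup L of the integer functions supported on F is free, by induction on F: the
  values at a point g are the multiples of a least nonzero value, and the functions vanishing at g
  are covered by the induction hypothesis. The coordinates with respect to the basis b are given by
  real weights w, so that they extend linearly to vectors outside the lattice, as the trace
  computation requires.\<close>

lemma lattice_coordinates:
  fixes L :: "('g \<Rightarrow> int) set"
  assumes "finite F"
    and "\<And>v x. v \<in> L \<Longrightarrow> x \<notin> F \<Longrightarrow> v x = 0"
    and "\<And>u v c. u \<in> L \<Longrightarrow> v \<in> L \<Longrightarrow> (\<lambda>x. u x - c * v x) \<in> L"
  shows "\<exists>n b w. (\<forall>i<n::nat. b i \<in> L) \<and>
    (\<forall>v\<in>L. \<forall>i<n. (\<Sum>y\<in>F. w i y * real_of_int (v y)) \<in> \<int>) \<and>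
    (\<forall>v\<in>L. \<forall>x. of_int (v x) = (\<Sum>i<n. (\<Sum>y\<in>F. w i y * of_int (v y)) * of_int (b i x)))"
  using assms
proof (induction F arbitrary: L rule: finite_induct)
  case empty
  show ?case
    by (rule exI[of _ 0]) (use empty.prems(1) in auto)
next
  case (insert g F)
  define L0 where "L0 = {v \<in> L. v g = 0}"
  have supp0: "v x = 0" if "v \<in> L0" "x \<notin> F" for v x
    using that insert.prems(1)[of v x] by (cases "x = g") (auto simp: L0_def)
  have sub0: "(\<lambda>x. u x - c * v x) \<in> L0" if "u \<in> L0" "v \<in> L0" for u v c
    using that insert.prems(2) by (auto simp: L0_def)
  have "\<exists>n b w. (\<forall>i<n::nat. b i \<in> L0) \<and>
    (\<forall>v\<in>L0. \<forall>i<n. (\<Sum>y\<in>F. w i y * real_of_int (v y)) \<in> \<int>) \<and>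
    (\<forall>v\<in>L0. \<forall>x. of_int (v x) = (\<Sum>i<n. (\<Sum>y\<in>F. w i y * of_int (v y)) * of_int (b i x)))"
    by (rule insert.IH) (rule supp0 sub0; assumption)+
  then obtain n :: nat and b w where nbw: "\<And>i. i < n \<Longrightarrow> b i \<in> L0"
    "\<And>v i. v \<in> L0 \<Longrightarrow> i < n \<Longrightarrow> (\<Sum>y\<in>F. w i y * real_of_int (v y)) \<in> \<int>"
    "\<And>v x. v \<in> L0 \<Longrightarrow> real_of_int (v x) = (\<Sum>i<n. (\<Sum>y\<in>F. w i y * of_int (v y)) * of_int (b i x))"
    by blast
  show ?case
  proof (cases "L = L0")
    case True
    define w' where "w' = (\<lambda>i. (w i)(g := 0))"
    have w': "(\<Sum>y\<in>insert g F. w' i y * real_of_int (v y)) = (\<Sum>y\<in>F. w i y * of_int (v y))" for i v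
      using insert.hyps by (auto simp: w'_def intro!: sum.cong)
    show ?thesis
    proof (intro exI[of _ n] exI[of _ b] exI[of _ w'] conjI allI impI ballI)
      show "b i \<in> L" if "i < n" for i using nbw(1)[OF that] True by simp
      show "(\<Sum>y\<in>insert g F. w' i y * real_of_int (v y)) \<in> \<int>" if "v \<in> L" "i < n" for v i
        unfolding w' using that nbw(2) True by simp
      show "real_of_int (v x) = (\<Sum>i<n. (\<Sum>y\<in>insert g F. w' i y * real_of_int (v y)) * real_of_int (b i x))"
        if "v \<in> L" for v x
        unfolding w' by (rule nbw(3)) (use that True in simp)
    qed
  next
    case False
    hence ex: "\<exists>v. v \<in> L \<and> v g \<noteq> 0" by (auto simp: L0_def)
    then obtain v1 where "v1 \<in> L \<and> v1 g \<noteq> 0" by blast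
    \<comment> \<open>The new basis vector p has the smallest nonzero absolute value at g; division
      with remainder then shows that p g divides every value at g.\<close>
    from ex_has_least_nat[of "\<lambda>v. v \<in> L \<and> v g \<noteq> 0", OF this, of "\<lambda>v. nat \<bar>v g\<bar>"]
    obtain p where p: "p \<in> L" "p g \<noteq> 0"
      and pmin: "\<And>v. v \<in> L \<Longrightarrow> v g \<noteq> 0 \<Longrightarrow> nat \<bar>p g\<bar> \<le> nat \<bar>v g\<bar>"
      by blast
    have dvd: "p g dvd v g" if v: "v \<in> L" for v
    proof (rule ccontr)
      assume nd: "\<not> p g dvd v g"
      define r where "r = (\<lambda>x. v x - (v g div p g) * p x)"
      have "r \<in> L" using v p(1) unfolding r_def by (rule insert.prems(2))
      moreover have rg: "r g = v g mod p g" by (simp add: r_def minus_div_mult_eq_mod)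
      moreover have "v g mod p g \<noteq> 0" using nd by (simp add: dvd_eq_mod_eq_0)
      ultimately have "nat \<bar>p g\<bar> \<le> nat \<bar>v g mod p g\<bar>" using pmin[of r] by simp
      thus False using abs_mod_less[OF p(2), of "v g"] by linarith
    qed
    define q where "q v = v g div p g" for v :: "'g \<Rightarrow> int"
    have q: "v g = q v * p g" if "v \<in> L" for v using dvd[OF that] by (simp add: q_def)
    define \<phi> where "\<phi> i v = (\<Sum>y\<in>F. w i y * real_of_int (v y))" for i v
    define v0 where "v0 v = (\<lambda>x. v x - q v * p x)" for v
    have v0: "v0 v \<in> L0" if "v \<in> L" for v
      using insert.prems(2)[OF that p(1)] q[OF that] by (simp add: v0_def L0_def)
    \<comment> \<open>Coordinate n is the multiplier v g / p g. The older coordinates are those of v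
      minus this multiple of p, and the correction is absorbed into the weight at g.\<close>
    define w' where "w' = (\<lambda>i y. if i = n then (if y = g then 1 / of_int (p g) else 0)
                                 else (if y = g then - \<phi> i p / of_int (p g) else w i y))"
    have neF: "y \<noteq> g" if "y \<in> F" for y using that insert.hyps by auto
    have wn: "(\<Sum>y\<in>insert g F. w' n y * real_of_int (v y)) = of_int (q v)" if "v \<in> L" for v
    proof -
      have "(\<Sum>y\<in>F. w' n y * real_of_int (v y)) = 0" by (intro sum.neutral) (simp add: w'_def neF)
      thus ?thesis using insert.hyps p(2) by (simp add: w'_def q[OF that])
    qed
    have wi: "(\<Sum>y\<in>insert g F. w' i y * real_of_int (v y)) = \<phi> i (v0 v)" if "v \<in> L" "i < n" for v i
    proof -
      have "(\<Sum>y\<in>F. w' i y * real_of_int (v y)) = \<phi> i v"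
        unfolding \<phi>_def using that(2) by (intro sum.cong refl) (simp add: w'_def neF)
      moreover have "\<phi> i (v0 v) = \<phi> i v - of_int (q v) * \<phi> i p"
        by (simp add: \<phi>_def v0_def right_diff_distrib sum_subtractf sum_distrib_left mult.left_commute)
      ultimately show ?thesis using insert.hyps p(2) that(2) by (simp add: w'_def q[OF that(1)])
    qed
    show ?thesis
    proof (intro exI[of _ "Suc n"] exI[of _ "b(n := p)"] exI[of _ w'] conjI allI impI ballI)
      show "(b(n := p)) i \<in> L" if "i < Suc n" for i
        using that nbw(1) p by (auto simp: L0_def less_Suc_eq)
      show "(\<Sum>y\<in>insert g F. w' i y * real_of_int (v y)) \<in> \<int>" if "v \<in> L" "i < Suc n" for v i
        using that nbw(2)[OF v0] by (cases "i = n") (auto simp: wn wi \<phi>_def)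
      show "real_of_int (v x) = (\<Sum>i<Suc n. (\<Sum>y\<in>insert g F. w' i y * real_of_int (v y)) * real_of_int ((b(n := p)) i x))"
        if "v \<in> L" for v x
      proof -
        have "(\<Sum>i<n. (\<Sum>y\<in>insert g F. w' i y * real_of_int (v y)) * real_of_int ((b(n := p)) i x))
            = (\<Sum>i<n. \<phi> i (v0 v) * of_int (b i x))"
          using that by (intro sum.cong refl) (simp add: wi)
        also have "\<dots> = of_int (v0 v x)" unfolding \<phi>_def by (rule nbw(3)[OF v0[OF that], symmetric])
        finally show ?thesis using that by (simp only: sum.lessThan_Suc wn) (simp add: v0_def)
      qed
    qed
  qed
qed

section \<open>Words in transpositions and powers of the operator\<close>

definition word_count :: "'a set \<Rightarrow> ('a \<Rightarrow> 'a) \<Rightarrow> nat \<Rightarrow> int" where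
  "word_count X \<sigma> b =
     (\<Sum>\<tau>s | set \<tau>s \<subseteq> transps X \<and> length \<tau>s = b. of_bool (\<sigma> \<circ> foldr (\<circ>) \<tau>s id = id))"

lemma sum_lists_Suc:
  assumes "finite A"
  shows "(\<Sum>xs | set xs \<subseteq> A \<and> length xs = Suc n. f xs) =
         (\<Sum>x\<in>A. \<Sum>xs | set xs \<subseteq> A \<and> length xs = n. f (x # xs))"
proof -
  have "(\<Sum>x\<in>A. \<Sum>xs | set xs \<subseteq> A \<and> length xs = n. f (x # xs)) =
        (\<Sum>(x, xs)\<in>A \<times> {xs. set xs \<subseteq> A \<and> length xs = n}. f (x # xs))"
    by (rule sum.cartesian_product)
  also have "\<dots> = (\<Sum>xs | set xs \<subseteq> A \<and> length xs = Suc n. f xs)"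
    by (rule sum.reindex_bij_witness[where i = "\<lambda>xs. (hd xs, tl xs)" and j = "\<lambda>(x, xs). x # xs"])
       (auto simp: length_Suc_conv)
  finally show ?thesis by simp
qed

lemma sum_lists_0: "(\<Sum>xs | set xs \<subseteq> A \<and> length xs = 0. f xs) = f []"
proof -
  have "{xs. set xs \<subseteq> A \<and> length xs = 0} = {[]}" by auto
  thus ?thesis by simp
qed

definition delta :: "('a \<Rightarrow> 'a) \<Rightarrow> ('a \<Rightarrow> 'a) \<Rightarrow> real" where
  "delta g = (\<lambda>\<sigma>. of_bool (\<sigma> = g))"

lemma funpow_shift_sum_delta:
  assumes "finite X"
  shows "(shift_sum (transps X) ^^ b) (delta id) \<sigma> = of_int (word_count X \<sigma> b)"
proof (induction b arbitrary: \<sigma>)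
  case 0
  show ?case by (simp add: word_count_def sum_lists_0 delta_def del: length_0_conv) (simp add: id_def)
next
  case (Suc b)
  show ?case
    by (simp add: shift_sum_def[of _ "(_ ^^ _) _"] Suc del: id_apply)
      (simp add: word_count_def sum_lists_Suc finite_transps assms comp_def)
qed

lemma poly_op_integral:
  assumes "finite S" "finite P" "\<And>\<sigma>. f \<sigma> \<in> \<int>"
  shows "poly_op (shift_sum P) (root_poly S) f \<sigma> \<in> \<int>"
  using assms(1)
proof (induction S arbitrary: \<sigma> rule: finite_induct)
  case empty
  show ?case using assms by (simp add: root_poly_def poly_op_1[OF linear_shift_sum])
next
  case (insert k S)
  show ?case
    unfolding root_poly_insert[OF insert.hyps] poly_op_mult[OF linear_shift_sum]
    by (simp add: poly_op_pCons[OF linear_shift_sum] poly_op_0[OF linear_shift_sum]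
        linear_0[OF linear_shift_sum])
       (auto simp: shift_sum_def insert.IH intro!: Ints_add Ints_diff Ints_minus Ints_mult Ints_sum)
qed

lemma poly_op_support:
  assumes "\<And>\<sigma>. \<not> \<sigma> permutes X \<Longrightarrow> f \<sigma> = 0" "\<not> \<sigma> permutes X"
  shows "poly_op (shift_sum (transps X)) p f \<sigma> = 0"
  using assms(2)
proof (induction p arbitrary: \<sigma>)
  case 0
  show ?case by (simp add: poly_op_0[OF linear_shift_sum])
next
  case (pCons a p)
  have "\<not> (\<sigma> \<circ> \<tau>) permutes X" if "\<tau> \<in> transps X" for \<tau>
  proof
    assume "(\<sigma> \<circ> \<tau>) permutes X"
    hence "(\<sigma> \<circ> \<tau> \<circ> \<tau>) permutes X" by (rule permutes_compose[OF transps_permutes[OF that]])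
    thus False using transps_involution[OF that] pCons.prems by (simp add: comp_assoc)
  qed
  thus ?case
    using pCons.IH assms(1)[OF pCons.prems]
    by (auto simp: poly_op_pCons[OF linear_shift_sum] shift_sum_def[of _ "poly_op _ _ _"] intro!: sum.neutral)
qed

text \<open>The quantity is the trace, on the eigenspace of \<open>k\<close>, of the shift by \<open>s\<close>. It is an integer
  since this shift preserves the lattice of integral points of the eigenspace.\<close>

lemma shift_trace_integral:
  fixes X :: "'a set"
  assumes X: "finite X" and s: "s permutes X" and k: "k \<in> spectrum (card X)"
  shows "(\<Sum>g | g permutes X. poly_op (shift_sum (transps X)) (lagrange_poly (spectrum (card X)) k) (delta g) (g \<circ> s)) \<in> \<int>"
proof -
  define A where "A = shift_sum (transps X)"
  define S where "S = spectrum (card X)"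
  define G where "G = {g. g permutes X}"
  define P where "P = poly_op A (lagrange_poly S k)"
  have linA: "linear A" by (simp add: A_def linear_shift_sum)
  have linP: "linear P" unfolding P_def by (rule linear_poly_op[OF linA])
  have finS: "finite S" by (simp add: S_def spectrum_def)
  have finG: "finite G" using finite_permutations[OF X] by (simp add: G_def)
  have root: "poly_op A (root_poly S) v = 0" for v
    unfolding A_def S_def by (rule transps_root_poly[OF X])
  define emb where "emb v = (\<lambda>x. real_of_int (v x))" for v :: "('a \<Rightarrow> 'a) \<Rightarrow> int"
  define L where "L = {v. (\<forall>x. x \<notin> G \<longrightarrow> v x = 0) \<and> A (emb v) = of_int k *\<^sub>R emb v}"
  have Lsub: "(\<lambda>x. u x - c * v x) \<in> L" if "u \<in> L" "v \<in> L" for u v c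
  proof -
    have "emb (\<lambda>x. u x - c * v x) = emb u - of_int c *\<^sub>R emb v"
      by (simp add: emb_def fun_eq_iff)
    thus ?thesis using that
      by (simp add: L_def linear_diff[OF linA] linear_scale[OF linA] scaleR_diff_right mult.commute)
  qed
  have "\<exists>n b w. (\<forall>i<n::nat. b i \<in> L) \<and>
    (\<forall>v\<in>L. \<forall>i<n. (\<Sum>y\<in>G. w i y * real_of_int (v y)) \<in> \<int>) \<and>
    (\<forall>v\<in>L. \<forall>x. of_int (v x) = (\<Sum>i<n. (\<Sum>y\<in>G. w i y * of_int (v y)) * of_int (b i x)))"
    using Lsub by (intro lattice_coordinates[OF finG]) (auto simp: L_def)
  then obtain n :: nat and b w where b: "\<And>i. i < n \<Longrightarrow> b i \<in> L"
    and int: "\<And>v i. v \<in> L \<Longrightarrow> i < n \<Longrightarrow> (\<Sum>y\<in>G. w i y * real_of_int (v y)) \<in> \<int>"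
    and rep: "\<And>v x. v \<in> L \<Longrightarrow> real_of_int (v x) = (\<Sum>i<n. (\<Sum>y\<in>G. w i y * of_int (v y)) * of_int (b i x))"
    by blast
  define \<phi> where "\<phi> i f = (\<Sum>y\<in>G. w i y * f y)" for i f
  define D where "D = (\<Prod>j\<in>S - {k}. real_of_int k - of_int j)"
  have D0: "D \<noteq> 0" using finS unfolding D_def by (subst prod_zero_iff) auto
  have Prep: "P (delta g) x = (\<Sum>i<n. \<phi> i (P (delta g)) * of_int (b i x))" if g: "g \<in> G" for g x
  proof -
    \<comment> \<open>\<open>P (delta g)\<close> need not be integral, but D times it is: M arises
      from a polynomial with integer coefficients, so it lies in L. Its expansion in the basis is
      then divided by D.\<close>
    define M where "M = poly_op A (root_poly (S - {k})) (delta g)"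
    have PM: "P (delta g) = (1 / D) *\<^sub>R M"
      unfolding P_def M_def lagrange_poly_def D_def by (rule poly_op_smult[OF linA])
    have "\<exists>v. \<forall>x. M x = of_int (v x)"
    proof -
      have "\<forall>x. \<exists>z. M x = of_int z"
      proof
        fix x
        have "M x \<in> \<int>" unfolding M_def A_def
          using finS X by (intro poly_op_integral) (auto simp: finite_transps delta_def)
        thus "\<exists>z. M x = of_int z" by (elim Ints_cases) blast
      qed
      thus ?thesis by (rule choice)
    qed
    then obtain v where v: "\<And>x. M x = of_int (v x)" by blast
    have Mv: "M = emb v" using v by (simp add: emb_def fun_eq_iff)
    have "M x = 0" if "x \<notin> G" for x
      unfolding M_def A_def using that g by (intro poly_op_support) (auto simp: G_def delta_def)
    hence "\<forall>x. x \<notin> G \<longrightarrow> v x = 0" using v by (metis of_int_eq_0_iff)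
    moreover have "A M = of_int k *\<^sub>R M"
    proof -
      have "M = D *\<^sub>R P (delta g)" using D0 by (simp add: PM)
      thus ?thesis
        using lagrange_eigen[OF linA finS root, of k "delta g"] k
        by (simp add: P_def S_def linear_scale[OF linA] algebra_simps)
    qed
    ultimately have "v \<in> L" by (simp add: L_def Mv)
    from rep[OF this, of x] have "M x = (\<Sum>i<n. \<phi> i M * of_int (b i x))"
      by (simp add: \<phi>_def v)
    hence "P (delta g) x = (\<Sum>i<n. (1 / D * \<phi> i M) * of_int (b i x))"
      by (simp add: PM sum_distrib_left mult.assoc sum_divide_distrib)
    moreover have "\<phi> i (P (delta g)) = 1 / D * \<phi> i M" for i
      by (simp add: \<phi>_def PM sum_divide_distrib)
    ultimately show ?thesis by simp
  qed
  have shift_L: "(\<lambda>x. v (x \<circ> s)) \<in> L" if v: "v \<in> L" for v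
  proof -
    have "x \<in> G" if "x \<circ> s \<in> G" for x
    proof -
      have "x \<circ> s \<circ> inv' s permutes X"
        by (rule permutes_compose[OF permutes_inv[OF s]]) (use that in \<open>simp add: G_def\<close>)
      thus ?thesis using permutes_inv_o[OF s] by (simp add: G_def comp_assoc)
    qed
    hence "\<forall>x. x \<notin> G \<longrightarrow> v (x \<circ> s) = 0" using v by (auto simp: L_def)
    moreover have "A (shift s (emb v)) = shift s (A (emb v))"
      unfolding A_def by (rule shift_sum_shift[OF permutes_bij[OF s] conj_transps[OF s]])
    hence "A (shift s (emb v)) = of_int k *\<^sub>R shift s (emb v)"
      using v by (simp add: L_def linear_scale[OF linear_shift])
    moreover have "emb (\<lambda>x. v (x \<circ> s)) = shift s (emb v)" by (simp add: emb_def shift_def)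
    ultimately show ?thesis by (simp add: L_def)
  qed
  have PL: "P (emb v) = emb v" if v: "v \<in> L" for v
  proof -
    have "poly (lagrange_poly S k) (of_int k) = 1"
      using D0 by (simp add: lagrange_poly_def poly_root_poly D_def)
    thus ?thesis using v poly_op_eigen[OF linA, of "emb v" "of_int k" "lagrange_poly S k"]
      by (simp add: P_def L_def)
  qed
  \<comment> \<open>The trace is moved from the basis of delta functions to the lattice basis. After
    the sums are swapped, the i-th diagonal entry is the i-th coordinate of P applied to the shifted
    basis vector; that vector lies in L and is fixed by P, so the entry is an integer.\<close>
  have "(\<Sum>g\<in>G. P (delta g) (g \<circ> s)) = (\<Sum>g\<in>G. \<Sum>i<n. \<phi> i (P (delta g)) * of_int (b i (g \<circ> s)))"
    by (intro sum.cong refl) (rule Prep)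
  also have "\<dots> = (\<Sum>i<n. \<Sum>g\<in>G. of_int (b i (g \<circ> s)) * \<phi> i (P (delta g)))"
    by (subst sum.swap) (simp add: mult.commute)
  also have "\<dots> = (\<Sum>i<n. \<phi> i (P (emb (\<lambda>x. b i (x \<circ> s)))))"
  proof (intro sum.cong refl)
    fix i assume "i \<in> {..<n}"
    hence bL: "(\<lambda>x. b i (x \<circ> s)) \<in> L" using shift_L b by auto
    have "(\<Sum>g\<in>G. of_int (b i (g \<circ> s)) *\<^sub>R delta g) x = emb (\<lambda>x. b i (x \<circ> s)) x" for x
    proof -
      have "(\<Sum>g\<in>G. of_int (b i (g \<circ> s)) *\<^sub>R delta g) x = (\<Sum>g\<in>G. of_int (b i (g \<circ> s)) * of_bool (x = g))"
        using linear_sum[OF linear_apply_at, of "\<lambda>g. of_int (b i (g \<circ> s)) *\<^sub>R delta g" G x]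
        by (simp add: delta_def)
      also have "\<dots> = (\<Sum>g\<in>G. if g = x then of_int (b i (x \<circ> s)) else 0)"
        by (intro sum.cong) auto
      also have "\<dots> = emb (\<lambda>x. b i (x \<circ> s)) x"
        using finG bL by (auto simp: emb_def L_def)
      finally show ?thesis .
    qed
    hence e: "emb (\<lambda>x. b i (x \<circ> s)) = (\<Sum>g\<in>G. of_int (b i (g \<circ> s)) *\<^sub>R delta g)"
      by (simp add: fun_eq_iff)
    have lin\<phi>: "linear (\<phi> i)"
      by (rule linearI) (simp_all add: \<phi>_def algebra_simps sum.distrib sum_distrib_left)
    show "(\<Sum>g\<in>G. of_int (b i (g \<circ> s)) * \<phi> i (P (delta g))) = \<phi> i (P (emb (\<lambda>x. b i (x \<circ> s))))"
      unfolding e by (simp add: linear_sum[OF linP] linear_sum[OF lin\<phi>] linear_scale[OF linP] linear_scale[OF lin\<phi>])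
  qed
  also have "\<dots> \<in> \<int>"
  proof (intro Ints_sum)
    fix i assume "i \<in> {..<n}"
    hence bL: "(\<lambda>x. b i (x \<circ> s)) \<in> L" and i: "i < n" using shift_L b by auto
    show "\<phi> i (P (emb (\<lambda>x. b i (x \<circ> s)))) \<in> \<int>"
      unfolding PL[OF bL] using int[OF bL i] by (simp add: \<phi>_def emb_def)
  qed
  finally show ?thesis by (simp add: P_def A_def S_def G_def)
qed

text \<open>The coefficient at k is n! times the value at s of the k-component of
  \<open>delta id\<close>, which is the trace shown integral above. At the top frequency the
  component is constant on the group and carries the whole mass 1 of \<open>delta id\<close>, so its
  value is 1/n!.\<close>

lemma word_count_expansion:
  assumes X: "finite X" and s: "s permutes X"
  obtains c :: "int \<Rightarrow> int"
  where "\<And>k. k \<notin> spectrum (card X) \<Longrightarrow> c k = 0" and "c (int (card X choose 2)) = 1"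
    and "\<And>b. fact (card X) * word_count X s b = (\<Sum>k\<in>spectrum (card X). c k * k ^ b)"
proof -
  define A where "A = shift_sum (transps X)"
  define S where "S = spectrum (card X)"
  define G where "G = {g. g permutes X}"
  define C where "C = int (card X choose 2)"
  define P where "P k = poly_op A (lagrange_poly S k)" for k
  have linA: "linear A" by (simp add: A_def linear_shift_sum)
  have finS: "finite S" by (simp add: S_def spectrum_def)
  have CS: "C \<in> S" by (simp add: S_def C_def spectrum_def)
  have finG: "finite G" using finite_permutations[OF X] by (simp add: G_def)
  have cardG: "card G = fact (card X)" using card_permutations[OF refl X] by (simp add: G_def)
  have root: "poly_op A (root_poly S) v = 0" for v
    unfolding A_def S_def by (rule transps_root_poly[OF X])
  note eig = lagrange_eigen[OF linA finS root, folded P_def]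
  have trace: "(\<Sum>g\<in>G. P k (delta g) (g \<circ> s)) = fact (card X) * P k (delta id) s" for k
  proof -
    have "P k (delta g) (g \<circ> s) = P k (delta id) s" if "g \<in> G" for g
    proof -
      \<comment> \<open>Left translation commutes with A, which acts on the right, and carries
        \<open>delta id\<close> to \<open>delta g\<close>; so all n! terms of the trace are
        equal.\<close>
      define U where "U = (\<lambda>(f :: ('a \<Rightarrow> 'a) \<Rightarrow> real) \<sigma>. f (inv' g \<circ> \<sigma>))"
      have linU: "linear U" by (rule linearI) (simp_all add: U_def fun_eq_iff)
      have g: "g permutes X" using that by (simp add: G_def)
      have "inv' g \<circ> \<sigma> = id \<longleftrightarrow> \<sigma> = g" for \<sigma>
      proof
        assume "inv' g \<circ> \<sigma> = id"
        hence "g \<circ> inv' g \<circ> \<sigma> = g" by (simp add: comp_assoc)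
        thus "\<sigma> = g" by (simp add: permutes_inv_o[OF g])
      qed (simp add: permutes_inv_o[OF g])
      hence "delta g = U (delta id)" by (simp add: U_def delta_def)
      moreover have "U (A v) = A (U v)" for v by (simp add: U_def A_def shift_sum_def comp_assoc)
      ultimately have "P k (delta g) = U (P k (delta id))"
        unfolding P_def by (simp add: poly_op_commute[OF linA linU])
      thus ?thesis by (simp add: U_def permutes_inv_o[OF g] comp_assoc[symmetric])
    qed
    thus ?thesis by (simp add: cardG)
  qed
  have int: "fact (card X) * P k (delta id) s \<in> \<int>" if "k \<in> S" for k
    using shift_trace_integral[OF X s, of k] that trace[of k] by (simp add: P_def A_def S_def G_def)
  have "\<exists>c. \<forall>k\<in>S. fact (card X) * P k (delta id) s = of_int (c k)"
    using int by (intro bchoice ballI) (metis Ints_cases)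
  then obtain c where c: "\<And>k. k \<in> S \<Longrightarrow> fact (card X) * P k (delta id) s = of_int (c k)" by blast
  define c' where "c' k = (if k \<in> S then c k else 0)" for k
  have "c' C = 1"
  proof -
    define v where "v = P C (delta id)"
    have inv: "shift \<tau> v = v" if "\<tau> \<in> transps X" for \<tau>
      using eig[OF CS, of "delta id"] that X finite_transps[OF X]
      by (intro shift_sum_top_eigen[of X "transps X"]) (simp_all add: v_def A_def C_def card_transps)
    have const: "v g = v id" if "g permutes X" for g
      using X that
    proof (induction g rule: permutes_rev_induct)
      case (swap a b p)
      show ?case
      proof (cases "a = b")
        case False
        hence "shift (transpose a b) v = v" using swap by (intro inv) (auto simp: transps_def)
        from fun_cong[OF this, of p] have "v (p \<circ> transpose a b) = v p" by (simp only: shift_def)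
        thus ?thesis using swap.IH by (rule trans)
      qed (use swap in simp)
    qed simp
    \<comment> \<open>Total mass satisfies L (A f) = C L f, so it vanishes on every eigenvector
      whose eigenvalue differs from C.\<close>
    define L where "L f = (\<Sum>g\<in>G. f g)" for f :: "('a \<Rightarrow> 'a) \<Rightarrow> real"
    have linL: "linear L" by (rule linearI) (simp_all add: L_def sum.distrib sum_distrib_left)
    have Lshift: "L (shift \<tau> f) = L f" if "\<tau> \<in> transps X" for \<tau> f
      unfolding L_def shift_def
      by (rule sum.reindex_bij_witness[where i = "\<lambda>\<rho>. \<rho> \<circ> \<tau>" and j = "\<lambda>\<rho>. \<rho> \<circ> \<tau>"])
         (use that transps_involution[OF that] in
           \<open>auto simp: comp_assoc G_def intro: permutes_compose transps_permutes\<close>)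
    have LA: "L (A f) = C * L f" for f
      unfolding A_def shift_sum_eq[OF finite_transps[OF X]]
      by (simp add: linear_sum[OF linL] Lshift card_transps X C_def)
    have L0: "L (P k (delta id)) = 0" if "k \<in> S - {C}" for k
      using that LA[of "P k (delta id)"] eig[of k "delta id"] by (simp add: linear_scale[OF linL])
    have "1 = L (delta id)"
      using finG by (simp add: L_def delta_def G_def of_bool_def)
    also have "\<dots> = L (\<Sum>k\<in>S. P k (delta id))"
      using lagrange_decomp[OF linA finS root, of "delta id"] by (simp add: P_def)
    also have "\<dots> = L v"
      using L0 by (subst linear_sum[OF linL], subst sum.remove[OF finS CS]) (simp add: v_def)
    also have "\<dots> = (\<Sum>g\<in>G. v s)" unfolding L_def
      using const s by (intro sum.cong refl) (metis G_def mem_Collect_eq)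
    also have "\<dots> = fact (card X) * v s" by (simp add: cardG)
    finally have "of_int (c C) = (1 :: real)" using c[OF CS] by (simp add: v_def)
    thus ?thesis using CS by (simp add: c'_def)
  qed
  moreover have "fact (card X) * word_count X s b = (\<Sum>k\<in>S. c' k * k ^ b)" for b
  proof -
    have "real_of_int (fact (card X) * word_count X s b) = fact (card X) * (A ^^ b) (delta id) s"
      using funpow_shift_sum_delta[OF X, of b s] by (simp add: A_def)
    also have "\<dots> = (\<Sum>k\<in>S. fact (card X) * (of_int k ^ b * P k (delta id) s))"
      unfolding funpow_lagrange[OF linA finS root] linear_sum[OF linear_apply_at]
      by (simp add: P_def sum_distrib_left)
    also have "\<dots> = (\<Sum>k\<in>S. of_int (c' k * k ^ b))"
      by (intro sum.cong refl) (simp add: c'_def c[symmetric])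
    finally show ?thesis by (simp only: of_int_sum[symmetric] of_int_eq_iff)
  qed
  ultimately show ?thesis by (intro that[of c']) (auto simp: c'_def S_def C_def)
qed

section \<open>Transitive factorizations\<close>

text \<open>Only forward steps are taken. For permutations of a finite set this already gives the
  orbit under the generated group, because an injective map of a finite set into itself is
  onto.\<close>

inductive_set gen_orbit :: "('a \<Rightarrow> 'a) set \<Rightarrow> 'a \<Rightarrow> 'a set" for S x where
  base: "x \<in> gen_orbit S x"
| step: "y \<in> gen_orbit S x \<Longrightarrow> p \<in> S \<Longrightarrow> p y \<in> gen_orbit S x"

lemma gen_orbit_subset:
  assumes "x \<in> B" "\<And>p. p \<in> S \<Longrightarrow> p ` B \<subseteq> B"
  shows "gen_orbit S x \<subseteq> B"
proof
  fix y assume "y \<in> gen_orbit S x"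
  thus "y \<in> B" by induction (use assms in auto)
qed

lemma gen_orbit_image:
  assumes "finite X" "x \<in> X" "\<And>p. p \<in> S \<Longrightarrow> p permutes X" "p \<in> S"
  shows "p ` gen_orbit S x = gen_orbit S x"
proof (rule card_subset_eq)
  have "gen_orbit S x \<subseteq> X"
    using assms by (intro gen_orbit_subset) (auto simp: permutes_image)
  thus "finite (gen_orbit S x)" using assms(1) finite_subset by blast
  show "p ` gen_orbit S x \<subseteq> gen_orbit S x" using assms(4) by (auto intro: gen_orbit.step)
  show "card (p ` gen_orbit S x) = card (gen_orbit S x)"
    using permutes_inj[OF assms(3)[OF assms(4)]] by (intro card_image) (auto intro: inj_on_subset)
qed

text \<open>Used to pass between the letters of a word on X and their restrictions to an invariant
  B; the alternative p y = y allows letters that act trivially on B to be dropped.\<close>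

lemma gen_orbit_mono_on:
  assumes "x \<in> B" "\<And>p. p \<in> S \<Longrightarrow> p ` B \<subseteq> B" "\<And>p y. p \<in> S \<Longrightarrow> y \<in> B \<Longrightarrow> p y = y \<or> (\<exists>q\<in>S'. q y = p y)"
  shows "gen_orbit S x \<subseteq> gen_orbit S' x"
proof
  fix y assume "y \<in> gen_orbit S x"
  thus "y \<in> gen_orbit S' x"
  proof induction
    case (step y p)
    have "y \<in> B" using gen_orbit_subset[OF assms(1,2)] step.hyps by auto
    hence "p y = y \<or> (\<exists>q\<in>S'. q y = p y)" using assms(3) step.hyps by blast
    thus ?case using step.IH by (metis gen_orbit.step)
  qed (rule gen_orbit.base)
qed

definition conn_count :: "'a set \<Rightarrow> 'a \<Rightarrow> ('a \<Rightarrow> 'a) \<Rightarrow> nat \<Rightarrow> int" where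
  "conn_count X x \<sigma> b = (\<Sum>\<tau>s | set \<tau>s \<subseteq> transps X \<and> length \<tau>s = b.
     of_bool (\<sigma> \<circ> foldr (\<circ>) \<tau>s id = id \<and> gen_orbit (insert \<sigma> (set \<tau>s)) x = X))"

lemma sum_choose_Suc:
  fixes h :: "nat \<Rightarrow> nat \<Rightarrow> 'b :: comm_semiring_1"
  shows "(\<Sum>j\<le>b. of_nat (b choose j) * (h (Suc j) (b - j) + h j (Suc b - j))) =
         (\<Sum>j\<le>Suc b. of_nat (Suc b choose j) * h j (Suc b - j))"
proof -
  have "(\<Sum>j\<le>b. of_nat (b choose j) * h j (Suc b - j)) = (\<Sum>j\<le>Suc b. of_nat (b choose j) * h j (Suc b - j))"
    by (simp add: binomial_eq_0)
  also have "\<dots> = h 0 (Suc b) + (\<Sum>j\<le>b. of_nat (b choose Suc j) * h (Suc j) (b - j))"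
    by (subst sum.atMost_Suc_shift) simp
  finally have e: "(\<Sum>j\<le>b. of_nat (b choose j) * h j (Suc b - j)) =
     h 0 (Suc b) + (\<Sum>j\<le>b. of_nat (b choose Suc j) * h (Suc j) (b - j))" .
  show ?thesis
    unfolding sum.atMost_Suc_shift distrib_left sum.distrib e
    by (simp add: distrib_right sum.distrib algebra_simps)
qed

text \<open>A word over two disjoint alphabets amounts to its two subwords and the positions of one
  of them. Removing the first letter turns the count of positions into Pascal's rule.\<close>

lemma sum_lists_shuffle:
  fixes f g :: "'b list \<Rightarrow> int"
  assumes T: "finite T" "finite U" "T \<inter> U = {}"
  shows "(\<Sum>xs | set xs \<subseteq> T \<union> U \<and> length xs = b. f (filter (\<lambda>x. x \<in> T) xs) * g (filter (\<lambda>x. x \<in> U) xs)) =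
    (\<Sum>j\<le>b. int (b choose j) * ((\<Sum>xs | set xs \<subseteq> T \<and> length xs = j. f xs) *
                               (\<Sum>xs | set xs \<subseteq> U \<and> length xs = b - j. g xs)))"
proof (induction b arbitrary: f g)
  case 0
  show ?case by (simp add: sum_lists_0 del: length_0_conv)
next
  case (Suc b)
  define F :: "('b list \<Rightarrow> int) \<Rightarrow> 'b set \<Rightarrow> nat \<Rightarrow> int" where "F = (\<lambda>f T j. \<Sum>xs | set xs \<subseteq> T \<and> length xs = j. f xs :: int)"
  have F: "(\<Sum>x\<in>A. F (\<lambda>xs. f (x # xs)) A j) = F f A (Suc j)" if "finite A" for f :: "'b list \<Rightarrow> int" and A j
    unfolding F_def using that by (simp add: sum_lists_Suc)
  have "(\<Sum>xs | set xs \<subseteq> T \<union> U \<and> length xs = Suc b. f (filter (\<lambda>x. x \<in> T) xs) * g (filter (\<lambda>x. x \<in> U) xs))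
    = (\<Sum>x\<in>T \<union> U. \<Sum>xs | set xs \<subseteq> T \<union> U \<and> length xs = b.
         f (filter (\<lambda>x. x \<in> T) (x # xs)) * g (filter (\<lambda>x. x \<in> U) (x # xs)))"
    using T by (subst sum_lists_Suc) auto
  also have "\<dots> = (\<Sum>x\<in>T. \<Sum>xs | set xs \<subseteq> T \<union> U \<and> length xs = b.
         f (x # filter (\<lambda>x. x \<in> T) xs) * g (filter (\<lambda>x. x \<in> U) xs))
    + (\<Sum>x\<in>U. \<Sum>xs | set xs \<subseteq> T \<union> U \<and> length xs = b.
         f (filter (\<lambda>x. x \<in> T) xs) * g (x # filter (\<lambda>x. x \<in> U) xs))"
    unfolding sum.union_disjoint[OF T] using T(3)
    by (intro arg_cong2[of _ _ _ _ "(+)"] sum.cong refl) auto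
  also have "\<dots> = (\<Sum>x\<in>T. \<Sum>j\<le>b. int (b choose j) * (F (\<lambda>xs. f (x # xs)) T j * F g U (b - j)))
       + (\<Sum>x\<in>U. \<Sum>j\<le>b. int (b choose j) * (F f T j * F (\<lambda>xs. g (x # xs)) U (b - j)))"
    unfolding F_def by (simp only: Suc.IH[of "\<lambda>xs. f (_ # xs)" g] Suc.IH[of f "\<lambda>xs. g (_ # xs)"])
  also have "\<dots> = (\<Sum>j\<le>b. int (b choose j) * (F f T (Suc j) * F g U (b - j)))
       + (\<Sum>j\<le>b. int (b choose j) * (F f T j * F g U (Suc (b - j))))"
    using T by (subst (1 2) sum.swap) (simp add: F[symmetric] sum_distrib_left sum_distrib_right)
  also have "\<dots> = (\<Sum>j\<le>b. int (b choose j) * (F f T (Suc j) * F g U (b - j) + F f T j * F g U (Suc b - j)))"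
    by (simp add: sum.distrib[symmetric] distrib_left Suc_diff_le)
  also have "\<dots> = (\<Sum>j\<le>Suc b. int (Suc b choose j) * (F f T j * F g U (Suc b - j)))"
    by (rule sum_choose_Suc)
  finally show ?case unfolding F_def .
qed

section \<open>Splitting a word along an invariant subset\<close>

lemma transps_disjoint: "B \<inter> B' = {} \<Longrightarrow> transps B \<inter> transps B' = {}"
proof -
  assume d: "B \<inter> B' = {}"
  have "\<tau> \<notin> transps B'" if \<tau>: "\<tau> \<in> transps B" for \<tau>
  proof
    assume \<tau>': "\<tau> \<in> transps B'"
    obtain a b where "\<tau> = transpose a b" "a \<in> B" "b \<in> B" "a \<noteq> b" using \<tau> by (auto simp: transps_def)
    moreover have "\<tau> a = a"
      using d \<tau>' \<open>a \<in> B\<close> by (intro permutes_not_in[OF transps_permutes[OF \<tau>']]) auto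
    ultimately show False by simp
  qed
  thus ?thesis by blast
qed

lemma foldr_comp_Cons: "foldr (\<circ>) (p # ps) id = p \<circ> foldr (\<circ>) ps id"
  by simp

lemma foldr_comp_permutes: "set ps \<subseteq> {p. p permutes X} \<Longrightarrow> foldr (\<circ>) ps id permutes X"
proof (induction ps)
  case (Cons p ps)
  show ?case unfolding foldr_comp_Cons
    by (intro permutes_compose Cons.IH) (use Cons.prems in simp_all)
qed (simp add: permutes_id)

lemma foldr_filter_transps:
  assumes d: "B \<inter> B' = {}" and ps: "set ps \<subseteq> transps B \<union> transps B'" and x: "x \<in> B"
  shows "foldr (\<circ>) (filter (\<lambda>\<tau>. \<tau> \<in> transps B) ps) id x = foldr (\<circ>) ps id x"
  using ps
proof (induction ps)
  case (Cons \<tau> ps)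
  define y where "y = foldr (\<circ>) ps id x"
  have IH: "foldr (\<circ>) (filter (\<lambda>\<tau>. \<tau> \<in> transps B) ps) id x = y"
    unfolding y_def by (rule Cons.IH) (use Cons.prems in simp)
  have "foldr (\<circ>) (filter (\<lambda>\<tau>. \<tau> \<in> transps B) ps) id permutes B"
    by (rule foldr_comp_permutes) (auto intro: transps_permutes)
  hence "y \<in> B" using x IH permutes_in_image by metis
  hence "\<tau> y = y" if "\<tau> \<in> transps B'"
    using that d by (intro permutes_not_in[OF transps_permutes[OF that]]) auto
  moreover have "foldr (\<circ>) (filter (\<lambda>\<tau>. \<tau> \<in> transps B) (\<tau> # ps)) id x = (if \<tau> \<in> transps B then \<tau> y else y)"
    by (simp only: filter.simps if_distrib[of "\<lambda>ps. foldr (\<circ>) ps id x"] foldr_comp_Cons o_apply IH)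
  moreover have "foldr (\<circ>) (\<tau> # ps) id x = \<tau> y" by (simp only: foldr_comp_Cons o_apply y_def)
  ultimately show ?case using Cons.prems by (metis UnE list.set_intros(1) subsetD)
qed simp

lemma perm_restrict_permutes:
  assumes "\<sigma> permutes X" "B \<subseteq> X" "\<sigma> ` B = B"
  shows "perm_restrict \<sigma> B permutes B"
proof (rule bij_imp_permutes)
  have "inj_on \<sigma> B" using permutes_inj[OF assms(1)] by (rule inj_on_subset) simp
  thus "bij_betw (perm_restrict \<sigma> B) B B"
    using assms(3) by (simp add: bij_betw_def perm_restrict_def inj_on_def)
qed (simp add: perm_restrict_def)

lemma restricted_product_eq_id:
  assumes d: "B \<inter> B' = {}" and ps: "set ps \<subseteq> transps B \<union> transps B'"
  shows "perm_restrict \<sigma> B \<circ> foldr (\<circ>) (filter (\<lambda>\<tau>. \<tau> \<in> transps B) ps) id = id \<longleftrightarrow>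
         (\<forall>x\<in>B. \<sigma> (foldr (\<circ>) ps id x) = x)"
proof -
  have p: "foldr (\<circ>) (filter (\<lambda>\<tau>. \<tau> \<in> transps B) ps) id permutes B" (is "?p permutes B")
    by (rule foldr_comp_permutes) (auto intro: transps_permutes)
  have "(perm_restrict \<sigma> B \<circ> ?p) x = (if x \<in> B then \<sigma> (foldr (\<circ>) ps id x) else x)" for x
    using permutes_in_image[OF p, of x] permutes_not_in[OF p, of x] foldr_filter_transps[OF d ps, of x]
    by (auto simp: perm_restrict_def)
  thus ?thesis by (auto simp: fun_eq_iff)
qed

text \<open>Words are sorted by the orbit B of the base point. Such a word shuffles a word on B with
  one on the complement; only the first is required to be transitive, which explains the asymmetry
  between the two factors.\<close>

lemma word_count_decomp:
  assumes X: "finite X" and s: "\<sigma> permutes X" and x: "x \<in> X"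
  shows "word_count X \<sigma> b = (\<Sum>B | B \<subseteq> X \<and> x \<in> B \<and> \<sigma> ` B = B. \<Sum>j\<le>b. int (b choose j) *
     (conn_count B x (perm_restrict \<sigma> B) j * word_count (X - B) (perm_restrict \<sigma> (X - B)) (b - j)))"
proof -
  define W where "W = {\<tau>s. set \<tau>s \<subseteq> transps X \<and> length \<tau>s = b}"
  define I where "I = {B. B \<subseteq> X \<and> x \<in> B \<and> \<sigma> ` B = B}"
  have finW: "finite W" unfolding W_def by (intro finite_lists_length_eq finite_transps X)
  have finI: "finite I" unfolding I_def using X by simp
  define Q where "Q \<tau>s \<longleftrightarrow> \<sigma> \<circ> foldr (\<circ>) \<tau>s id = id" for \<tau>s
  define orb where "orb \<tau>s = gen_orbit (insert \<sigma> (set \<tau>s)) x" for \<tau>s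
  have perm: "p permutes X" if "\<tau>s \<in> W" "p \<in> insert \<sigma> (set \<tau>s)" for \<tau>s p
    using that s by (auto simp: W_def intro: transps_permutes)
  have OI: "orb \<tau>s \<in> I" if w: "\<tau>s \<in> W" for \<tau>s
  proof -
    have "\<sigma> ` orb \<tau>s = orb \<tau>s"
      unfolding orb_def by (rule gen_orbit_image[OF X x perm[OF w]]) auto
    moreover have "orb \<tau>s \<subseteq> X"
      unfolding orb_def using x permutes_image[OF perm[OF w]] by (intro gen_orbit_subset) auto
    moreover have "x \<in> orb \<tau>s" unfolding orb_def by (rule gen_orbit.base)
    ultimately show ?thesis by (simp add: I_def)
  qed
  have "word_count X \<sigma> b = (\<Sum>\<tau>s\<in>W. \<Sum>B\<in>I. of_bool (Q \<tau>s \<and> orb \<tau>s = B))"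
    unfolding word_count_def W_def[symmetric]
  proof (intro sum.cong refl)
    fix \<tau>s assume w: "\<tau>s \<in> W"
    have "(\<Sum>B\<in>I. of_bool (Q \<tau>s \<and> orb \<tau>s = B)) = (\<Sum>B\<in>I. if B = orb \<tau>s then of_bool (Q \<tau>s) else 0 :: int)"
      by (intro sum.cong) auto
    thus "of_bool (\<sigma> \<circ> foldr (\<circ>) \<tau>s id = id) = (\<Sum>B\<in>I. of_bool (Q \<tau>s \<and> orb \<tau>s = B) :: int)"
      using OI[OF w] finI by (simp add: Q_def)
  qed
  also have "\<dots> = (\<Sum>B\<in>I. \<Sum>\<tau>s\<in>W. of_bool (Q \<tau>s \<and> orb \<tau>s = B))" by (rule sum.swap)
  also have "\<dots> = (\<Sum>B\<in>I. \<Sum>j\<le>b. int (b choose j) *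
     (conn_count B x (perm_restrict \<sigma> B) j * word_count (X - B) (perm_restrict \<sigma> (X - B)) (b - j)))"
  proof (intro sum.cong refl)
    fix B assume "B \<in> I"
    hence B: "B \<subseteq> X" "x \<in> B" "\<sigma> ` B = B" by (auto simp: I_def)
    define T where "T = transps B"
    define U where "U = transps (X - B)"
    have TU: "finite T" "finite U" "T \<inter> U = {}"
      using X B finite_subset transps_disjoint[of B "X - B"] by (auto simp: T_def U_def intro!: finite_transps)
    define V where "V = {\<tau>s. set \<tau>s \<subseteq> T \<union> U \<and> length \<tau>s = b}"
    define f where "f ps = (of_bool (perm_restrict \<sigma> B \<circ> foldr (\<circ>) ps id = id \<and>
       gen_orbit (insert (perm_restrict \<sigma> B) (set ps)) x = B) :: int)" for ps
    define g where "g ps = (of_bool (perm_restrict \<sigma> (X - B) \<circ> foldr (\<circ>) ps id = id) :: int)" for ps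
    have VW: "V \<subseteq> W" using transps_mono[of B X] transps_mono[of "X - B" X] B by (auto simp: V_def W_def T_def U_def)
    \<comment> \<open>A letter exchanging a point of B with a point outside B would carry the orbit
      out of B.\<close>
    have "of_bool (Q \<tau>s \<and> orb \<tau>s = B) = (0 :: int)" if "\<tau>s \<in> W - V" for \<tau>s
    proof -
      from that obtain \<tau> where \<tau>: "\<tau> \<in> set \<tau>s" "\<tau> \<in> transps X" "\<tau> \<notin> T" "\<tau> \<notin> U"
        by (auto simp: W_def V_def)
      then obtain a c where ac: "\<tau> = transpose a c" "a \<in> X" "c \<in> X" "a \<noteq> c" by (auto simp: transps_def)
      have "orb \<tau>s \<noteq> B"
      proof
        assume "orb \<tau>s = B"
        hence "\<tau> ` B \<subseteq> B" unfolding orb_def using \<tau>(1) by (auto intro: gen_orbit.step)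
        hence "a \<in> B \<longleftrightarrow> c \<in> B" unfolding ac(1) by (metis image_subset_iff transpose_apply_first transpose_apply_second)
        hence "\<tau> \<in> T \<or> \<tau> \<in> U" using ac by (auto simp: T_def U_def transps_def)
        thus False using \<tau> by simp
      qed
      thus ?thesis by simp
    qed
    hence "(\<Sum>\<tau>s\<in>W. of_bool (Q \<tau>s \<and> orb \<tau>s = B) :: int) = (\<Sum>\<tau>s\<in>V. of_bool (Q \<tau>s \<and> orb \<tau>s = B))"
      using finW VW by (intro sum.mono_neutral_right) auto
    also have "\<dots> = (\<Sum>\<tau>s\<in>V. f (filter (\<lambda>\<tau>. \<tau> \<in> T) \<tau>s) * g (filter (\<lambda>\<tau>. \<tau> \<in> U) \<tau>s))"
    proof (intro sum.cong refl)
      fix \<tau>s assume v: "\<tau>s \<in> V"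
      hence vTU: "set \<tau>s \<subseteq> transps B \<union> transps (X - B)" by (auto simp: V_def T_def U_def)
      have vW: "\<tau>s \<in> W" using v VW by auto
      have "foldr (\<circ>) \<tau>s id permutes X" using perm[OF vW] by (intro foldr_comp_permutes) auto
      hence out: "foldr (\<circ>) \<tau>s id y = y" if "y \<notin> X" for y using that by (rule permutes_not_in)
      have out': "\<sigma> y = y" if "y \<notin> X" for y using s that by (rule permutes_not_in)
      have "Q \<tau>s \<longleftrightarrow> (\<forall>y\<in>B. \<sigma> (foldr (\<circ>) \<tau>s id y) = y) \<and> (\<forall>y\<in>X-B. \<sigma> (foldr (\<circ>) \<tau>s id y) = y)"
      proof (intro iffI conjI ballI)
        assume *: "(\<forall>y\<in>B. \<sigma> (foldr (\<circ>) \<tau>s id y) = y) \<and> (\<forall>y\<in>X-B. \<sigma> (foldr (\<circ>) \<tau>s id y) = y)"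
        have "\<sigma> (foldr (\<circ>) \<tau>s id y) = y" for y
        proof (cases "y \<in> X")
          case True thus ?thesis using * by blast
        next
          case False thus ?thesis using out out' by metis
        qed
        thus "Q \<tau>s" unfolding Q_def fun_eq_iff o_apply id_apply by blast
      next
        assume "Q \<tau>s"
        hence *: "\<sigma> (foldr (\<circ>) \<tau>s id y) = y" for y
          unfolding Q_def fun_eq_iff o_apply id_apply by blast
        show "\<sigma> (foldr (\<circ>) \<tau>s id y) = y" for y by (rule *)
        show "\<sigma> (foldr (\<circ>) \<tau>s id y) = y" for y by (rule *)
      qed
      also have "\<dots> \<longleftrightarrow> perm_restrict \<sigma> B \<circ> foldr (\<circ>) (filter (\<lambda>\<tau>. \<tau> \<in> T) \<tau>s) id = id \<and>
          perm_restrict \<sigma> (X - B) \<circ> foldr (\<circ>) (filter (\<lambda>\<tau>. \<tau> \<in> U) \<tau>s) id = id"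
        unfolding T_def U_def
        by (simp only: restricted_product_eq_id[OF _ vTU] restricted_product_eq_id[OF _ vTU[unfolded Un_commute[of "transps B"]]]
              Diff_disjoint Int_commute[of "X - B"])
      finally have Q: "Q \<tau>s \<longleftrightarrow> \<dots>" .
      have fixB: "\<tau> y = y" if "\<tau> \<in> U" "y \<in> B" for \<tau> y
        using that transps_permutes[of \<tau> "X - B"] permutes_not_in[of \<tau> "X - B" y] by (auto simp: U_def)
      have imgB: "\<tau> ` B = B" if "\<tau> \<in> T" for \<tau>
        using that transps_permutes permutes_image unfolding T_def by blast
      have imgB': "p ` B \<subseteq> B" if "p \<in> insert \<sigma> (set \<tau>s)" for p
      proof -
        from that vTU consider "p = \<sigma>" | "p \<in> T" | "p \<in> U" by (auto simp: T_def U_def)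
        thus ?thesis
        proof cases
          case 3
          thus ?thesis using fixB by (metis image_subsetI)
        qed (use B(3) imgB in simp_all)
      qed
      have "orb \<tau>s = gen_orbit (insert (perm_restrict \<sigma> B) (set (filter (\<lambda>\<tau>. \<tau> \<in> T) \<tau>s))) x"
        unfolding orb_def
      proof (intro equalityI gen_orbit_mono_on[of x B])
        show "x \<in> B" by fact
        show "x \<in> B" by fact
        show "p ` B \<subseteq> B" if "p \<in> insert \<sigma> (set \<tau>s)" for p using imgB'[OF that] .
        show "p ` B \<subseteq> B" if "p \<in> insert (perm_restrict \<sigma> B) (set (filter (\<lambda>\<tau>. \<tau> \<in> T) \<tau>s))" for p
          using that imgB B(3) by (auto simp: perm_restrict_def)
        show "p y = y \<or> (\<exists>q\<in>insert (perm_restrict \<sigma> B) (set (filter (\<lambda>\<tau>. \<tau> \<in> T) \<tau>s)). q y = p y)"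
          if "p \<in> insert \<sigma> (set \<tau>s)" "y \<in> B" for p y
          using that fixB vTU by (auto simp: perm_restrict_def T_def U_def)
        show "p y = y \<or> (\<exists>q\<in>insert \<sigma> (set \<tau>s). q y = p y)"
          if "p \<in> insert (perm_restrict \<sigma> B) (set (filter (\<lambda>\<tau>. \<tau> \<in> T) \<tau>s))" "y \<in> B" for p y
          using that by (auto simp: perm_restrict_def)
      qed
      thus "of_bool (Q \<tau>s \<and> orb \<tau>s = B) = f (filter (\<lambda>\<tau>. \<tau> \<in> T) \<tau>s) * g (filter (\<lambda>\<tau>. \<tau> \<in> U) \<tau>s)"
        unfolding Q f_def g_def by auto
    qed
    also have "\<dots> = (\<Sum>j\<le>b. int (b choose j) *
       (conn_count B x (perm_restrict \<sigma> B) j * word_count (X - B) (perm_restrict \<sigma> (X - B)) (b - j)))"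
      unfolding V_def conn_count_def word_count_def T_def[symmetric] U_def[symmetric]
        f_def[symmetric] g_def[symmetric] by (rule sum_lists_shuffle[OF TU])
    finally show "(\<Sum>\<tau>s\<in>W. of_bool (Q \<tau>s \<and> orb \<tau>s = B)) = (\<Sum>j\<le>b. int (b choose j) *
       (conn_count B x (perm_restrict \<sigma> B) j * word_count (X - B) (perm_restrict \<sigma> (X - B)) (b - j)))" .
  qed
  finally show ?thesis unfolding I_def .
qed

section \<open>Exponential sums for transitive factorizations\<close>

lemma choose_two_add: "(m + l) choose 2 = (m choose 2) + (l choose 2) + m * l"
  by (induction l) (simp_all add: choose_two_Suc)

text \<open>The right-hand side exceeds the left-hand side by (m - 1)(l - 1).\<close>

lemma choose_two_add_le:
  assumes "0 < m" "0 < l"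
  shows "(m choose 2) + (l choose 2) \<le> (m + l - 1) choose 2"
    and "2 \<le> m \<Longrightarrow> 2 \<le> l \<Longrightarrow> (m choose 2) + (l choose 2) < (m + l - 1) choose 2"
    and "m = 1 \<or> l = 1 \<Longrightarrow> (m choose 2) + (l choose 2) = (m + l - 1) choose 2"
proof -
  obtain m' l' where ml: "m = Suc m'" "l = Suc l'" using assms by (metis gr0_conv_Suc)
  have "Suc (m' + l') choose 2 = (m' + l' choose 2) + (m' + l')" by (rule choose_two_Suc)
  hence e: "(m + l - 1) choose 2 = (m choose 2) + (l choose 2) + m' * l'"
    by (simp add: ml choose_two_Suc choose_two_add)
  show "(m choose 2) + (l choose 2) \<le> (m + l - 1) choose 2" using e by simp
  show "(m choose 2) + (l choose 2) < (m + l - 1) choose 2" if "2 \<le> m" "2 \<le> l" using e that ml by simp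
  show "(m choose 2) + (l choose 2) = (m + l - 1) choose 2" if "m = 1 \<or> l = 1" using e that ml by auto
qed

text \<open>By the binomial theorem, shuffling two independent words adds their frequencies.\<close>

lemma binomial_convolution:
  fixes c e :: "int \<Rightarrow> int"
  shows "(\<Sum>j\<le>b. int (b choose j) * ((\<Sum>k\<in>K. c k * k ^ j) * (\<Sum>l\<in>L. e l * l ^ (b - j)))) =
         (\<Sum>k\<in>K. \<Sum>l\<in>L. c k * e l * (k + l) ^ b)"
proof -
  have "(\<Sum>k\<in>K. \<Sum>l\<in>L. c k * e l * (k + l) ^ b) =
        (\<Sum>k\<in>K. \<Sum>l\<in>L. \<Sum>j\<le>b. int (b choose j) * ((c k * k ^ j) * (e l * l ^ (b - j))))"
    unfolding binomial_ring sum_distrib_left by (intro sum.cong refl) (simp add: mult_ac)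
  also have "\<dots> = (\<Sum>k\<in>K. \<Sum>j\<le>b. \<Sum>l\<in>L. int (b choose j) * ((c k * k ^ j) * (e l * l ^ (b - j))))"
    by (intro sum.cong refl sum.swap)
  also have "\<dots> = (\<Sum>j\<le>b. \<Sum>k\<in>K. \<Sum>l\<in>L. int (b choose j) * ((c k * k ^ j) * (e l * l ^ (b - j))))"
    by (rule sum.swap)
  also have "\<dots> = (\<Sum>j\<le>b. int (b choose j) * ((\<Sum>k\<in>K. c k * k ^ j) * (\<Sum>l\<in>L. e l * l ^ (b - j))))"
    by (simp only: sum_distrib_left[symmetric] sum_distrib_right[symmetric])
  finally show ?thesis ..
qed

section \<open>The recursion for the coefficients of the transitive count\<close>

definition freq_range :: "nat \<Rightarrow> int set" where
  "freq_range n = {- int (n choose 2)..int (n choose 2)}"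

text \<open>A fixed point z different from x corresponds to the complement of z, and the base point,
  if fixed, to {x}. With at least three points, {x} is not the complement of a point, so the
  correspondence is injective.\<close>

lemma card_invariant_corank_one:
  assumes X: "finite X" and s: "\<sigma> permutes X" and x: "x \<in> X" and n: "3 \<le> card X"
  shows "card {B. B \<subset> X \<and> x \<in> B \<and> \<sigma> ` B = B \<and> (card B = 1 \<or> card X - card B = 1)} =
         card {z \<in> X. \<sigma> z = z}"
proof (rule bij_betw_same_card[symmetric])
  have inj: "inj \<sigma>" using s by (rule permutes_inj)
  show "bij_betw (\<lambda>z. if z = x then {x} else X - {z}) {z \<in> X. \<sigma> z = z}
     {B. B \<subset> X \<and> x \<in> B \<and> \<sigma> ` B = B \<and> (card B = 1 \<or> card X - card B = 1)}"
    unfolding bij_betw_def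
  proof
    show "inj_on (\<lambda>z. if z = x then {x} else X - {z}) {z \<in> X. \<sigma> z = z}"
    proof (rule inj_onI)
      fix y z assume yz: "y \<in> {z \<in> X. \<sigma> z = z}" "z \<in> {z \<in> X. \<sigma> z = z}"
        and eq: "(if y = x then {x} else X - {y}) = (if z = x then {x} else X - {z})"
      have ne: "{x} \<noteq> X - {u}" if "u \<in> X" for u
      proof
        assume "{x} = X - {u}"
        hence "card {x} = card (X - {u})" by (rule arg_cong)
        thus False using n X that by simp
      qed
      consider "y = x" "z = x" | "y = x" "z \<noteq> x" | "y \<noteq> x" "z = x" | "y \<noteq> x" "z \<noteq> x" by blast
      thus "y = z"
      proof cases
        case 2 thus ?thesis using eq ne[of z] yz(2) by (metis (mono_tags, lifting) mem_Collect_eq)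
      next
        case 3 thus ?thesis using eq ne[of y] yz(1) by (metis (mono_tags, lifting) mem_Collect_eq)
      next
        case 4
        hence "X - {y} = X - {z}" using eq by simp
        thus ?thesis using yz by blast
      qed simp
    qed
    show "(\<lambda>z. if z = x then {x} else X - {z}) ` {z \<in> X. \<sigma> z = z} =
      {B. B \<subset> X \<and> x \<in> B \<and> \<sigma> ` B = B \<and> (card B = 1 \<or> card X - card B = 1)}"
    proof (intro equalityI subsetI)
      fix B assume "B \<in> (\<lambda>z. if z = x then {x} else X - {z}) ` {z \<in> X. \<sigma> z = z}"
      then obtain z where z: "z \<in> X" "\<sigma> z = z" "B = (if z = x then {x} else X - {z})" by auto
      have "X \<noteq> {x}" using n by auto
      moreover have "\<sigma> ` (X - {z}) = X - {z}"
        using permutes_image[OF s] z by (simp add: image_set_diff[OF inj])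
      ultimately have "B \<subset> X \<and> x \<in> B \<and> \<sigma> ` B = B"
        using z x by (cases "z = x") (simp_all add: psubset_eq, blast)
      moreover have "card B = 1 \<or> card X - card B = 1"
        using z X n by (cases "z = x") simp_all
      ultimately show "B \<in> {B. B \<subset> X \<and> x \<in> B \<and> \<sigma> ` B = B \<and> (card B = 1 \<or> card X - card B = 1)}"
        by blast
    next
      fix B assume "B \<in> {B. B \<subset> X \<and> x \<in> B \<and> \<sigma> ` B = B \<and> (card B = 1 \<or> card X - card B = 1)}"
      hence B: "B \<subset> X" "x \<in> B" "\<sigma> ` B = B" "card B = 1 \<or> card X - card B = 1" by auto
      show "B \<in> (\<lambda>z. if z = x then {x} else X - {z}) ` {z \<in> X. \<sigma> z = z}"
        using B(4)
      proof
        assume "card B = 1"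
        hence "B = {x}" using B(2) by (metis card_1_singletonE singletonD)
        moreover have "\<sigma> x = x" using B(3) unfolding \<open>B = {x}\<close> by simp
        ultimately show ?thesis using x by (intro image_eqI[of _ _ x]) simp_all
      next
        assume "card X - card B = 1"
        hence "card (X - B) = 1" using B(1) X by (subst card_Diff_subset) (auto intro: finite_subset)
        then obtain z where z: "X - B = {z}" by (metis card_1_singletonE)
        have "\<sigma> ` (X - B) = X - B" using permutes_image[OF s] B(3) by (simp add: image_set_diff[OF inj])
        hence "\<sigma> z = z" unfolding z by simp
        moreover have "z \<in> X" "z \<noteq> x" "B = X - {z}" using z B(1,2) by blast+
        ultimately show ?thesis by (intro image_eqI[of _ _ z]) simp_all
      qed
    qed
  qed
qed

text \<open>The decomposition of the full count is solved for its term B = X. The induction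
  hypothesis supplies, for the proper subsets, the expansion, its support and the top coefficient 1;
  the gap and the second coefficient are read off afterwards from the sizes of the subsets.\<close>

lemma conn_count_expansion:
  assumes "finite X" "\<sigma> permutes X" "x \<in> X"
  shows "\<exists>c. (\<forall>k. k \<notin> freq_range (card X) \<longrightarrow> c k = 0) \<and>
     (\<forall>b. fact (card X) * conn_count X x \<sigma> b = (\<Sum>k\<in>freq_range (card X). c k * k ^ b)) \<and>
     c (int (card X choose 2)) = 1 \<and>
     (\<forall>k. int ((card X - 1) choose 2) < k \<and> k < int (card X choose 2) \<longrightarrow> c k = 0) \<and>
     (3 \<le> card X \<longrightarrow> c (int ((card X - 1) choose 2)) = - (int (card X) * int (card {z \<in> X. \<sigma> z = z})))"
  using assms
proof (induction "card X" arbitrary: X \<sigma> rule: less_induct)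
  case less
  note X = \<open>finite X\<close> and s = \<open>\<sigma> permutes X\<close> and x = \<open>x \<in> X\<close>
  define n where "n = card X"
  define I where "I = {B. B \<subset> X \<and> x \<in> B \<and> \<sigma> ` B = B}"
  define C where "C m = int (m choose 2)" for m
  have finI: "finite I" unfolding I_def using X by (auto intro: finite_subset[of _ "Pow X"])
  have B: "B \<subseteq> X" "x \<in> B" "\<sigma> ` B = B" "0 < card B" "card B < n" "card (X - B) = n - card B" "finite B"
    if "B \<in> I" for B
  proof -
    show "B \<subseteq> X" "x \<in> B" "\<sigma> ` B = B" using that by (auto simp: I_def)
    thus fB: "finite B" using X finite_subset by blast
    show "0 < card B" using \<open>x \<in> B\<close> fB by (auto simp: card_gt_0_iff)
    show "card B < n" using that X by (auto simp: I_def n_def intro: psubset_card_mono)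
    show "card (X - B) = n - card B" using \<open>B \<subseteq> X\<close> fB by (simp add: card_Diff_subset n_def)
  qed
  have rB: "perm_restrict \<sigma> B permutes B" if "B \<in> I" for B
    using perm_restrict_permutes[OF s] B[OF that] by simp
  have rXB: "perm_restrict \<sigma> (X - B) permutes (X - B)" if "B \<in> I" for B
    using perm_restrict_permutes[OF s, of "X - B"] B[OF that] permutes_image[OF s]
    by (simp add: image_set_diff[OF permutes_inj[OF s]])
  have "\<exists>c. (\<forall>k. k \<notin> freq_range (card B) \<longrightarrow> c k = 0) \<and> c (C (card B)) = 1 \<and>
     (\<forall>b. fact (card B) * conn_count B x (perm_restrict \<sigma> B) b = (\<Sum>k\<in>freq_range (card B). c k * k ^ b))"
    if "B \<in> I" for B
    using less.hyps[of B "perm_restrict \<sigma> B"] B[OF that] rB[OF that] unfolding n_def C_def by blast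
  then obtain cK where cK: "\<And>B k. B \<in> I \<Longrightarrow> k \<notin> freq_range (card B) \<Longrightarrow> cK B k = 0"
    "\<And>B. B \<in> I \<Longrightarrow> cK B (C (card B)) = 1"
    "\<And>B b. B \<in> I \<Longrightarrow> fact (card B) * conn_count B x (perm_restrict \<sigma> B) b = (\<Sum>k\<in>freq_range (card B). cK B k * k ^ b)"
    by metis
  have word: "\<exists>c. (\<forall>k. k \<notin> spectrum (card Y) \<longrightarrow> c k = 0) \<and> c (C (card Y)) = 1 \<and>
     (\<forall>b. fact (card Y) * word_count Y \<rho> b = (\<Sum>k\<in>freq_range (card Y). c k * k ^ b))"
    if Y: "finite Y" "\<rho> permutes Y" for Y and \<rho> :: "'a \<Rightarrow> 'a"
  proof -
    obtain c where c: "\<And>k. k \<notin> spectrum (card Y) \<Longrightarrow> c k = 0" "c (int (card Y choose 2)) = 1"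
      "\<And>b. fact (card Y) * word_count Y \<rho> b = (\<Sum>k\<in>spectrum (card Y). c k * k ^ b)"
      using word_count_expansion[OF Y] by metis
    have "(\<Sum>k\<in>spectrum (card Y). c k * k ^ b) = (\<Sum>k\<in>freq_range (card Y). c k * k ^ b)" for b
      using c(1) by (intro sum.mono_neutral_left) (auto simp: freq_range_def spectrum_def)
    thus ?thesis using c unfolding C_def by metis
  qed
  obtain cX where cX: "\<And>k. k \<notin> spectrum n \<Longrightarrow> cX k = 0" "cX (C n) = 1"
    "\<And>b. fact n * word_count X \<sigma> b = (\<Sum>k\<in>freq_range n. cX k * k ^ b)"
    using word[OF X s] unfolding n_def by metis
  have "\<exists>c. (\<forall>k. k \<notin> freq_range (n - card B) \<longrightarrow> c k = 0) \<and> c (C (n - card B)) = 1 \<and>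
     (\<forall>b. fact (n - card B) * word_count (X - B) (perm_restrict \<sigma> (X - B)) b =
        (\<Sum>k\<in>freq_range (n - card B). c k * k ^ b))" if BI: "B \<in> I" for B
  proof -
    have sub: "spectrum m \<subseteq> freq_range m" for m by (auto simp: spectrum_def freq_range_def)
    obtain c where c: "\<forall>k. k \<notin> spectrum (card (X - B)) \<longrightarrow> c k = 0" "c (C (card (X - B))) = 1"
      "\<forall>b. fact (card (X - B)) * word_count (X - B) (perm_restrict \<sigma> (X - B)) b =
        (\<Sum>k\<in>freq_range (card (X - B)). c k * k ^ b)"
      using word[OF _ rXB[OF BI]] X by blast
    show ?thesis using c sub unfolding B(6)[OF BI] by blast
  qed
  hence "\<forall>B\<in>I. \<exists>c. (\<forall>k. k \<notin> freq_range (n - card B) \<longrightarrow> c k = 0) \<and> c (C (n - card B)) = 1 \<and>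
     (\<forall>b. fact (n - card B) * word_count (X - B) (perm_restrict \<sigma> (X - B)) b =
        (\<Sum>k\<in>freq_range (n - card B). c k * k ^ b))" by blast
  from bchoice[OF this] obtain cN where cN:
    "\<And>B k. B \<in> I \<Longrightarrow> k \<notin> freq_range (n - card B) \<Longrightarrow> cN B k = 0"
    "\<And>B. B \<in> I \<Longrightarrow> cN B (C (n - card B)) = 1"
    "\<And>B b. B \<in> I \<Longrightarrow> fact (n - card B) * word_count (X - B) (perm_restrict \<sigma> (X - B)) b =
        (\<Sum>k\<in>freq_range (n - card B). cN B k * k ^ b)"
    by blast
  \<comment> \<open>The coefficient of k ^ b in the convolution belonging to B, up to the binomial
    factor.\<close>
  define conv where "conv B k = (\<Sum>i\<in>freq_range (card B). \<Sum>l\<in>freq_range (n - card B).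
     if i + l = k then cK B i * cN B l else 0)" for B k
  define c where "c k = cX k - (\<Sum>B\<in>I. int (n choose card B) * conv B k)" for k
  have CBle: "C (card B) + C (n - card B) \<le> C (n - 1)" if "B \<in> I" for B
    using choose_two_add_le(1)[of "card B" "n - card B"] B[OF that] by (simp add: C_def)
  have n0: "0 < n" using X x by (auto simp: n_def card_gt_0_iff)
  have Cn: "C n = C (n - 1) + int (n - 1)"
    using n0 choose_two_Suc[of "n - 1"] by (simp add: C_def)
  have conv0: "conv B k = 0" if "\<bar>k\<bar> > C (card B) + C (n - card B)" for B k
  proof -
    have "i + l \<noteq> k" if "i \<in> freq_range (card B)" "l \<in> freq_range (n - card B)" for i l
      using that \<open>\<bar>k\<bar> > _\<close> by (auto simp: freq_range_def C_def)
    thus ?thesis unfolding conv_def by (intro sum.neutral ballI) auto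
  qed
  have conv1: "conv B (C (card B) + C (n - card B)) = 1" if "B \<in> I" for B
  proof -
    have "conv B (C (card B) + C (n - card B)) =
      (\<Sum>i\<in>freq_range (card B). \<Sum>l\<in>freq_range (n - card B).
        if i = C (card B) then if l = C (n - card B) then 1 else 0 else 0)"
      unfolding conv_def using cK(2)[OF that] cN(2)[OF that]
      by (intro sum.cong refl) (auto simp: freq_range_def C_def)
    also have "\<dots> = (\<Sum>i\<in>freq_range (card B). if i = C (card B) then 1 else 0)"
      by (intro sum.cong refl) (auto simp: freq_range_def C_def)
    also have "\<dots> = 1" by (auto simp: freq_range_def C_def)
    finally show ?thesis .
  qed
  have supp: "c k = 0" if "k \<notin> freq_range n" for k
  proof -
    have "\<bar>k\<bar> > C (card B) + C (n - card B)" if "B \<in> I" for B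
      using CBle[OF that] Cn \<open>k \<notin> _\<close> by (auto simp: freq_range_def C_def[of n])
    hence "(\<Sum>B\<in>I. int (n choose card B) * conv B k) = 0"
      using conv0 by (intro sum.neutral) simp
    moreover have "cX k = 0" using that by (intro cX(1)) (auto simp: freq_range_def spectrum_def)
    ultimately show ?thesis by (simp add: c_def)
  qed
  have conv_sum: "(\<Sum>k\<in>freq_range n. conv B k * k ^ b) =
      (\<Sum>i\<in>freq_range (card B). \<Sum>l\<in>freq_range (n - card B). cK B i * cN B l * (i + l) ^ b)"
    if "B \<in> I" for B b
  proof -
    have "(\<Sum>k\<in>freq_range n. conv B k * k ^ b) = (\<Sum>k\<in>freq_range n. \<Sum>i\<in>freq_range (card B).
        \<Sum>l\<in>freq_range (n - card B). if k = i + l then cK B i * cN B l * (i + l) ^ b else 0)"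
      unfolding conv_def sum_distrib_right by (intro sum.cong refl) auto
    also have "\<dots> = (\<Sum>i\<in>freq_range (card B). \<Sum>l\<in>freq_range (n - card B). \<Sum>k\<in>freq_range n.
        if k = i + l then cK B i * cN B l * (i + l) ^ b else 0)"
      by (subst sum.swap) (intro sum.cong refl sum.swap)
    also have "\<dots> = (\<Sum>i\<in>freq_range (card B). \<Sum>l\<in>freq_range (n - card B). cK B i * cN B l * (i + l) ^ b)"
    proof (intro sum.cong refl)
      fix i l assume il: "i \<in> freq_range (card B)" "l \<in> freq_range (n - card B)"
      have "i + l \<in> freq_range n" using il CBle[OF that] Cn by (auto simp: freq_range_def C_def)
      thus "(\<Sum>k\<in>freq_range n. if k = i + l then cK B i * cN B l * (i + l) ^ b else 0) = cK B i * cN B l * (i + l) ^ b"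
        by (simp add: freq_range_def)
    qed
    finally show ?thesis .
  qed
  have expand: "fact n * conn_count X x \<sigma> b = (\<Sum>k\<in>freq_range n. c k * k ^ b)" for b
  proof -
    define t where "t B = (\<Sum>j\<le>b. int (b choose j) *
       (conn_count B x (perm_restrict \<sigma> B) j * word_count (X - B) (perm_restrict \<sigma> (X - B)) (b - j)))" for B
    have "{B. B \<subseteq> X \<and> x \<in> B \<and> \<sigma> ` B = B} = insert X I"
      using x permutes_image[OF s] by (auto simp: I_def)
    hence "word_count X \<sigma> b = t X + (\<Sum>B\<in>I. t B)"
      using word_count_decomp[OF X s x, of b] finI by (simp add: t_def I_def)
    \<comment> \<open>For B = X the complement is empty and admits only the empty word, so only j =
      b survives.\<close>
    moreover have "t X = conn_count X x \<sigma> b"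
    proof -
      have "word_count {} (id :: 'a \<Rightarrow> 'a) m = of_bool (m = 0)" for m
      proof -
        have "{\<tau>s :: ('a \<Rightarrow> 'a) list. set \<tau>s \<subseteq> transps {} \<and> length \<tau>s = m} = (if m = 0 then {[]} else {})"
          by (auto simp: transps_def)
        thus ?thesis by (simp add: word_count_def)
      qed
      moreover have "perm_restrict \<sigma> {} = id" by (simp add: perm_restrict_def fun_eq_iff)
      ultimately have "t X = (\<Sum>j\<le>b. if j = b then conn_count X x \<sigma> b else 0)"
        unfolding t_def using s by (intro sum.cong refl) auto
      thus ?thesis by simp
    qed
    moreover have "fact n * t B = int (n choose card B) * (\<Sum>k\<in>freq_range n. conv B k * k ^ b)" if "B \<in> I" for B
    proof -
      have "fact n = (int (n choose card B)) * (fact (card B) * fact (n - card B))"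
        using binomial_fact_lemma[of "card B" n] B(5)[OF that]
        by (metis (no_types, lifting) less_imp_le mult.commute of_nat_fact of_nat_mult)
      hence "fact n * t B = int (n choose card B) * (\<Sum>j\<le>b. int (b choose j) *
         ((fact (card B) * conn_count B x (perm_restrict \<sigma> B) j) *
          (fact (n - card B) * word_count (X - B) (perm_restrict \<sigma> (X - B)) (b - j))))"
        by (simp add: t_def sum_distrib_left mult_ac)
      thus ?thesis unfolding cK(3)[OF that] cN(3)[OF that] binomial_convolution conv_sum[OF that] .
    qed
    ultimately have "fact n * conn_count X x \<sigma> b = fact n * word_count X \<sigma> b -
        (\<Sum>B\<in>I. int (n choose card B) * (\<Sum>k\<in>freq_range n. conv B k * k ^ b))"
      by (simp add: algebra_simps sum_distrib_left)
    also have "(\<Sum>B\<in>I. int (n choose card B) * (\<Sum>k\<in>freq_range n. conv B k * k ^ b)) =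
       (\<Sum>k\<in>freq_range n. (\<Sum>B\<in>I. int (n choose card B) * conv B k) * k ^ b)"
      by (simp only: sum_distrib_left sum_distrib_right mult.assoc) (rule sum.swap)
    finally show ?thesis by (simp add: cX(3) c_def left_diff_distrib sum_subtractf)
  qed
  have top: "c (C n) = 1"
  proof -
    have "conv B (C n) = 0" if "B \<in> I" for B
      using CBle[OF that] Cn B(4,5)[OF that] by (intro conv0) auto
    thus ?thesis using cX(2) by (simp add: c_def)
  qed
  have gap: "c k = 0" if "C (n - 1) < k" "k < C n" for k
  proof -
    have "conv B k = 0" if "B \<in> I" for B
      using CBle[OF that] \<open>C (n - 1) < k\<close> by (intro conv0) auto
    moreover have "cX k = 0"
      using that Cn n0 by (intro cX(1)) (auto simp: spectrum_def C_def[symmetric])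
    ultimately show ?thesis by (simp add: c_def)
  qed
  have second: "c (C (n - 1)) = - (int n * int (card {z \<in> X. \<sigma> z = z}))" if n3: "3 \<le> n"
  proof -
    define J where "J = {B. B \<subset> X \<and> x \<in> B \<and> \<sigma> ` B = B \<and> (card B = 1 \<or> n - card B = 1)}"
    \<comment> \<open>This frequency equals C n - (n - 1), one above the bound for the smaller
      eigenvalues.\<close>
    have "cX (C (n - 1)) = 0"
      using Cn n3 by (intro cX(1)) (auto simp: spectrum_def C_def[symmetric])
    \<comment> \<open>A convolution reaches C (n - 1) only as its top frequency and only if B or its
      complement is a single point. There its coefficient is 1 and the binomial factor is n.\<close>
    moreover have "(\<Sum>B\<in>I. int (n choose card B) * conv B (C (n - 1))) = (\<Sum>B\<in>J. int n)"
    proof -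
      have "(\<Sum>B\<in>I. int (n choose card B) * conv B (C (n - 1))) = (\<Sum>B\<in>J. int (n choose card B) * conv B (C (n - 1)))"
      proof (rule sum.mono_neutral_right[OF finI])
        show "J \<subseteq> I" by (auto simp: J_def I_def)
        show "\<forall>B\<in>I - J. int (n choose card B) * conv B (C (n - 1)) = 0"
        proof
          fix A assume A: "A \<in> I - J"
          hence "2 \<le> card A" "2 \<le> n - card A" using B(4,5)[of A] by (auto simp: I_def J_def)
          hence "C (card A) + C (n - card A) < C (n - 1)"
            using choose_two_add_le(2)[of "card A" "n - card A"] B(5)[of A] A by (simp add: C_def)
          thus "int (n choose card A) * conv A (C (n - 1)) = 0" using conv0 by simp
        qed
      qed
      also have "\<dots> = (\<Sum>B\<in>J. int n)"
      proof (intro sum.cong refl)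
        fix A assume A: "A \<in> J"
        hence AI: "A \<in> I" and or: "card A = 1 \<or> n - card A = 1" by (auto simp: I_def J_def)
        have "C (card A) + C (n - card A) = C (n - 1)"
          using choose_two_add_le(3)[of "card A" "n - card A"] B(4,5)[OF AI] or by (simp add: C_def)
        hence "conv A (C (n - 1)) = 1" using conv1[OF AI] by simp
        moreover have "n choose card A = n"
          using or B(5)[OF AI] binomial_symmetric[of "card A" n] by auto
        ultimately show "int (n choose card A) * conv A (C (n - 1)) = int n" by simp
      qed
      finally show ?thesis .
    qed
    moreover have "card J = card {z \<in> X. \<sigma> z = z}"
      using card_invariant_corank_one[OF X s x] n3 unfolding J_def n_def by blast
    ultimately show ?thesis by (simp add: c_def)
  qed
  show ?case
    using supp expand top gap second unfolding n_def C_def by blast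
qed

text \<open>By linearity the hypothesis says that the values of every polynomial on K, weighted by
  a, sum to 0; a polynomial vanishing on K except at m isolates a m. Since 0 ^ 0 = 1, the case b = 0
  also detects the frequency 0.\<close>

lemma exponential_sum_unique:
  fixes a :: "int \<Rightarrow> int"
  assumes K: "finite K" and zero: "\<And>b. (\<Sum>k\<in>K. a k * k ^ b) = 0" and m: "m \<in> K"
  shows "a m = 0"
proof -
  have p: "(\<Sum>k\<in>K. a k * poly p k) = 0" for p
  proof -
    have "(\<Sum>k\<in>K. a k * poly p k) = (\<Sum>k\<in>K. \<Sum>i\<le>degree p. coeff p i * (a k * k ^ i))"
      by (simp add: poly_altdef sum_distrib_left mult_ac)
    also have "\<dots> = (\<Sum>i\<le>degree p. coeff p i * (\<Sum>k\<in>K. a k * k ^ i))"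
      by (subst sum.swap) (simp add: sum_distrib_left)
    finally show ?thesis by (simp add: zero)
  qed
  define p where "p = (\<Prod>k\<in>K - {m}. [:- k, 1:])"
  have "poly p k = 0" if "k \<in> K - {m}" for k
    using that K by (auto simp: p_def poly_prod prod_zero_iff)
  hence "(\<Sum>k\<in>K. a k * poly p k) = a m * poly p m"
    using K m by (simp add: sum.remove)
  moreover have "poly p m \<noteq> 0" using K by (auto simp: p_def poly_prod prod_zero_iff)
  ultimately show ?thesis using p[of p] by simp
qed

lemma conn_count_parity:
  assumes "finite X" "\<sigma> permutes X" "conn_count X x \<sigma> b \<noteq> 0"
  shows "sign \<sigma> = (-1) ^ b"
proof -
  have "\<exists>\<tau>s\<in>{\<tau>s. set \<tau>s \<subseteq> transps X \<and> length \<tau>s = b}. \<sigma> \<circ> foldr (\<circ>) \<tau>s id = id"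
  proof (rule ccontr)
    assume "\<not> ?thesis"
    hence "conn_count X x \<sigma> b = 0" unfolding conn_count_def by (intro sum.neutral) auto
    thus False using assms by simp
  qed
  then obtain \<tau>s where \<tau>s: "set \<tau>s \<subseteq> transps X" "length \<tau>s = b" "\<sigma> \<circ> foldr (\<circ>) \<tau>s id = id" by blast
  have "permutation (foldr (\<circ>) \<tau>s id) \<and> sign (foldr (\<circ>) \<tau>s id) = (-1) ^ length \<tau>s"
    using \<tau>s(1)
  proof (induction \<tau>s)
    case (Cons \<tau> \<tau>s)
    have \<tau>: "permutation \<tau>" "sign \<tau> = -1"
      using Cons.prems by (auto simp: transps_def permutation_swap_id sign_swap_id)
    have IH: "permutation (foldr (\<circ>) \<tau>s id)" "sign (foldr (\<circ>) \<tau>s id) = (-1) ^ length \<tau>s"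
      using Cons.IH[OF subset_trans[OF set_subset_Cons Cons.prems]] by blast+
    show ?case unfolding foldr_comp_Cons
      using permutation_compose[OF \<tau>(1) IH(1)] sign_compose[OF \<tau>(1) IH(1)] \<tau>(2) IH(2)
      by (simp del: o_apply comp_apply)
  qed simp
  moreover have "permutation \<sigma>" using assms by (auto simp: permutation_permutes)
  ultimately have "sign \<sigma> * (-1) ^ b = sign (\<sigma> \<circ> foldr (\<circ>) \<tau>s id)"
    using \<tau>s(2) by (simp add: sign_compose)
  also have "\<dots> = 1" by (simp add: \<tau>s(3))
  finally show ?thesis by (cases "even b") auto
qed

text \<open>The vanishing of the count for exponents of the wrong parity is itself an identity of
  exponential sums, and uniqueness turns it into c (-k) = sign \<sigma> * c k. For the right parity,
  k and -k then contribute equally.\<close>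

lemma conn_count_expansion_pos:
  assumes X: "finite X" and s: "\<sigma> permutes X" and x: "x \<in> X"
  shows "\<exists>c. (\<forall>b>0. sign \<sigma> = (-1) ^ b \<longrightarrow>
       fact (card X) * conn_count X x \<sigma> b = 2 * (\<Sum>k=1..card X choose 2. c k * int k ^ b)) \<and>
     c (card X choose 2) = 1 \<and>
     (\<forall>k. (card X - 1) choose 2 < k \<and> k < card X choose 2 \<longrightarrow> c k = 0) \<and>
     (3 \<le> card X \<longrightarrow> c ((card X - 1) choose 2) = - (int (card X) * int (card {z \<in> X. \<sigma> z = z})))"
proof -
  define n where "n = card X"
  define R where "R = freq_range n"
  obtain c where supp: "\<And>k. k \<notin> R \<Longrightarrow> c k = 0"
    and ex: "\<And>b. fact n * conn_count X x \<sigma> b = (\<Sum>k\<in>R. c k * k ^ b)"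
    and top: "c (int (n choose 2)) = 1"
    and gap: "\<And>k. int ((n - 1) choose 2) < k \<Longrightarrow> k < int (n choose 2) \<Longrightarrow> c k = 0"
    and second: "3 \<le> n \<Longrightarrow> c (int ((n - 1) choose 2)) = - (int n * int (card {z \<in> X. \<sigma> z = z}))"
    using conn_count_expansion[OF X s x] unfolding n_def R_def by blast
  have finR: "finite R" by (simp add: R_def freq_range_def)
  have reflect: "(\<Sum>k\<in>R. f (- k)) = (\<Sum>k\<in>R. f k)" for f :: "int \<Rightarrow> int"
    by (rule sum.reindex_bij_witness[of _ uminus uminus]) (auto simp: R_def freq_range_def)
  have sym: "c (- k) = sign \<sigma> * c k" for k
  proof (cases "k \<in> R")
    case True
    have "c k - sign \<sigma> * c (- k) = 0"
    proof (rule exponential_sum_unique[OF finR _ True])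
      fix b
      have "(\<Sum>k\<in>R. (c k - sign \<sigma> * c (- k)) * k ^ b) =
         (\<Sum>k\<in>R. c k * k ^ b) - sign \<sigma> * (-1) ^ b * (\<Sum>k\<in>R. c (- k) * (- k) ^ b)"
      proof -
        have "(c k - sign \<sigma> * c (- k)) * k ^ b = c k * k ^ b - sign \<sigma> * (-1) ^ b * (c (- k) * (- k) ^ b)" for k
        proof -
          have "(-1) ^ b * (- k) ^ b = k ^ b" by (simp flip: power_mult_distrib)
          thus ?thesis by (metis (no_types, opaque_lifting) left_diff_distrib mult.assoc mult.left_commute)
        qed
        thus ?thesis by (simp add: sum_subtractf sum_distrib_left)
      qed
      \<comment> \<open>One of the two factors is always 0: the count for the wrong parity, the
        bracket for the right one.\<close>
      also have "\<dots> = (1 - sign \<sigma> * (-1) ^ b) * (fact n * conn_count X x \<sigma> b)"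
        using reflect[of "\<lambda>k. c k * k ^ b"] by (simp add: ex left_diff_distrib)
      also have "\<dots> = 0"
      proof (cases "conn_count X x \<sigma> b = 0")
        case False
        hence "sign \<sigma> = (-1) ^ b" by (rule conn_count_parity[OF X s])
        thus ?thesis by (simp flip: power_add)
      qed simp
      finally show "(\<Sum>k\<in>R. (c k - sign \<sigma> * c (- k)) * k ^ b) = 0" .
    qed
    hence "sign \<sigma> * c k = sign \<sigma> * sign \<sigma> * c (- k)" by (simp add: mult.assoc)
    thus ?thesis by simp
  next
    case False
    hence "- k \<notin> R" by (auto simp: R_def freq_range_def)
    thus ?thesis using False supp by simp
  qed
  have "fact n * conn_count X x \<sigma> b = 2 * (\<Sum>k=1..n choose 2. c (int k) * int k ^ b)"
    if b: "b > 0" and sg: "sign \<sigma> = (-1) ^ b" for b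
  proof -
    define P where "P = {1..int (n choose 2)}"
    have Rsplit: "R = P \<union> (uminus ` P \<union> {0})"
    proof (intro equalityI subsetI)
      fix k assume "k \<in> R"
      moreover have "k \<in> uminus ` P" if "- k \<in> P" using that by (intro image_eqI[of _ _ "- k"]) auto
      ultimately show "k \<in> P \<union> (uminus ` P \<union> {0})"
        by (cases "k > 0"; cases "k = 0") (auto simp: R_def P_def freq_range_def)
    qed (auto simp: R_def P_def freq_range_def)
    have "(\<Sum>k\<in>R. c k * k ^ b) = (\<Sum>k\<in>P. c k * k ^ b) + ((\<Sum>k\<in>uminus ` P. c k * k ^ b) + (\<Sum>k\<in>{0}. c k * k ^ b))"
      unfolding Rsplit
      by (subst sum.union_disjoint, simp add: P_def, simp add: P_def, force simp: P_def,
          subst sum.union_disjoint) (auto simp: P_def)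
    also have "(\<Sum>k\<in>uminus ` P. c k * k ^ b) = (\<Sum>k\<in>P. c (- k) * (- k) ^ b)"
      by (subst sum.reindex) auto
    also have "\<dots> = (\<Sum>k\<in>P. c k * k ^ b)"
    proof (intro sum.cong refl)
      fix k
      have "c (- k) * (- k) ^ b = c k * ((-1) ^ b * (- k) ^ b)" by (simp add: sym sg)
      also have "(-1) ^ b * (- k) ^ b = k ^ b" by (simp flip: power_mult_distrib)
      finally show "c (- k) * (- k) ^ b = c k * k ^ b" .
    qed
    \<comment> \<open>The frequency 0 has no partner and would spoil the factor 2; positivity of b
      removes it.\<close>
    also have "(\<Sum>k\<in>{0}. c k * k ^ b) = 0" using b by simp
    also have "(\<Sum>k\<in>P. c k * k ^ b) = (\<Sum>k=1..n choose 2. c (int k) * int k ^ b)"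
      unfolding P_def
      by (rule sum.reindex_bij_witness[of _ int nat]) auto
    finally show ?thesis by (simp add: ex)
  qed
  thus ?thesis
    using top gap second unfolding n_def by (intro exI[of _ "\<lambda>k. c (int k)"]) auto
qed

section \<open>Cycle types and conjugacy classes\<close>

lemma funpow_eq_iff_mod_card_orbit:
  assumes "permutation f"
  shows "(f ^^ i) x = (f ^^ k) x \<longleftrightarrow> i mod card (orbit f x) = k mod card (orbit f x)"
proof -
  define j where "j = funpow_dist1 f x x"
  have x: "x \<in> orbit f x" using assms by (rule permutation_self_in_orbit)
  have inj: "inj_on (\<lambda>n. (f ^^ n) x) {0..<j}" unfolding j_def using x by (rule inj_on_funpow_dist1)
  have "card (orbit f x) = card {0..<j}"
    unfolding orbit_conv_funpow_dist1[OF x] j_def[symmetric] by (rule card_image[OF inj])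
  hence card: "card (orbit f x) = j" by simp
  have "(f ^^ j) x = x" unfolding j_def by (rule funpow_dist1_prop[OF x])
  hence m: "(f ^^ (n mod j)) x = (f ^^ n) x" for n by (rule funpow_mod_eq)
  have "j > 0" by (simp add: j_def)
  hence "(f ^^ (i mod j)) x = (f ^^ (k mod j)) x \<longleftrightarrow> i mod j = k mod j"
    using inj by (auto dest: inj_onD)
  thus ?thesis by (simp add: card m)
qed

lemma orbit_subset_invariant:
  assumes "f ` X \<subseteq> X" "x \<in> X"
  shows "orbit f x \<subseteq> X"
proof
  fix y assume "y \<in> orbit f x"
  thus "y \<in> X" by induction (use assms in auto)
qed

lemma orbit_eq_of_mem:
  assumes "permutation f" "y \<in> orbit f x"
  shows "orbit f y = orbit f x"
  using orbit_cyclic_eq3[OF cyclic_on_orbit'[OF assms(1)] assms(2)] .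

lemma image_orbit:
  assumes "permutation f"
  shows "f ` orbit f x = orbit f x"
  using orbit_inverse[OF permutation_self_in_orbit[OF assms, of x], of f f]
  by (simp add: permutation_orbit_step[OF assms])

text \<open>This is \<open>cycle_type\<close> over an arbitrary set, so that orbits can be removed
  one at a time.\<close>

definition cycle_lengths :: "'a set \<Rightarrow> ('a \<Rightarrow> 'a) \<Rightarrow> nat multiset" where
  "cycle_lengths X \<sigma> = image_mset card (mset_set (orbit \<sigma> ` X))"

lemma cycle_lengths_remove_orbit:
  assumes p: "permutation \<sigma>" and X: "finite X" "\<sigma> ` X = X" and x: "x \<in> X"
  shows "cycle_lengths X \<sigma> = add_mset (card (orbit \<sigma> x)) (cycle_lengths (X - orbit \<sigma> x) \<sigma>)"
    and "\<sigma> ` (X - orbit \<sigma> x) = X - orbit \<sigma> x"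
proof -
  have sub: "orbit \<sigma> x \<subseteq> X" using X x by (intro orbit_subset_invariant) auto
  have "orbit \<sigma> x \<notin> orbit \<sigma> ` (X - orbit \<sigma> x)"
  proof
    assume "orbit \<sigma> x \<in> orbit \<sigma> ` (X - orbit \<sigma> x)"
    then obtain y where "y \<notin> orbit \<sigma> x" "orbit \<sigma> x = orbit \<sigma> y" by auto
    thus False using permutation_self_in_orbit[OF p, of y] by simp
  qed
  moreover have "orbit \<sigma> ` X = insert (orbit \<sigma> x) (orbit \<sigma> ` (X - orbit \<sigma> x))"
    using orbit_eq_of_mem[OF p] x by blast
  ultimately show "cycle_lengths X \<sigma> = add_mset (card (orbit \<sigma> x)) (cycle_lengths (X - orbit \<sigma> x) \<sigma>)"
    using X by (simp add: cycle_lengths_def)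
  have "inj \<sigma>" using p by (simp add: permutation_bijective bij_is_inj)
  thus "\<sigma> ` (X - orbit \<sigma> x) = X - orbit \<sigma> x"
    by (simp add: image_set_diff X image_orbit[OF p])
qed

lemma card_points_on_cycles:
  assumes p: "permutation \<sigma>" and X: "finite X" "\<sigma> ` X = X"
  shows "card {x \<in> X. card (orbit \<sigma> x) = j} = j * count (cycle_lengths X \<sigma>) j"
proof -
  define S where "S = {Orb \<in> orbit \<sigma> ` X. card Orb = j}"
  have fin: "finite Orb" if "Orb \<in> S" for Orb
    using that finite_orbit[OF permutation_self_in_orbit[OF p]] by (auto simp: S_def)
  have "{x \<in> X. card (orbit \<sigma> x) = j} = \<Union> S"
  proof (intro equalityI subsetI)
    fix x assume "x \<in> {x \<in> X. card (orbit \<sigma> x) = j}"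
    thus "x \<in> \<Union> S" using permutation_self_in_orbit[OF p, of x] by (auto simp: S_def)
  next
    fix x assume "x \<in> \<Union> S"
    then obtain y where y: "y \<in> X" "card (orbit \<sigma> y) = j" "x \<in> orbit \<sigma> y" by (auto simp: S_def)
    moreover have "x \<in> X" using y orbit_subset_invariant[of \<sigma> X y] X by auto
    ultimately show "x \<in> {x \<in> X. card (orbit \<sigma> x) = j}" using orbit_eq_of_mem[OF p] by auto
  qed
  moreover have "card (\<Union> S) = (\<Sum>Orb\<in>S. card Orb)"
  proof (rule card_Union_disjoint)
    have "A \<inter> B = {}" if "A \<in> S" "B \<in> S" "A \<noteq> B" for A B
    proof (rule ccontr)
      assume "A \<inter> B \<noteq> {}"
      then obtain z where "z \<in> A" "z \<in> B" by auto
      hence "A = orbit \<sigma> z" "B = orbit \<sigma> z"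
        using that orbit_eq_of_mem[OF p, of z] by (auto simp: S_def)
      thus False using that by simp
    qed
    thus "pairwise disjnt S" by (simp add: pairwise_def disjnt_def)
  qed (rule fin)
  moreover have "(\<Sum>Orb\<in>S. card Orb) = card S * j" by (simp add: S_def)
  moreover have "count (cycle_lengths X \<sigma>) j = card S"
    using X by (simp add: cycle_lengths_def count_image_mset S_def vimage_def Int_def conj_commute)
  ultimately show ?thesis by simp
qed

text \<open>The order of the centralizer of a permutation with cycle lengths M, commonly written
  z_M.\<close>

definition centralizer_size :: "nat multiset \<Rightarrow> nat" where
  "centralizer_size M = prod_mset M * (\<Prod>j\<in>set_mset M. fact (count M j))"

lemma centralizer_size_add_mset:
  "centralizer_size (add_mset j M) = j * Suc (count M j) * centralizer_size M"
proof -
  have e: "(\<Prod>i\<in>set_mset (add_mset j M). fact (count (add_mset j M) i)) = (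
        fact (Suc (count M j)) * (\<Prod>i\<in>set_mset M - {j}. fact (count M i)) :: nat)"
    by (simp add: prod.insert_remove)
  have e': "(\<Prod>i\<in>set_mset M. fact (count M i) :: nat) = fact (count M j) * (\<Prod>i\<in>set_mset M - {j}. fact (count M i))"
  proof (cases "j \<in># M")
    case True
    thus ?thesis by (simp add: prod.remove)
  next
    case False
    thus ?thesis by (simp add: not_in_iff)
  qed
  show ?thesis unfolding centralizer_size_def e e' by (simp only: prod_mset.add_mset fact_Suc of_nat_id mult_ac)
qed

text \<open>Source and target are separate sets because the induction removes an orbit from X and a
  possibly different one from Y. Fixing the values outside X makes each isomorphism correspond to
  exactly one map.\<close>

definition intertwiners :: "'a set \<Rightarrow> ('a \<Rightarrow> 'a) \<Rightarrow> 'a set \<Rightarrow> ('a \<Rightarrow> 'a) \<Rightarrow> ('a \<Rightarrow> 'a) set" where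
  "intertwiners X \<sigma> Y \<rho> =
     {\<pi>. bij_betw \<pi> X Y \<and> (\<forall>x. x \<notin> X \<longrightarrow> \<pi> x = x) \<and> (\<forall>x\<in>X. \<pi> (\<sigma> x) = \<rho> (\<pi> x))}"

lemma intertwiner_funpow:
  assumes "\<pi> \<in> intertwiners X \<sigma> Y \<rho>" "\<sigma> ` X = X" "x \<in> X"
  shows "\<pi> ((\<sigma> ^^ i) x) = (\<rho> ^^ i) (\<pi> x)"
proof -
  have "(\<sigma> ^^ i) x \<in> X \<and> \<pi> ((\<sigma> ^^ i) x) = (\<rho> ^^ i) (\<pi> x)"
    by (induction i) (use assms in \<open>auto simp: intertwiners_def\<close>)
  thus ?thesis by simp
qed

lemma intertwiner_image_orbit:
  assumes "permutation \<sigma>" "permutation \<rho>" "\<pi> \<in> intertwiners X \<sigma> Y \<rho>" "\<sigma> ` X = X" "x \<in> X"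
  shows "\<pi> ` orbit \<sigma> x = orbit \<rho> (\<pi> x)"
  unfolding orbit_altdef_permutation[OF assms(1)] orbit_altdef_permutation[OF assms(2)]
  using intertwiner_funpow[OF assms(3-5)] by (auto simp: image_def)

text \<open>On the orbit of x an intertwiner is determined by the image y of x, and off the orbit it
  is an arbitrary intertwiner of the complements.\<close>

lemma intertwiners_extend_orbit:
  assumes p: "permutation \<sigma>" "permutation \<rho>"
    and X: "finite X" "\<sigma> ` X = X" and Y: "finite Y" "\<rho> ` Y = Y"
    and x: "x \<in> X" and y: "y \<in> Y" and c: "card (orbit \<rho> y) = card (orbit \<sigma> x)"
  shows "bij_betw (\<lambda>\<pi> z. if z \<in> orbit \<sigma> x then z else \<pi> z)
     {\<pi> \<in> intertwiners X \<sigma> Y \<rho>. \<pi> x = y} (intertwiners (X - orbit \<sigma> x) \<sigma> (Y - orbit \<rho> y) \<rho>)"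
proof -
  define Orb where "Orb = orbit \<sigma> x"
  define Q where "Q = orbit \<rho> y"
  have OX: "Orb \<subseteq> X" unfolding Orb_def using X x by (intro orbit_subset_invariant) auto
  have QY: "Q \<subseteq> Y" unfolding Q_def using Y y by (intro orbit_subset_invariant) auto
  have Orb: "Orb = {(\<sigma> ^^ n) x |n. True}" unfolding Orb_def by (rule orbit_altdef_permutation[OF p(1)])
  have Q: "Q = {(\<rho> ^^ n) y |n. True}" unfolding Q_def by (rule orbit_altdef_permutation[OF p(2)])
  have rem: "\<sigma> ` (X - Orb) = X - Orb" unfolding Orb_def using cycle_lengths_remove_orbit(2)[OF p(1) X x] .
  have eqv: "(\<sigma> ^^ i) x = (\<sigma> ^^ k) x \<longleftrightarrow> (\<rho> ^^ i) y = (\<rho> ^^ k) y" for i k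
    unfolding funpow_eq_iff_mod_card_orbit[OF p(1)] funpow_eq_iff_mod_card_orbit[OF p(2)] c ..
  \<comment> \<open>The exponent is determined only modulo the orbit length; \<open>eqv\<close>,
    which rests on the equal lengths of the two orbits, makes the value independent of the
    choice.\<close>
  define g where "g z = (\<rho> ^^ (SOME i. z = (\<sigma> ^^ i) x)) y" for z
  have g: "g ((\<sigma> ^^ i) x) = (\<rho> ^^ i) y" for i
  proof -
    have "(\<sigma> ^^ i) x = (\<sigma> ^^ (SOME k. (\<sigma> ^^ i) x = (\<sigma> ^^ k) x)) x" by (rule someI) (rule refl)
    thus ?thesis unfolding g_def eqv by simp
  qed
  have bijg: "bij_betw g Orb Q"
    unfolding bij_betw_def
  proof
    show "inj_on g Orb" unfolding Orb by (rule inj_onI) (auto simp: g eqv)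
    show "g ` Orb = Q" unfolding Orb Q by (auto simp: g image_def)
  qed
  define restr where "restr = (\<lambda>\<pi> z. if z \<in> Orb then z else \<pi> z :: 'a)"
  have "bij_betw restr {\<pi> \<in> intertwiners X \<sigma> Y \<rho>. \<pi> x = y} (intertwiners (X - Orb) \<sigma> (Y - Q) \<rho>)"
  proof (rule bij_betw_byWitness[where f' = "\<lambda>\<pi> z. if z \<in> Orb then g z else \<pi> z"])
    show "\<forall>\<pi>\<in>{\<pi> \<in> intertwiners X \<sigma> Y \<rho>. \<pi> x = y}. (\<lambda>z. if z \<in> Orb then g z else restr \<pi> z) = \<pi>"
    proof
      fix \<pi> assume \<pi>: "\<pi> \<in> {\<pi> \<in> intertwiners X \<sigma> Y \<rho>. \<pi> x = y}"
      have "g z = \<pi> z" if "z \<in> Orb" for z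
        using that intertwiner_funpow[OF _ X(2) x, of \<pi> Y \<rho>] \<pi> unfolding Orb by (auto simp: g)
      thus "(\<lambda>z. if z \<in> Orb then g z else restr \<pi> z) = \<pi>" by (auto simp: restr_def fun_eq_iff)
    qed
    show "\<forall>\<pi>\<in>intertwiners (X - Orb) \<sigma> (Y - Q) \<rho>. restr (\<lambda>z. if z \<in> Orb then g z else \<pi> z) = \<pi>"
      by (auto simp: restr_def fun_eq_iff intertwiners_def)
    show "restr ` {\<pi> \<in> intertwiners X \<sigma> Y \<rho>. \<pi> x = y} \<subseteq> intertwiners (X - Orb) \<sigma> (Y - Q) \<rho>"
    proof
      fix \<pi>' assume "\<pi>' \<in> restr ` {\<pi> \<in> intertwiners X \<sigma> Y \<rho>. \<pi> x = y}"
      then obtain \<pi> where \<pi>: "\<pi> \<in> intertwiners X \<sigma> Y \<rho>" "\<pi> x = y" "\<pi>' = restr \<pi>" by auto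
      have b: "bij_betw \<pi> X Y" using \<pi> by (simp add: intertwiners_def)
      have "\<pi> ` Orb = Q" unfolding Orb_def Q_def using intertwiner_image_orbit[OF p \<pi>(1) X(2) x] \<pi>(2) by simp
      hence "bij_betw \<pi> (X - Orb) (Y - Q)"
        using b OX by (auto simp: bij_betw_def inj_on_image_set_diff[of \<pi> X] intro: inj_on_subset)
      moreover have "bij_betw \<pi>' (X - Orb) (Y - Q) \<longleftrightarrow> bij_betw \<pi> (X - Orb) (Y - Q)"
        by (rule bij_betw_cong) (simp add: \<pi>(3) restr_def)
      moreover have "\<sigma> z \<in> X - Orb" if "z \<in> X - Orb" for z using rem that by blast
      ultimately show "\<pi>' \<in> intertwiners (X - Orb) \<sigma> (Y - Q) \<rho>"
        using \<pi>(1) unfolding \<pi>(3) by (auto simp: intertwiners_def restr_def)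
    qed
    show "(\<lambda>\<pi> z. if z \<in> Orb then g z else \<pi> z) ` intertwiners (X - Orb) \<sigma> (Y - Q) \<rho> \<subseteq>
       {\<pi> \<in> intertwiners X \<sigma> Y \<rho>. \<pi> x = y}"
    proof
      fix \<pi>' assume "\<pi>' \<in> (\<lambda>\<pi> z. if z \<in> Orb then g z else \<pi> z) ` intertwiners (X - Orb) \<sigma> (Y - Q) \<rho>"
      then obtain \<pi> where \<pi>: "\<pi> \<in> intertwiners (X - Orb) \<sigma> (Y - Q) \<rho>"
        and \<pi>': "\<pi>' = (\<lambda>z. if z \<in> Orb then g z else \<pi> z)" by auto
      have "bij_betw \<pi>' Orb Q \<longleftrightarrow> bij_betw g Orb Q"
        by (rule bij_betw_cong) (simp add: \<pi>')
      moreover have "bij_betw \<pi>' (X - Orb) (Y - Q) \<longleftrightarrow> bij_betw \<pi> (X - Orb) (Y - Q)"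
        by (rule bij_betw_cong) (simp add: \<pi>')
      ultimately have "bij_betw \<pi>' (Orb \<union> (X - Orb)) (Q \<union> (Y - Q))"
        using bijg \<pi> by (intro bij_betw_combine) (auto simp: intertwiners_def)
      hence "bij_betw \<pi>' X Y" using OX QY by (simp add: Un_absorb1)
      moreover have "\<pi>' (\<sigma> z) = \<rho> (\<pi>' z)" if "z \<in> X" for z
      proof (cases "z \<in> Orb")
        case True
        then obtain i where i: "z = (\<sigma> ^^ i) x" unfolding Orb by auto
        have "\<sigma> z = (\<sigma> ^^ Suc i) x" by (simp add: i)
        moreover have "\<sigma> z \<in> Orb" using True unfolding Orb_def by (rule orbit.step)
        ultimately show ?thesis using True g[of "Suc i"] g[of i] by (simp add: \<pi>' i)
      next
        case False
        hence "\<sigma> z \<in> X - Orb" using rem that by blast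
        moreover have "\<pi> (\<sigma> z) = \<rho> (\<pi> z)" using False \<pi> that by (auto simp: intertwiners_def)
        ultimately show ?thesis using False by (simp add: \<pi>')
      qed
      moreover have "\<pi>' z = z" if "z \<notin> X" for z
        using that OX \<pi> by (auto simp: \<pi>' intertwiners_def)
      moreover have "\<pi>' x = y" using g[of 0] permutation_self_in_orbit[OF p(1), of x] by (simp add: \<pi>' Orb_def)
      ultimately show "\<pi>' \<in> {\<pi> \<in> intertwiners X \<sigma> Y \<rho>. \<pi> x = y}" by (simp add: intertwiners_def)
    qed
  qed
  thus ?thesis unfolding restr_def Orb_def Q_def .
qed

text \<open>The intertwiners are grouped by the image of a point x on a cycle of length j. The
  admissible images are the points of Y on cycles of length j, and their number is exactly the
  factor that \<open>centralizer_size\<close> gains from an additional part j.\<close>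

lemma card_intertwiners:
  assumes p: "permutation \<sigma>" "permutation \<rho>"
    and "finite X" "\<sigma> ` X = X" "finite Y" "\<rho> ` Y = Y" "cycle_lengths X \<sigma> = cycle_lengths Y \<rho>"
  shows "finite (intertwiners X \<sigma> Y \<rho>) \<and> card (intertwiners X \<sigma> Y \<rho>) = centralizer_size (cycle_lengths X \<sigma>)"
  using assms(3-)
proof (induction "card X" arbitrary: X Y rule: less_induct)
  case less
  note X = less.prems(1,2) and Y = less.prems(3,4) and eq = less.prems(5)
  show ?case
  proof (cases "X = {}")
    case True
    hence "cycle_lengths X \<sigma> = {#}" by (simp add: cycle_lengths_def)
    moreover from this eq Y have "Y = {}" by (auto simp: cycle_lengths_def mset_set_empty_iff)
    moreover have "intertwiners {} \<sigma> {} \<rho> = {id}" by (auto simp: intertwiners_def fun_eq_iff)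
    ultimately show ?thesis using True by (simp add: centralizer_size_def)
  next
    case False
    then obtain x where x: "x \<in> X" by auto
    define j where "j = card (orbit \<sigma> x)"
    define Yj where "Yj = {y \<in> Y. card (orbit \<rho> y) = j}"
    define M where "M = cycle_lengths (X - orbit \<sigma> x) \<sigma>"
    have cX: "cycle_lengths X \<sigma> = add_mset j M"
      unfolding j_def M_def by (rule cycle_lengths_remove_orbit(1)[OF p(1) X x])
    have finYj: "finite Yj" using Y by (simp add: Yj_def)
    have smaller: "card (X - orbit \<sigma> x) < card X"
      using x permutation_self_in_orbit[OF p(1), of x] X by (intro psubset_card_mono) auto
    have fib: "finite {\<pi> \<in> intertwiners X \<sigma> Y \<rho>. \<pi> x = y} \<and>
       card {\<pi> \<in> intertwiners X \<sigma> Y \<rho>. \<pi> x = y} = centralizer_size M" if y: "y \<in> Yj" for y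
    proof -
      have yY: "y \<in> Y" "card (orbit \<rho> y) = card (orbit \<sigma> x)" using y by (auto simp: Yj_def j_def)
      have "add_mset j M = add_mset j (cycle_lengths (Y - orbit \<rho> y) \<rho>)"
        using cycle_lengths_remove_orbit(1)[OF p(2) Y yY(1)] eq cX yY(2) by (simp add: j_def)
      hence "M = cycle_lengths (Y - orbit \<rho> y) \<rho>" by simp
      hence "finite (intertwiners (X - orbit \<sigma> x) \<sigma> (Y - orbit \<rho> y) \<rho>) \<and>
        card (intertwiners (X - orbit \<sigma> x) \<sigma> (Y - orbit \<rho> y) \<rho>) = centralizer_size M"
        unfolding M_def
        using X Y cycle_lengths_remove_orbit(2)[OF p(1) X x] cycle_lengths_remove_orbit(2)[OF p(2) Y yY(1)]
        by (intro less.hyps[OF smaller]) auto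
      moreover note bij_betw_finite[OF intertwiners_extend_orbit[OF p X Y x yY]]
        bij_betw_same_card[OF intertwiners_extend_orbit[OF p X Y x yY]]
      ultimately show ?thesis by simp
    qed
    have un: "intertwiners X \<sigma> Y \<rho> = (\<Union>y\<in>Yj. {\<pi> \<in> intertwiners X \<sigma> Y \<rho>. \<pi> x = y})"
    proof -
      have "\<pi> x \<in> Yj" if \<pi>: "\<pi> \<in> intertwiners X \<sigma> Y \<rho>" for \<pi>
      proof -
        have b: "bij_betw \<pi> X Y" using \<pi> by (simp add: intertwiners_def)
        have "orbit \<sigma> x \<subseteq> X" using X x by (intro orbit_subset_invariant) auto
        hence "card (\<pi> ` orbit \<sigma> x) = card (orbit \<sigma> x)"
          using b by (intro card_image) (auto simp: bij_betw_def intro: inj_on_subset)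
        thus ?thesis
          using intertwiner_image_orbit[OF p \<pi> X(2) x] b x by (auto simp: Yj_def j_def bij_betw_def)
      qed
      thus ?thesis by auto
    qed
    have "card (\<Union>y\<in>Yj. {\<pi> \<in> intertwiners X \<sigma> Y \<rho>. \<pi> x = y}) = (\<Sum>y\<in>Yj. centralizer_size M)"
      using fib finYj by (subst card_UN_disjoint) auto
    moreover have "finite (\<Union>y\<in>Yj. {\<pi> \<in> intertwiners X \<sigma> Y \<rho>. \<pi> x = y})" using fib finYj by auto
    moreover have "card Yj = j * Suc (count M j)"
      unfolding Yj_def card_points_on_cycles[OF p(2) Y] eq[symmetric] cX by simp
    ultimately show ?thesis unfolding un[symmetric] cX centralizer_size_add_mset by simp
  qed
qed

lemma intertwiners_eq_conjugators:
  assumes "\<sigma> permutes X" "\<rho> permutes X"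
  shows "intertwiners X \<sigma> X \<rho> = {\<pi>. \<pi> permutes X \<and> \<pi> \<circ> \<sigma> = \<rho> \<circ> \<pi>}"
proof -
  have "\<pi> (\<sigma> x) = \<rho> (\<pi> x)" if \<pi>: "\<pi> permutes X" and x: "x \<notin> X" for \<pi> x
    using that assms by (simp add: permutes_not_in)
  moreover have "bij_betw \<pi> X X \<and> (\<forall>x. x \<notin> X \<longrightarrow> \<pi> x = x) \<longleftrightarrow> \<pi> permutes X" for \<pi>
    using bij_imp_permutes[of \<pi> X] permutes_imp_bij[of \<pi> X] permutes_not_in[of \<pi> X] by blast
  ultimately show ?thesis unfolding intertwiners_def fun_eq_iff o_apply by blast
qed

lemma cycle_lengths_conj:
  assumes "permutation \<sigma>" "\<pi> permutes X" "\<rho> \<circ> \<pi> = \<pi> \<circ> \<sigma>"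
  shows "cycle_lengths X \<rho> = cycle_lengths X \<sigma>"
proof -
  have inj: "inj \<pi>" using assms(2) by (rule permutes_inj)
  have "orbit \<rho> (\<pi> x) = \<pi> ` orbit \<sigma> x" for x
    using fun_cong[OF assms(3)] by (intro orbit_inverse[symmetric] permutation_self_in_orbit[OF assms(1)]) (simp add: o_def)
  hence "orbit \<rho> ` \<pi> ` X = (`) \<pi> ` orbit \<sigma> ` X" by (auto simp: image_image)
  hence e: "orbit \<rho> ` X = (`) \<pi> ` orbit \<sigma> ` X" by (simp add: permutes_image[OF assms(2)])
  have "inj_on ((`) \<pi>) (orbit \<sigma> ` X)" using inj by (auto simp: inj_on_def inj_image_eq_iff)
  hence "mset_set ((`) \<pi> ` orbit \<sigma> ` X) = image_mset ((`) \<pi>) (mset_set (orbit \<sigma> ` X))"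
    by (rule image_mset_mset_set[symmetric])
  thus ?thesis unfolding cycle_lengths_def e
    by (simp add: image_mset.compositionality o_def card_image inj_on_subset[OF inj])
qed

section \<open>Representatives of a given cycle type\<close>

definition interval_cycle :: "nat \<Rightarrow> nat \<Rightarrow> nat \<Rightarrow> nat" where
  "interval_cycle s p z = (if z \<in> {s+1..s+p} then if z = s + p then s + 1 else z + 1 else z)"

lemma interval_cycle_permutes: "interval_cycle s p permutes {s+1..s+p}"
proof (rule bij_imp_permutes)
  have "inj_on (interval_cycle s p) {s+1..s+p}"
    by (rule inj_onI) (auto simp: interval_cycle_def split: if_splits)
  moreover have "interval_cycle s p ` {s+1..s+p} \<subseteq> {s+1..s+p}" by (auto simp: interval_cycle_def)
  ultimately show "bij_betw (interval_cycle s p) {s+1..s+p} {s+1..s+p}"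
    by (metis bij_betw_def endo_inj_surj finite_atLeastAtMost)
qed (auto simp: interval_cycle_def)

lemma interval_cycle_permutation: "permutation (interval_cycle s p)"
  using interval_cycle_permutes by (auto simp: permutation_permutes)

lemma cyclic_on_interval_cycle:
  assumes "0 < p"
  shows "cyclic_on (interval_cycle s p) {s+1..s+p}"
proof (rule cyclic_on_singleI[of "s + 1"])
  let ?c = "interval_cycle s p"
  show "s + 1 \<in> {s+1..s+p}" using assms by simp
  have pw: "(?c ^^ i) (s + 1) = s + 1 + i" if "i < p" for i
    using that by (induction i) (auto simp: interval_cycle_def)
  have "{s+1..s+p} \<subseteq> orbit ?c (s + 1)"
  proof
    fix z assume z: "z \<in> {s+1..s+p}"
    hence "z = (?c ^^ (z - (s + 1))) (s + 1)" using pw[of "z - (s + 1)"] by auto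
    thus "z \<in> orbit ?c (s + 1)"
      unfolding orbit_altdef_permutation[OF interval_cycle_permutation] by blast
  qed
  moreover have "orbit ?c (s + 1) \<subseteq> {s+1..s+p}"
    using interval_cycle_permutes assms by (intro permutes_orbit_subset) auto
  ultimately show "{s+1..s+p} = orbit ?c (s + 1)" by blast
qed

lemma sign_interval_cycle: "sign (interval_cycle s (Suc p)) = (-1) ^ p"
proof (induction p)
  case 0
  have "interval_cycle s (Suc 0) = id" by (auto simp: interval_cycle_def fun_eq_iff)
  thus ?case by simp
next
  case (Suc p)
  have "interval_cycle s (Suc (Suc p)) = interval_cycle s (Suc p) \<circ> transpose (s + Suc p) (s + Suc (Suc p))"
    by (auto simp: interval_cycle_def fun_eq_iff transpose_def)
  thus ?case
    by (simp add: sign_compose interval_cycle_permutation permutation_swap_id sign_swap_id Suc del: o_apply)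
qed

text \<open>Each part p becomes a cycle on a fresh interval of length p and contributes the sign
  (-1)^(p-1). The total exponent is written as a sum instead of the difference of d and l, which has
  the same parity.\<close>

lemma exists_permutation_cycle_lengths:
  assumes "\<forall>p\<in>set \<mu>. 0 < p"
  shows "\<exists>\<sigma>. \<sigma> permutes {1..sum_list \<mu>} \<and> cycle_lengths {1..sum_list \<mu>} \<sigma> = mset \<mu> \<and>
    sign \<sigma> = (-1) ^ (sum_list \<mu> + length \<mu>)"
  using assms
proof (induction \<mu>)
  case Nil
  show ?case by (intro exI[of _ id]) (simp add: cycle_lengths_def id_def)
next
  case (Cons p \<mu>)
  define s where "s = sum_list \<mu>"
  obtain \<sigma> where \<sigma>: "\<sigma> permutes {1..s}" "cycle_lengths {1..s} \<sigma> = mset \<mu>"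
      "sign \<sigma> = (-1) ^ (s + length \<mu>)"
    using Cons by (auto simp: s_def)
  have p0: "0 < p" using Cons.prems by simp
  define c where "c = interval_cycle s p"
  have c: "c permutes {s+1..s+p}" "cyclic_on c {s+1..s+p}"
    using p0 by (simp_all only: c_def interval_cycle_permutes cyclic_on_interval_cycle)
  have split: "{1..s+p} = {1..s} \<union> {s+1..s+p}" by auto
  define \<rho> where "\<rho> = \<sigma> \<circ> c"
  have \<rho>: "\<rho> permutes {1..s+p}"
    unfolding \<rho>_def split
    using \<sigma>(1) c(1) by (intro permutes_compose) (auto intro: permutes_subset)
  have o1: "orbit \<rho> x = orbit \<sigma> x" if x: "x \<in> {1..s}" for x
  proof (rule sym, rule orbit_cong0[of _ "{1..s}"])
    show "\<sigma> \<in> {1..s} \<rightarrow> {1..s}" using permutes_in_image[OF \<sigma>(1)] by auto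
    show "\<sigma> y = \<rho> y" if "y \<in> {1..s}" for y
      using that permutes_not_in[OF c(1), of y] by (simp add: \<rho>_def)
  qed (rule x)
  have o2: "orbit \<rho> x = {s+1..s+p}" if x: "x \<in> {s+1..s+p}" for x
  proof -
    have "orbit c x = orbit \<rho> x"
    proof (rule orbit_cong0[of _ "{s+1..s+p}"])
      show "c \<in> {s+1..s+p} \<rightarrow> {s+1..s+p}" using permutes_in_image[OF c(1)] by auto
      show "c y = \<rho> y" if "y \<in> {s+1..s+p}" for y
        using that permutes_in_image[OF c(1), of y] permutes_not_in[OF \<sigma>(1), of "c y"] by (simp add: \<rho>_def)
    qed (rule x)
    thus ?thesis using orbit_cyclic_eq3[OF c(2) x] by simp
  qed
  have "orbit \<rho> ` {1..s+p} = insert {s+1..s+p} (orbit \<sigma> ` {1..s})"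
    unfolding split image_Un using p0 o1 o2 by (auto simp: image_constant_conv)
  moreover have "{s+1..s+p} \<notin> orbit \<sigma> ` {1..s}"
  proof
    assume "{s+1..s+p} \<in> orbit \<sigma> ` {1..s}"
    then obtain x where "x \<in> {1..s}" "{s+1..s+p} = orbit \<sigma> x" by auto
    hence "{s+1..s+p} \<subseteq> {1..s}" using permutes_orbit_subset[OF \<sigma>(1)] by metis
    thus False using p0 by auto
  qed
  ultimately have "cycle_lengths {1..s+p} \<rho> = add_mset p (cycle_lengths {1..s} \<sigma>)"
    by (simp add: cycle_lengths_def)
  moreover have "sign \<rho> = (-1) ^ (s + p + length (p # \<mu>))"
  proof -
    obtain q where q: "p = Suc q" using p0 gr0_implies_Suc by blast
    have "permutation \<sigma>" using \<sigma>(1) by (auto simp: permutation_permutes)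
    hence "sign \<rho> = sign \<sigma> * sign c"
      unfolding \<rho>_def c_def by (intro sign_compose interval_cycle_permutation)
    also have "sign c = (-1) ^ q" unfolding c_def q by (rule sign_interval_cycle)
    finally show ?thesis unfolding \<sigma>(3) q by (simp add: power_add)
  qed
  ultimately show ?case using \<rho> \<sigma>(2) by (intro exI[of _ \<rho>]) (simp add: s_def add.commute)
qed

text \<open>Every permutation \<pi> of X intertwines \<sigma> with exactly one \<rho>, namely its
  conjugate by \<pi>. This partitions the symmetric group into sets of intertwiners of equal size,
  one for each \<rho> with the same cycle lengths.\<close>

lemma card_permutations_cycle_lengths:
  assumes X: "finite X" and s: "\<sigma> permutes X"
  shows "card {\<rho>. \<rho> permutes X \<and> cycle_lengths X \<rho> = cycle_lengths X \<sigma>} * centralizer_size (cycle_lengths X \<sigma>)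
     = fact (card X)"
proof -
  define K where "K = {\<rho>. \<rho> permutes X \<and> cycle_lengths X \<rho> = cycle_lengths X \<sigma>}"
  have perm: "permutation \<rho>" if "\<rho> permutes X" for \<rho> using that X by (auto simp: permutation_permutes)
  have finK: "finite K" unfolding K_def using finite_permutations[OF X] by (rule rev_finite_subset) auto
  have int: "finite (intertwiners X \<sigma> X \<rho>) \<and> card (intertwiners X \<sigma> X \<rho>) = centralizer_size (cycle_lengths X \<sigma>)"
    if "\<rho> \<in> K" for \<rho>
    using that X s by (intro card_intertwiners perm) (auto simp: K_def permutes_image)
  have un: "{\<pi>. \<pi> permutes X} = (\<Union>\<rho>\<in>K. intertwiners X \<sigma> X \<rho>)"
  proof (intro equalityI subsetI)
    fix \<pi> assume "\<pi> \<in> {\<pi>. \<pi> permutes X}"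
    hence \<pi>: "\<pi> permutes X" by simp
    define \<rho> where "\<rho> = \<pi> \<circ> \<sigma> \<circ> inv' \<pi>"
    have \<rho>: "\<rho> permutes X" unfolding \<rho>_def
      by (rule permutes_compose[OF permutes_inv[OF \<pi>] permutes_compose[OF s \<pi>]])
    have e: "\<rho> \<circ> \<pi> = \<pi> \<circ> \<sigma>" by (simp add: \<rho>_def comp_assoc permutes_inv_o[OF \<pi>])
    hence "\<rho> \<in> K" using cycle_lengths_conj[OF perm[OF s] \<pi> e] \<rho> by (simp add: K_def)
    thus "\<pi> \<in> (\<Union>\<rho>\<in>K. intertwiners X \<sigma> X \<rho>)"
      using \<pi> e intertwiners_eq_conjugators[OF s \<rho>] by auto
  next
    fix \<pi> assume "\<pi> \<in> (\<Union>\<rho>\<in>K. intertwiners X \<sigma> X \<rho>)"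
    thus "\<pi> \<in> {\<pi>. \<pi> permutes X}" using intertwiners_eq_conjugators[OF s] by (auto simp: K_def)
  qed
  have cu: "card (\<Union>\<rho>\<in>K. intertwiners X \<sigma> X \<rho>) = (\<Sum>\<rho>\<in>K. centralizer_size (cycle_lengths X \<sigma>))"
  proof (subst card_UN_disjoint[OF finK])
    have "\<rho> = \<rho>'" if "\<rho> \<in> K" "\<rho>' \<in> K" "\<pi> \<in> intertwiners X \<sigma> X \<rho>" "\<pi> \<in> intertwiners X \<sigma> X \<rho>'" for \<rho> \<rho>' \<pi>
    proof -
      have \<pi>: "\<pi> permutes X" "\<rho> \<circ> \<pi> = \<rho>' \<circ> \<pi>"
        using that intertwiners_eq_conjugators[OF s] by (auto simp: K_def)
      hence "\<rho> \<circ> \<pi> \<circ> inv' \<pi> = \<rho>' \<circ> \<pi> \<circ> inv' \<pi>" by simp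
      thus ?thesis by (simp add: comp_assoc permutes_inv_o[OF \<pi>(1)])
    qed
    thus "\<forall>i\<in>K. \<forall>j\<in>K. i \<noteq> j \<longrightarrow> intertwiners X \<sigma> X i \<inter> intertwiners X \<sigma> X j = {}" by blast
  qed (use int in auto)
  have "card {\<pi>. \<pi> permutes X} = card K * centralizer_size (cycle_lengths X \<sigma>)"
    unfolding un cu by simp
  thus ?thesis unfolding K_def card_permutations[OF refl X] by (rule sym)
qed

text \<open>No conjugator is constructed: the number of intertwiners is a factor of a factorial,
  hence nonzero.\<close>

lemma exists_conjugator:
  assumes X: "finite X" and s: "\<sigma> permutes X" and r: "\<rho> permutes X"
    and eq: "cycle_lengths X \<sigma> = cycle_lengths X \<rho>"
  shows "\<exists>\<pi>. \<pi> permutes X \<and> \<pi> \<circ> \<sigma> = \<rho> \<circ> \<pi>"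
proof -
  have "card (intertwiners X \<sigma> X \<rho>) = centralizer_size (cycle_lengths X \<sigma>)"
    using X s r eq card_intertwiners[of \<sigma> \<rho> X X] by (auto simp: permutes_image permutation_permutes)
  moreover have "centralizer_size (cycle_lengths X \<sigma>) \<noteq> 0"
    using card_permutations_cycle_lengths[OF X s] by (metis fact_nonzero mult_0_right)
  ultimately have "intertwiners X \<sigma> X \<rho> \<noteq> {}" by auto
  thus ?thesis using intertwiners_eq_conjugators[OF s r] by auto
qed

section \<open>Hurwitz numbers\<close>

lemma foldr_comp_conj:
  fixes \<pi> :: "'a \<Rightarrow> 'a"
  assumes "bij \<pi>"
  shows "foldr (\<circ>) (map (\<lambda>p. \<pi> \<circ> p \<circ> inv' \<pi>) ps) id = \<pi> \<circ> foldr (\<circ>) ps id \<circ> inv' \<pi>"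
proof (induction ps)
  case Nil
  have "\<pi> \<circ> inv' \<pi> = id" using bij_is_surj[OF assms] by (simp only: surj_iff)
  moreover have "id id = (id :: 'a \<Rightarrow> 'a)" by (rule id_apply)
  ultimately show ?case by (simp only: list.map foldr_Nil comp_id)
next
  case (Cons p ps)
  have i: "inv' \<pi> \<circ> \<pi> = id" using bij_is_inj[OF assms] by simp
  have "foldr (\<circ>) (map (\<lambda>p. \<pi> \<circ> p \<circ> inv' \<pi>) (p # ps)) id =
        (\<pi> \<circ> p \<circ> inv' \<pi>) \<circ> (\<pi> \<circ> foldr (\<circ>) ps id \<circ> inv' \<pi>)"
    by (simp only: list.map foldr_comp_Cons Cons.IH)
  also have "\<dots> = \<pi> \<circ> (p \<circ> ((inv' \<pi> \<circ> \<pi>) \<circ> foldr (\<circ>) ps id)) \<circ> inv' \<pi>" by (simp only: comp_assoc)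
  also have "\<dots> = \<pi> \<circ> foldr (\<circ>) (p # ps) id \<circ> inv' \<pi>" by (simp only: i id_comp foldr_comp_Cons)
  finally show ?case .
qed

lemma gen_orbit_conj:
  assumes "bij \<pi>"
  shows "gen_orbit ((\<lambda>p. \<pi> \<circ> p \<circ> inv' \<pi>) ` S) (\<pi> x) = \<pi> ` gen_orbit S x"
proof (intro equalityI subsetI)
  fix y assume "y \<in> gen_orbit ((\<lambda>p. \<pi> \<circ> p \<circ> inv' \<pi>) ` S) (\<pi> x)"
  thus "y \<in> \<pi> ` gen_orbit S x"
  proof induction
    case (step y q)
    then obtain z p where z: "z \<in> gen_orbit S x" "y = \<pi> z" and p: "p \<in> S" "q = \<pi> \<circ> p \<circ> inv' \<pi>" by auto
    have "q y = \<pi> (p z)" using bij_is_inj[OF assms] by (simp add: z p)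
    thus ?case using gen_orbit.step[OF z(1) p(1)] by simp
  qed (simp add: gen_orbit.base)
next
  fix y assume "y \<in> \<pi> ` gen_orbit S x"
  then obtain z where z: "z \<in> gen_orbit S x" "y = \<pi> z" by blast
  from z(1) have "\<pi> z \<in> gen_orbit ((\<lambda>p. \<pi> \<circ> p \<circ> inv' \<pi>) ` S) (\<pi> x)"
  proof induction
    case (step z p)
    have "(\<pi> \<circ> p \<circ> inv' \<pi>) (\<pi> z) \<in> gen_orbit ((\<lambda>p. \<pi> \<circ> p \<circ> inv' \<pi>) ` S) (\<pi> x)"
      using step.hyps(2) by (intro gen_orbit.step[OF step.IH] imageI)
    moreover have "(\<pi> \<circ> p \<circ> inv' \<pi>) (\<pi> z) = \<pi> (p z)" using bij_is_inj[OF assms] by simp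
    ultimately show ?case by (simp only:)
  qed (rule gen_orbit.base)
  thus "y \<in> gen_orbit ((\<lambda>p. \<pi> \<circ> p \<circ> inv' \<pi>) ` S) (\<pi> x)" by (simp only: z(2))
qed

lemma conn_count_conj:
  assumes \<pi>: "\<pi> permutes X" and e: "\<pi> \<circ> \<sigma> = \<rho> \<circ> \<pi>"
  shows "conn_count X (\<pi> x) \<rho> b = conn_count X x \<sigma> b"
proof -
  define cj where "cj p = \<pi> \<circ> p \<circ> inv' \<pi>" for p
  define cj' where "cj' p = inv' \<pi> \<circ> p \<circ> \<pi>" for p
  have bij: "bij \<pi>" using \<pi> by (rule permutes_bij)
  have ii: "\<pi> \<circ> inv' \<pi> = id" "inv' \<pi> \<circ> \<pi> = id" by (rule permutes_inv_o[OF \<pi>])+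
  have inv1: "cj (cj' p) = p" for p
  proof -
    have "cj (cj' p) = (\<pi> \<circ> inv' \<pi>) \<circ> p \<circ> (\<pi> \<circ> inv' \<pi>)" by (simp only: cj_def cj'_def comp_assoc)
    thus ?thesis by (simp only: ii id_comp comp_id)
  qed
  have inv2: "cj' (cj p) = p" for p
  proof -
    have "cj' (cj p) = (inv' \<pi> \<circ> \<pi>) \<circ> p \<circ> (inv' \<pi> \<circ> \<pi>)" by (simp only: cj_def cj'_def comp_assoc)
    thus ?thesis by (simp only: ii id_comp comp_id)
  qed
  have T: "cj ` transps X = transps X" unfolding cj_def by (rule conj_transps[OF \<pi>])
  have T': "cj' ` transps X = transps X"
  proof -
    have "cj' ` transps X = cj' ` cj ` transps X" by (simp only: T)
    thus ?thesis by (simp add: image_image inv2)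
  qed
  have \<rho>: "\<rho> = cj \<sigma>"
    unfolding cj_def e by (simp only: comp_assoc ii comp_id)
  show ?thesis unfolding conn_count_def
  proof (rule sum.reindex_bij_witness[where i = "map cj" and j = "map cj'"])
    fix \<tau>s assume \<tau>s: "\<tau>s \<in> {\<tau>s. set \<tau>s \<subseteq> transps X \<and> length \<tau>s = b}"
    show "map cj (map cj' \<tau>s) = \<tau>s" by (simp add: inv1 map_idI)
    show "map cj' (map cj \<tau>s) = \<tau>s" by (simp add: inv2 map_idI)
    show "map cj' \<tau>s \<in> {\<tau>s. set \<tau>s \<subseteq> transps X \<and> length \<tau>s = b}" using \<tau>s T' by auto
    show "map cj \<tau>s \<in> {\<tau>s. set \<tau>s \<subseteq> transps X \<and> length \<tau>s = b}" using \<tau>s T by auto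
    define ps where "ps = map cj' \<tau>s"
    have ts: "\<tau>s = map cj ps" by (simp add: ps_def inv1 map_idI)
    have "foldr (\<circ>) (\<rho> # \<tau>s) id = cj (foldr (\<circ>) (\<sigma> # ps) id)"
      unfolding ts \<rho> cj_def list.map(2)[symmetric, of "\<lambda>p. \<pi> \<circ> p \<circ> inv' \<pi>"] by (rule foldr_comp_conj[OF bij])
    hence f: "\<rho> \<circ> foldr (\<circ>) \<tau>s id = cj (\<sigma> \<circ> foldr (\<circ>) ps id)" by (simp only: foldr_comp_Cons)
    have cid: "cj id = id" by (simp only: cj_def comp_id ii)
    have "\<rho> \<circ> foldr (\<circ>) \<tau>s id = id \<longleftrightarrow> \<sigma> \<circ> foldr (\<circ>) ps id = id"
      unfolding f using cid inv2 by metis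
    moreover have "gen_orbit (insert \<rho> (set \<tau>s)) (\<pi> x) = \<pi> ` gen_orbit (insert \<sigma> (set ps)) x"
    proof -
      have "insert \<rho> (set \<tau>s) = cj ` insert \<sigma> (set ps)" by (simp add: \<rho> ts)
      thus ?thesis unfolding cj_def using gen_orbit_conj[OF bij] by metis
    qed
    moreover have "\<pi> ` A = X \<longleftrightarrow> A = X" for A
      using permutes_image[OF \<pi>] permutes_inj[OF \<pi>] by (metis inj_image_eq_iff)
    ultimately show "of_bool (\<sigma> \<circ> foldr (\<circ>) (map cj' \<tau>s) id = id \<and> gen_orbit (insert \<sigma> (set (map cj' \<tau>s))) x = X) =
        (of_bool (\<rho> \<circ> foldr (\<circ>) \<tau>s id = id \<and> gen_orbit (insert \<rho> (set \<tau>s)) (\<pi> x) = X) :: int)"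
      unfolding ps_def[symmetric] by simp
  qed
qed

text \<open>Each generator maps the forward orbit onto itself, hence so does its inverse and the
  whole generated group. Conversely, two points reached from x are connected by going back to x and
  out again. The equivalence for every x also shows that the base point does not matter.\<close>

lemma generates_transitive_iff:
  assumes S: "S \<subseteq> {p. p permutes {1..d}}" and x: "x \<in> {1..d}"
  shows "generates_transitive d S \<longleftrightarrow> gen_orbit S x = {1..d}"
proof
  let ?G = "sym_group d"
  interpret G: group ?G by (rule sym_group_is_group)
  have Sc: "S \<subseteq> carrier ?G" using S by (auto simp: sym_group_carrier)
  define B where "B = gen_orbit S x"
  have sub: "B \<subseteq> {1..d}"
    unfolding B_def
  proof (rule gen_orbit_subset[OF x])
    fix p assume "p \<in> S"
    hence "p permutes {1..d}" using S by auto
    thus "p ` {1..d} \<subseteq> {1..d}" by (simp add: permutes_image)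
  qed
  have img: "\<rho> ` B = B" if "\<rho> \<in> generate ?G S" for \<rho>
    using that
  proof induction
    case one
    show ?case by (simp add: sym_group_one)
  next
    case (incl h)
    show ?case unfolding B_def using S incl x by (intro gen_orbit_image[of "{1..d}"]) auto
  next
    case (inv h)
    have hB: "h ` B = B" unfolding B_def using S inv x by (intro gen_orbit_image[of "{1..d}"]) auto
    have "inv\<^bsub>?G\<^esub> h \<otimes>\<^bsub>?G\<^esub> h = \<one>\<^bsub>?G\<^esub>" using inv Sc by (intro G.l_inv) auto
    hence "inv\<^bsub>?G\<^esub> h \<circ> h = id" by (simp add: sym_group_mult sym_group_one)
    hence "(inv\<^bsub>?G\<^esub> h \<circ> h) ` B = B" by simp
    thus ?case using hB by (simp only: image_comp[symmetric])
  next
    case (eng h1 h2)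
    thus ?case by (simp only: sym_group_mult image_comp[symmetric])
  qed
  {
    assume t: "generates_transitive d S"
    have "{1..d} \<subseteq> B"
    proof
      fix y assume "y \<in> {1..d}"
      then obtain \<rho> where \<rho>: "\<rho> \<in> generate ?G S" "\<rho> x = y"
        using t x unfolding generates_transitive_def by blast
      have "x \<in> B" unfolding B_def by (rule gen_orbit.base)
      thus "y \<in> B" using img[OF \<rho>(1)] \<rho>(2) by auto
    qed
    thus "gen_orbit S x = {1..d}" using sub by (simp add: B_def)
  next
    assume full: "gen_orbit S x = {1..d}"
    have reach: "\<exists>\<rho>\<in>generate ?G S. \<rho> x = y" if "y \<in> gen_orbit S x" for y
      using that
    proof induction
      case base
      show ?case by (intro bexI[of _ "\<one>\<^bsub>?G\<^esub>"] generate.one) (simp add: sym_group_one)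
    next
      case (step y p)
      then obtain \<rho> where "\<rho> \<in> generate ?G S" "\<rho> x = y" by auto
      thus ?case using generate.eng[OF generate.incl[OF step.hyps(2)], of \<rho> ?G]
        by (intro bexI[of _ "p \<otimes>\<^bsub>?G\<^esub> \<rho>"]) (simp_all add: sym_group_mult)
    qed
    show "generates_transitive d S"
      unfolding generates_transitive_def
    proof (intro ballI)
      fix u v assume "u \<in> {1..d}" "v \<in> {1..d}"
      then obtain \<rho> \<rho>' where \<rho>: "\<rho> \<in> generate ?G S" "\<rho> x = u" and \<rho>': "\<rho>' \<in> generate ?G S" "\<rho>' x = v"
        using reach full by metis
      have "inv\<^bsub>?G\<^esub> \<rho> \<otimes>\<^bsub>?G\<^esub> \<rho> = \<one>\<^bsub>?G\<^esub>"
        using \<rho>(1) G.generate_in_carrier[OF Sc] by (intro G.l_inv) auto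
      hence "inv\<^bsub>?G\<^esub> \<rho> \<circ> \<rho> = id" by (simp add: sym_group_mult sym_group_one)
      hence "(inv\<^bsub>?G\<^esub> \<rho>) u = x" using \<rho>(2) by (metis comp_apply id_apply)
      moreover have "\<rho>' \<otimes>\<^bsub>?G\<^esub> inv\<^bsub>?G\<^esub> \<rho> \<in> generate ?G S"
        using G.generate_m_inv_closed[OF Sc \<rho>(1)] \<rho>'(1) by (intro generate.eng)
      ultimately show "\<exists>\<rho>\<in>generate ?G S. \<rho> u = v"
        using \<rho>'(2) by (intro bexI[of _ "\<rho>' \<otimes>\<^bsub>?G\<^esub> inv\<^bsub>?G\<^esub> \<rho>"]) (simp_all add: sym_group_mult)
    qed
  }
qed

section \<open>Conjugacy classes and Hurwitz tuples\<close>

lemma conj_class_eq: "conj_class d \<mu> = {\<sigma>. \<sigma> permutes {1..d} \<and> cycle_lengths {1..d} \<sigma> = mset \<mu>}"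
  by (auto simp: conj_class_def cycle_type_def cycle_lengths_def sym_group_carrier)

lemma cycle_lengths_transpose:
  assumes X: "finite X" and ab: "a \<in> X" "b \<in> X" "a \<noteq> b"
  shows "cycle_lengths X (transpose a b) = mset (2 # replicate (card X - 2) 1)"
proof -
  have img: "transpose a b ` X = X" by (rule permutes_image[OF permutes_swap_id[OF ab(1,2)]])
  have orb: "orbit (transpose a b) a = {a, b}"
  proof (intro equalityI)
    show "orbit (transpose a b) a \<subseteq> {a, b}" by (rule orbit_subset_invariant) (auto simp: transpose_def)
    have "b \<in> orbit (transpose a b) a" using orbit.base[of "transpose a b" a] by simp
    moreover from orbit.step[OF this] have "a \<in> orbit (transpose a b) a" by simp
    ultimately show "{a, b} \<subseteq> orbit (transpose a b) a" by simp
  qed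
  have "orbit (transpose a b) y = {y}" if "y \<in> X - {a, b}" for y
    using that by (simp add: orbit_eq_singleton_iff transpose_def)
  hence "orbit (transpose a b) ` (X - {a, b}) = (\<lambda>y. {y}) ` (X - {a, b})" by (intro image_cong refl)
  moreover have "mset_set ((\<lambda>y. {y}) ` (X - {a, b})) = image_mset (\<lambda>y. {y}) (mset_set (X - {a, b}))"
    by (rule image_mset_mset_set[symmetric]) simp
  ultimately have "cycle_lengths (X - {a, b}) (transpose a b) = replicate_mset (card (X - {a, b})) 1"
    by (simp add: cycle_lengths_def image_mset.compositionality o_def image_mset_const_eq)
  moreover have "card (X - {a, b}) = card X - 2" using X ab by (simp add: card_Diff_subset)
  ultimately show ?thesis
    using cycle_lengths_remove_orbit(1)[OF permutation_swap_id X img ab(1)] ab(3) by (simp add: orb)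
qed

text \<open>An element of this class has the cycle lengths of \<open>transpose 1 2\<close>, so it is
  conjugate to it, and conjugates of transpositions are transpositions.\<close>

lemma conj_class_transpositions:
  assumes "d \<ge> 2"
  shows "conj_class d (2 # replicate (d - 2) 1) = transps {1..d}"
proof (intro equalityI subsetI)
  fix \<tau> assume "\<tau> \<in> conj_class d (2 # replicate (d - 2) 1)"
  hence \<tau>: "\<tau> permutes {1..d}" "cycle_lengths {1..d} \<tau> = mset (2 # replicate (d - 2) 1)"
    by (auto simp: conj_class_eq)
  have 12: "1 \<in> {1..d}" "2 \<in> {1..d}" using assms by auto
  have t: "transpose 1 2 permutes {1..d}" by (rule permutes_swap_id[OF 12])
  have "cycle_lengths {1..d} (transpose 1 2) = cycle_lengths {1..d} \<tau>"
    using cycle_lengths_transpose[OF _ 12] \<tau>(2) by simp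
  then obtain \<pi> where \<pi>: "\<pi> permutes {1..d}" "\<pi> \<circ> transpose 1 2 = \<tau> \<circ> \<pi>"
    using exists_conjugator[OF _ t \<tau>(1)] by auto
  have "\<tau> = \<pi> \<circ> transpose 1 2 \<circ> inv' \<pi>"
    unfolding \<pi>(2) by (simp only: comp_assoc permutes_inv_o[OF \<pi>(1)] comp_id)
  also have "\<dots> = transpose (\<pi> 1) (\<pi> 2)" by (rule conj_transpose[OF permutes_bij[OF \<pi>(1)]])
  finally have "\<tau> = transpose (\<pi> 1) (\<pi> 2)" .
  moreover have "\<pi> 1 \<noteq> \<pi> 2" using permutes_inj[OF \<pi>(1)] by (simp add: inj_eq)
  ultimately show "\<tau> \<in> transps {1..d}"
    using permutes_in_image[OF \<pi>(1)] 12 unfolding transps_def by blast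
next
  fix \<tau> assume \<tau>: "\<tau> \<in> transps {1..d}"
  then obtain a b where "\<tau> = transpose a b" "a \<in> {1..d}" "b \<in> {1..d}" "a \<noteq> b" by (auto simp: transps_def)
  thus "\<tau> \<in> conj_class d (2 # replicate (d - 2) 1)"
    using cycle_lengths_transpose[of "{1..d}" a b] transps_permutes[OF \<tau>] by (simp add: conj_class_eq)
qed

lemma card_hurwitz_tuples:
  assumes d: "d \<ge> 2" and x: "x \<in> {1..d}"
  shows "int (card (hurwitz_tuples d \<mu> b)) = (\<Sum>\<sigma>\<in>conj_class d \<mu>. conn_count {1..d} x \<sigma> b)"
proof -
  define W where "W = {\<tau>s. set \<tau>s \<subseteq> transps {1..d} \<and> length \<tau>s = b}"
  define P where "P \<sigma> \<tau>s \<longleftrightarrow> \<sigma> \<circ> foldr (\<circ>) \<tau>s id = id \<and> gen_orbit (insert \<sigma> (set \<tau>s)) x = {1..d}" for \<sigma> \<tau>s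
  have finW: "finite W" unfolding W_def by (intro finite_lists_length_eq finite_transps) simp
  have finC: "finite (conj_class d \<mu>)"
    unfolding conj_class_eq by (rule finite_subset[OF _ finite_permutations[of "{1..d}"]]) auto
  have "\<sigma>s \<in> hurwitz_tuples d \<mu> b \<longleftrightarrow> (\<exists>\<sigma>\<in>conj_class d \<mu>. \<exists>\<tau>s\<in>W. P \<sigma> \<tau>s \<and> \<sigma>s = \<sigma> # \<tau>s)" for \<sigma>s
  proof (cases \<sigma>s)
    case Nil
    thus ?thesis by (simp add: hurwitz_tuples_def)
  next
    case (Cons \<sigma> \<tau>s)
    have "generates_transitive d (set \<sigma>s) \<longleftrightarrow> gen_orbit (set \<sigma>s) x = {1..d}"
      if "\<sigma> \<in> conj_class d \<mu>" "set \<tau>s \<subseteq> transps {1..d}"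
      using that x Cons by (intro generates_transitive_iff) (auto simp: conj_class_eq dest: transps_permutes)
    thus ?thesis
      unfolding Cons hurwitz_tuples_def P_def W_def foldr_comp_Cons mem_Collect_eq
        conj_class_transpositions[OF d]
      by (auto simp del: o_apply foldr_Cons)
  qed
  hence "hurwitz_tuples d \<mu> b = (\<lambda>(\<sigma>, \<tau>s). \<sigma> # \<tau>s) ` (SIGMA \<sigma>:conj_class d \<mu>. {\<tau>s \<in> W. P \<sigma> \<tau>s})"
    by auto
  moreover have "inj_on (\<lambda>(\<sigma>, \<tau>s). \<sigma> # \<tau>s) (SIGMA \<sigma>:conj_class d \<mu>. {\<tau>s \<in> W. P \<sigma> \<tau>s})"
    by (auto simp: inj_on_def)
  ultimately have "card (hurwitz_tuples d \<mu> b) = (\<Sum>\<sigma>\<in>conj_class d \<mu>. card {\<tau>s \<in> W. P \<sigma> \<tau>s})"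
    using finW finC by (simp add: card_image)
  moreover have "int (card {\<tau>s \<in> W. P \<sigma> \<tau>s}) = conn_count {1..d} x \<sigma> b" for \<sigma>
  proof -
    have "int (card {\<tau>s \<in> W. P \<sigma> \<tau>s}) = (\<Sum>\<tau>s\<in>W. of_bool (P \<sigma> \<tau>s))"
      using finW by (simp add: sum_of_bool_eq Int_def)
    thus ?thesis unfolding conn_count_def W_def P_def .
  qed
  ultimately show ?thesis by simp
qed

lemma centralizer_size_mset: "centralizer_size (mset \<mu>) = prod_list \<mu> * aut_size \<mu>"
  by (simp add: centralizer_size_def aut_size_def prod_mset_prod_list count_mset)

lemma card_fixed_points:
  assumes "permutation \<sigma>" "finite X" "\<sigma> ` X = X"
  shows "card {z \<in> X. \<sigma> z = z} = count (cycle_lengths X \<sigma>) 1"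
proof -
  have "card (orbit \<sigma> z) = 1 \<longleftrightarrow> \<sigma> z = z" for z
    using permutation_self_in_orbit[OF assms(1), of z] orbit_eq_singleton_iff[of \<sigma> z]
    by (metis card_1_singletonE is_singletonI is_singleton_altdef singletonD)
  thus ?thesis using card_points_on_cycles[OF assms, of 1] by simp
qed

text \<open>The transitive count is constant on the class, so the Hurwitz number is the class size
  times one count. The class size times the product of the parts times \<open>aut_size \<mu>\<close>
  is d!, which cancels the automorphism factor; the remaining d! in the denominator is the one of
  the expansion.\<close>

lemma hurwitz_expansion:
  assumes d: "d \<ge> 2" and \<mu>: "is_partition d \<mu>"
  obtains C :: "nat \<Rightarrow> int"
  where "\<And>g. hurwitz g \<mu> = 2 / (fact d * real (prod_list \<mu>)) *
      (\<Sum>k = 1..d choose 2. real_of_int (C k) * real k ^ (d + 2 * g + length \<mu> - 2))"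
    and "\<And>k. (d - 1) choose 2 < k \<Longrightarrow> k < d choose 2 \<Longrightarrow> C k = 0"
    and "C (d choose 2) = 1"
    and "d \<ge> 3 \<Longrightarrow> C ((d - 1) choose 2) = - (int d * int (count_list \<mu> 1))"
proof -
  define X where "X = {1..d}"
  have sum: "sum_list \<mu> = d" and pos: "\<forall>p\<in>set \<mu>. 0 < p" using \<mu> by (auto simp: is_partition_def)
  have "\<mu> \<noteq> []" using sum d by auto
  hence l: "0 < length \<mu>" by (rule length_greater_0_conv[THEN iffD2])
  have X: "finite X" "card X = d" "1 \<in> X" using d by (auto simp: X_def)
  obtain \<sigma> where \<sigma>: "\<sigma> permutes X" "cycle_lengths X \<sigma> = mset \<mu>" "sign \<sigma> = (-1) ^ (d + length \<mu>)"
    using exists_permutation_cycle_lengths[OF pos] unfolding sum X_def by blast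
  obtain c where c: "\<And>b. b > 0 \<Longrightarrow> sign \<sigma> = (-1) ^ b \<Longrightarrow>
       fact d * conn_count X 1 \<sigma> b = 2 * (\<Sum>k=1..d choose 2. c k * int k ^ b)"
    and c_top: "c (d choose 2) = 1" and c_gap: "\<And>k. (d - 1) choose 2 < k \<Longrightarrow> k < d choose 2 \<Longrightarrow> c k = 0"
    and c_second: "3 \<le> d \<Longrightarrow> c ((d - 1) choose 2) = - (int d * int (card {z \<in> X. \<sigma> z = z}))"
    using conn_count_expansion_pos[OF X(1) \<sigma>(1) X(3)] unfolding X(2) by blast
  have fixed: "card {z \<in> X. \<sigma> z = z} = count_list \<mu> 1"
    using card_fixed_points[of \<sigma> X] X(1) \<sigma> by (auto simp: permutation_permutes permutes_image count_mset)
  \<comment> \<open>Conjugation moves the base point from 1 to \<open>\<pi> 1\<close>; it is moved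
    back because transitivity can be tested at any point.\<close>
  have const: "conn_count X 1 \<rho> b = conn_count X 1 \<sigma> b" if "\<rho> \<in> conj_class d \<mu>" for \<rho> b
  proof -
    have \<rho>: "\<rho> permutes X" "cycle_lengths X \<sigma> = cycle_lengths X \<rho>"
      using that \<sigma>(2) by (auto simp: conj_class_eq X_def)
    obtain \<pi> where \<pi>: "\<pi> permutes X" "\<pi> \<circ> \<sigma> = \<rho> \<circ> \<pi>"
      using exists_conjugator[OF X(1) \<sigma>(1) \<rho>] by blast
    have "conn_count X (\<pi> 1) \<rho> b = conn_count X 1 \<sigma> b" by (rule conn_count_conj[OF \<pi>])
    moreover have "conn_count X (\<pi> 1) \<rho> b = conn_count X 1 \<rho> b"
    proof -
      have "gen_orbit (insert \<rho> (set \<tau>s)) (\<pi> 1) = X \<longleftrightarrow> gen_orbit (insert \<rho> (set \<tau>s)) 1 = X"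
        if "set \<tau>s \<subseteq> transps X" for \<tau>s
      proof -
        have sub: "insert \<rho> (set \<tau>s) \<subseteq> {p. p permutes {1..d}}"
          using that \<rho>(1) transps_permutes by (auto simp: X_def)
        have "\<pi> 1 \<in> {1..d}" "1 \<in> {1..d}" using permutes_in_image[OF \<pi>(1)] X(3) by (auto simp: X_def)
        thus ?thesis
          using generates_transitive_iff[OF sub] unfolding X_def by blast
      qed
      thus ?thesis unfolding conn_count_def by (intro sum.cong refl arg_cong[of _ _ of_bool]) auto
    qed
    ultimately show ?thesis by simp
  qed
  have class_size: "card (conj_class d \<mu>) * (prod_list \<mu> * aut_size \<mu>) = fact d"
    using card_permutations_cycle_lengths[OF X(1) \<sigma>(1)] \<sigma>(2)
    by (simp add: conj_class_eq X_def centralizer_size_mset)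
  have main: "hurwitz g \<mu> = 2 / (fact d * real (prod_list \<mu>)) *
      (\<Sum>k = 1..d choose 2. real_of_int (c k) * real k ^ (d + 2 * g + length \<mu> - 2))" for g
  proof -
    define b where "b = d + 2 * g + length \<mu> - 2"
    have b0: "b > 0" unfolding b_def using d l by arith
    \<comment> \<open>So b has the parity of d + l for every genus, and the expansion restricted to
      the right parity always applies.\<close>
    have "b + 2 = d + length \<mu> + 2 * g" using d by (simp add: b_def)
    hence "(-1 :: int) ^ (b + 2) = (-1) ^ (d + length \<mu> + 2 * g)" by simp
    hence sg: "sign \<sigma> = (-1) ^ b" by (simp add: \<sigma>(3) power_add power_mult)
    define N where "N = real (card (conj_class d \<mu>))"
    define K where "K = real_of_int (conn_count X 1 \<sigma> b)"
    define Z where "Z = real (prod_list \<mu>)"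
    define A where "A = real (aut_size \<mu>)"
    define F where "F = (fact d :: real)"
    define T where "T = (\<Sum>k = 1..d choose 2. real_of_int (c k) * real k ^ b)"
    have "int (card (hurwitz_tuples d \<mu> b)) = (\<Sum>\<rho>\<in>conj_class d \<mu>. conn_count X 1 \<sigma> b)"
      using card_hurwitz_tuples[OF d, of 1 \<mu> b] d const unfolding X_def by simp
    hence "real_of_int (int (card (hurwitz_tuples d \<mu> b))) = N * K" by (simp add: N_def K_def)
    hence card: "real (card (hurwitz_tuples d \<mu> b)) = N * K" by simp
    have "real_of_int (fact d * conn_count X 1 \<sigma> b) = real_of_int (2 * (\<Sum>k=1..d choose 2. c k * int k ^ b))"
      using c[OF b0 sg] by simp
    hence FK: "F * K = 2 * T" by (simp add: F_def K_def T_def)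
    have "real (card (conj_class d \<mu>) * (prod_list \<mu> * aut_size \<mu>)) = fact d"
      unfolding class_size by simp
    hence NZA: "N * (Z * A) = F" by (simp add: N_def Z_def A_def F_def)
    have F0: "F \<noteq> 0" by (simp add: F_def)
    hence Z0: "Z \<noteq> 0" using NZA by auto
    have bb: "2 * g + d + length \<mu> - 2 = b" by (simp add: b_def)
    have "hurwitz g \<mu> = A / F * (N * K)"
      unfolding hurwitz_def sum Let_def bb card A_def F_def ..
    also have "\<dots> = 2 / (F * Z) * T"
    proof -
      have "A / F * (N * K) * (F * Z) = (N * (Z * A)) * K" using F0 by simp
      also have "\<dots> = 2 * T" by (simp add: NZA FK)
      finally show ?thesis using F0 Z0 by (simp add: field_simps)
    qed
    finally show ?thesis unfolding F_def Z_def T_def b_def .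
  qed
  show ?thesis by (rule that[OF main c_gap c_top c_second[unfolded fixed]])
qed

section \<open>Asymptotics for large genus\<close>

lemma power_sum_bigo:
  fixes a :: "nat \<Rightarrow> real"
  assumes "finite K" "\<And>k. k \<in> K \<Longrightarrow> real k \<le> M"
  shows "(\<lambda>n. \<Sum>k\<in>K. a k * real k ^ e n) \<in> O(\<lambda>n. M ^ e n)"
proof (rule big_sum_in_bigo)
  fix k assume k: "k \<in> K"
  have "norm (a k * real k ^ e n) \<le> \<bar>a k\<bar> * norm (M ^ e n)" for n
  proof -
    have "real k ^ e n \<le> M ^ e n" using assms(2)[OF k] by (intro power_mono) auto
    also have "\<dots> \<le> norm (M ^ e n)" by simp
    finally show ?thesis by (simp add: abs_mult mult_left_mono)
  qed
  thus "(\<lambda>n. a k * real k ^ e n) \<in> O(\<lambda>n. M ^ e n)" by (intro bigoI[of _ "\<bar>a k\<bar>"]) auto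
qed

theorem theorem1p3:
  fixes d :: nat and \<mu> :: "nat list"
  assumes "d \<ge> 2" and "is_partition d \<mu>"
  shows "(\<exists>C :: nat \<Rightarrow> int.
            (\<forall>g. hurwitz g \<mu> =
               2 / (fact d * real (prod_list \<mu>)) *
                 (\<Sum>k = 1..d choose 2. real_of_int (C k) * real k ^ (d + 2 * g + length \<mu> - 2))) \<and>
            (\<forall>k. (d - 1) choose 2 < k \<and> k < d choose 2 \<longrightarrow> C k = 0) \<and>
            C (d choose 2) = 1 \<and>
            (d \<ge> 3 \<longrightarrow> C ((d - 1) choose 2) = - (int d * int (count_list \<mu> 1)))) \<and>
         (\<lambda>g. hurwitz g \<mu> -
            (2 / (fact d * real (prod_list \<mu>)) *
               real (d choose 2) ^ (d + 2 * g + length \<mu> - 2)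
             - 2 * real (count_list \<mu> 1) / (fact (d - 1) * real (prod_list \<mu>)) *
               real ((d - 1) choose 2) ^ (d + 2 * g + length \<mu> - 2)))
           \<in> O(\<lambda>g. (real ((d - 1) choose 2) - 1) ^ (d + 2 * g + length \<mu> - 2))"
proof -
  obtain C :: "nat \<Rightarrow> int" where C: "\<And>g. hurwitz g \<mu> = 2 / (fact d * real (prod_list \<mu>)) *
      (\<Sum>k = 1..d choose 2. real_of_int (C k) * real k ^ (d + 2 * g + length \<mu> - 2))"
    and gap: "\<And>k. (d - 1) choose 2 < k \<Longrightarrow> k < d choose 2 \<Longrightarrow> C k = 0"
    and top: "C (d choose 2) = 1"
    and second: "d \<ge> 3 \<Longrightarrow> C ((d - 1) choose 2) = - (int d * int (count_list \<mu> 1))"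
    by (rule hurwitz_expansion[OF assms]) blast
  define e where "e g = d + 2 * g + length \<mu> - 2" for g
  define N where "N = d choose 2"
  define M where "M = (d - 1) choose 2"
  define Z where "Z = real (prod_list \<mu>)"
  define m where "m = real (count_list \<mu> 1)"
  define A where "A = 2 / (fact d * Z)"
  define B where "B = 2 * m / (fact (d - 1) * Z)"
  have "\<mu> \<noteq> []" using assms by (auto simp: is_partition_def)
  hence "length \<mu> > 0" by (rule length_greater_0_conv[THEN iffD2])
  hence e0: "e g > 0" for g unfolding e_def using assms(1) by arith
  have NM: "N = M + (d - 1)" using assms(1) choose_two_Suc[of "d - 1"] by (simp add: N_def M_def)
  have AB: "A * (real d * m) = B"
  proof -
    have "fact d = real d * fact (d - 1)" using assms(1) by (simp add: fact_reduce)
    thus ?thesis using assms(1) by (simp add: A_def B_def)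
  qed
  have diff: "hurwitz g \<mu> - (A * real N ^ e g - B * real M ^ e g) =
      A * (\<Sum>k\<in>{1..<M}. real_of_int (C k) * real k ^ e g)" for g
  proof -
    define f where "f k = real_of_int (C k) * real k ^ e g" for k
    \<comment> \<open>The middle set is a singleton or empty: for d = 2, M is 0 and lies outside the
      range of summation.\<close>
    have "(\<Sum>k = 1..N. f k) = (\<Sum>k\<in>{1..<M} \<union> {k. k = M \<and> 1 \<le> M} \<union> {N}. f k)"
    proof (rule sum.mono_neutral_right)
      show "{1..<M} \<union> {k. k = M \<and> 1 \<le> M} \<union> {N} \<subseteq> {1..N}" using NM assms(1) by auto
      show "\<forall>i\<in>{1..N} - ({1..<M} \<union> {k. k = M \<and> 1 \<le> M} \<union> {N}). f i = 0"
      proof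
        fix i assume "i \<in> {1..N} - ({1..<M} \<union> {k. k = M \<and> 1 \<le> M} \<union> {N})"
        hence "M < i" "i < N" by (auto simp: not_less le_less)
        thus "f i = 0" using gap[of i] by (simp add: f_def M_def N_def)
      qed
    qed simp
    also have "\<dots> = (\<Sum>k\<in>{1..<M}. f k) + (\<Sum>k\<in>{k. k = M \<and> 1 \<le> M}. f k) + f N"
      using NM assms(1) by (subst sum.union_disjoint, simp, simp, force, subst sum.union_disjoint) auto
    also have "f N = real N ^ e g" using top by (simp add: f_def N_def)
    finally have "(\<Sum>k = 1..N. f k) = (\<Sum>k\<in>{1..<M}. f k) + (\<Sum>k\<in>{k. k = M \<and> 1 \<le> M}. f k) + real N ^ e g" .
    moreover have "A * ((\<Sum>k\<in>{1..<M}. f k) + (\<Sum>k\<in>{k. k = M \<and> 1 \<le> M}. f k) + real N ^ e g) =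
       A * (\<Sum>k\<in>{1..<M}. f k) - B * real M ^ e g + A * real N ^ e g"
    proof -
      have "A * (\<Sum>k\<in>{k. k = M \<and> 1 \<le> M}. f k) = - (B * real M ^ e g)"
      proof (cases "d \<ge> 3")
        case True
        hence "1 \<le> M" by (simp add: M_def Suc_le_eq)
        hence "{k. k = M \<and> 1 \<le> M} = {M}" by auto
        moreover have "real_of_int (C M) = - (real d * m)"
          using second[OF True] by (simp add: M_def m_def)
        moreover have "A * (- (real d * m) * real M ^ e g) = - (A * (real d * m) * real M ^ e g)"
          by simp
        ultimately show ?thesis by (simp add: f_def AB)
      next
        \<comment> \<open>For d = 2 the sum is empty, and the second main term vanishes as a
          positive power of 0.\<close>
        case False
        hence "M = 0" using assms(1) by (simp add: M_def)
        thus ?thesis using e0[of g] by simp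
      qed
      thus ?thesis by (simp add: algebra_simps)
    qed
    moreover have "hurwitz g \<mu> = A * (\<Sum>k = 1..N. f k)"
      using C[of g] by (simp add: A_def Z_def N_def f_def e_def)
    ultimately show ?thesis by (simp add: f_def)
  qed
  \<comment> \<open>For d \<le> 3 the sum is empty and the two main terms are exact. This is what
    the bound demands for d = 3, where its base M - 1 is 0.\<close>
  have "(\<lambda>g. \<Sum>k\<in>{1..<M}. real_of_int (C k) * real k ^ e g) \<in> O(\<lambda>g. (real M - 1) ^ e g)"
    by (rule power_sum_bigo) auto
  hence "(\<lambda>g. A * (\<Sum>k\<in>{1..<M}. real_of_int (C k) * real k ^ e g)) \<in> O(\<lambda>g. (real M - 1) ^ e g)"
    by simp
  hence "(\<lambda>g. hurwitz g \<mu> - (A * real N ^ e g - B * real M ^ e g)) \<in> O(\<lambda>g. (real M - 1) ^ e g)"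
    unfolding diff .
  hence big: "(\<lambda>g. hurwitz g \<mu> -
            (2 / (fact d * real (prod_list \<mu>)) * real (d choose 2) ^ (d + 2 * g + length \<mu> - 2)
             - 2 * real (count_list \<mu> 1) / (fact (d - 1) * real (prod_list \<mu>)) *
               real ((d - 1) choose 2) ^ (d + 2 * g + length \<mu> - 2)))
           \<in> O(\<lambda>g. (real ((d - 1) choose 2) - 1) ^ (d + 2 * g + length \<mu> - 2))"
    unfolding A_def B_def N_def M_def Z_def m_def e_def .
  show ?thesis using C gap top second big by blast
qed

end
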